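(* Let $F$ be a SIMO LTI system (one input, $p$ outputs) with $\|F\|_2<\infty$, and let $k_1>0$, $\epsilon,\delta>0$. For every stable LTI system $G$ with one input and $q$ outputs and every stable LTI system $L$ with $q$ inputs and one output satisfying $L(z)G(z)=1$, the quantity $$e(G,L):=k_1^2\kappa_{\delta,\epsilon}^2\,\|G\|_2^2\,\|FL\|_2^2$$ satisfies $$e(G,L)\ge k_1^2\kappa_{\delta,\epsilon}^2\Big(\frac1{2\pi}\int_{-\pi}^{\pi}|F(e^{j\omega})|_2\,d\omega\Big)^2,$$ where $|F(e^{j\omega})|_2$ is the Euclidean norm of the vector $F(e^{j\omega})\in\mathbb C^p$. If moreover $\frac1{2\pi}\int_{-\pi}^{\pi}\ln|F(e^{j\omega})|_2\,d\omega>-\infty$ (Paley–Wiener condition), then there is a stable minimum-phase SISO system $G$ (so $q=1$) with $|G(e^{j\omega})|^2=|F(e^{j\omega})|_2$ for almost every $\omega\in[-\pi,\pi)$, and for $L=1/G$ this lower bound is attained.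
   Context: All systems are causal LTI with real coefficients; $\|\cdot\|_2$ for a system is the $\mathcal H_2$ norm, $\|G\|_2^2=\frac1{2\pi}\int_{-\pi}^{\pi}\mathrm{Tr}(G(e^{j\omega})^*G(e^{j\omega}))d\omega$. For $\epsilon,\delta>0$, let $\mathcal Q(x)=\frac1{\sqrt{2\pi}}\int_x^\infty e^{-s^2/2}ds$, $K_\delta=\mathcal Q^{-1}(\delta)$, and $\kappa_{\delta,\epsilon}=\frac1{2\epsilon}(K_\delta+\sqrt{K_\delta^2+2\epsilon})$. The quantity $e(G,L)$ is the mean-squared error of the zero-forcing equalization mechanism which outputs $FL(Gu+w)$ with $w$ Gaussian white noise of covariance $k_1^2\kappa_{\delta,\epsilon}^2\|G\|_2^2I_q$. *)

theory Defs
  imports "HOL-Analysis.Analysis"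
begin

text \<open>A causal LTI system with real coefficients is represented by its impulse
response h :: nat => V, where V is a real vector/matrix space (a column vector
real^'p for a system with one input and p outputs, a row vector real^'q for a
system with q inputs and one output, a matrix real^'q^'p for a p x q system).
Its transfer function is H(z) = sum_k h k z^(-k); we write w = z^(-1).\<close>

text \<open>Stability: the transfer function is analytic on |z| > 1, i.e. the power series
in w = z^(-1) converges absolutely for |w| < 1.\<close>
definition stable_sys :: "(nat \<Rightarrow> 'a::real_normed_vector) \<Rightarrow> bool" where
  "stable_sys h \<longleftrightarrow> (\<forall>r::real. 0 \<le> r \<and> r < 1 \<longrightarrow> summable (\<lambda>k. norm (h k) * r ^ k))"

text \<open>Squared H2 norm (Parseval form: sum of squared Frobenius/Euclidean norms of
the Markov parameters; may be infinite).\<close>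
definition h2sq :: "(nat \<Rightarrow> 'a::real_normed_vector) \<Rightarrow> ennreal" where
  "h2sq h = (\<Sum>k. ennreal ((norm (h k))\<^sup>2))"

text \<open>Transfer function (vector case) evaluated at w = z^(-1).\<close>
definition tfun :: "(nat \<Rightarrow> real ^ 'n) \<Rightarrow> complex \<Rightarrow> complex ^ 'n" where
  "tfun h w = (\<chi> i. \<Sum>k. complex_of_real (h k $ i) * w ^ k)"

text \<open>Frequency response H(e^{j omega}): radial boundary value
lim_{r -> 1^-} H evaluated at w = r e^{-j omega}.\<close>
definition freq :: "(nat \<Rightarrow> real ^ 'n) \<Rightarrow> real \<Rightarrow> complex ^ 'n" where
  "freq h \<omega> = Lim (at_left 1) (\<lambda>r::real. tfun h (complex_of_real r * cis (- \<omega>)))"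

definition series_FL :: "(nat \<Rightarrow> real ^ 'p) \<Rightarrow> (nat \<Rightarrow> real ^ 'q) \<Rightarrow> nat \<Rightarrow> real ^ 'q ^ 'p" where
  "series_FL F L k = (\<chi> i j. \<Sum>m\<le>k. F m $ i * L (k - m) $ j)"

definition series_LG :: "(nat \<Rightarrow> real ^ 'q) \<Rightarrow> (nat \<Rightarrow> real ^ 'q) \<Rightarrow> nat \<Rightarrow> real" where
  "series_LG L G k = (\<Sum>m\<le>k. L m \<bullet> G (k - m))"

definition left_inverse :: "(nat \<Rightarrow> real ^ 'q) \<Rightarrow> (nat \<Rightarrow> real ^ 'q) \<Rightarrow> bool" where
  "left_inverse L G \<longleftrightarrow> (\<forall>k. series_LG L G k = (if k = 0 then 1 else 0))"

definition Qfun :: "real \<Rightarrow> real" where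
  "Qfun x = (1 / sqrt (2 * pi)) * (LBINT s:{x..}. exp (- (s\<^sup>2) / 2))"

definition K_delta :: "real \<Rightarrow> real" where
  "K_delta \<delta> = (THE x. Qfun x = \<delta>)"

definition kappa :: "real \<Rightarrow> real \<Rightarrow> real" where
  "kappa \<delta> \<epsilon> = (1 / (2 * \<epsilon>)) * (K_delta \<delta> + sqrt ((K_delta \<delta>)\<^sup>2 + 2 * \<epsilon>))"

definition err :: "real \<Rightarrow> real \<Rightarrow> real \<Rightarrow> (nat \<Rightarrow> real ^ 'p) \<Rightarrow> (nat \<Rightarrow> real ^ 'q)
    \<Rightarrow> (nat \<Rightarrow> real ^ 'q) \<Rightarrow> ennreal" where
  "err k1 \<delta> \<epsilon> F G L =
     ennreal (k1\<^sup>2 * (kappa \<delta> \<epsilon>)\<^sup>2) * h2sq G * h2sq (series_FL F L)"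

definition err_bound :: "real \<Rightarrow> real \<Rightarrow> real \<Rightarrow> (nat \<Rightarrow> real ^ 'p) \<Rightarrow> ennreal" where
  "err_bound k1 \<delta> \<epsilon> F =
     ennreal (k1\<^sup>2 * (kappa \<delta> \<epsilon>)\<^sup>2 *
       ((1 / (2 * pi)) * (LBINT \<omega>:{-pi..pi}. norm (freq F \<omega>)))\<^sup>2)"

text \<open>Paley-Wiener condition (1/2pi) int ln|F(e^{jw})|_2 dw > -infinity: the
integrand is a.e. positive and its logarithm is integrable (the positive part
of the log is always integrable since ln x <= x).\<close>
definition paley_wiener :: "(nat \<Rightarrow> real ^ 'p) \<Rightarrow> bool" where
  "paley_wiener F \<longleftrightarrow>
     (AE \<omega> in lborel. \<omega> \<in> {-pi..pi} \<longrightarrow> norm (freq F \<omega>) > 0) \<and>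
     set_integrable lborel {-pi..pi} (\<lambda>\<omega>. ln (norm (freq F \<omega>)))"

end

theory Submission
  imports Defs "HOL-Complex_Analysis.Complex_Analysis"
begin

text \<open>
  Inside the disc \<open>L G = 1\<close> gives \<open>|F| \<le> |F L| |G|\<close>, so by Cauchy--Schwarz and Parseval
  the mean of \<open>|F|\<close> over a circle of radius \<open>r < 1\<close> is at most \<open>\<parallel>FL\<parallel> \<parallel>G\<parallel>\<close> (both in \<open>H\<^sub>2\<close> norm);
  Fatou's lemma carries this to the boundary once the radial limits of \<open>F\<close> are known to exist
  almost everywhere. The latter is Fatou's theorem: the coefficients of an \<open>H\<^sub>2\<close> function are
  the Fourier coefficients of some \<open>f \<in> L\<^sup>2\<close>, and the Poisson integral of \<open>f\<close> converges radially at
  every Lebesgue point.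

  The optimal \<open>G\<close> is the outer function \<open>exp (H / 2)\<close>, where \<open>H\<close> is the Herglotz transform of
  \<open>ln |F|\<close>. Jensen's inequality gives \<open>\<parallel>G\<parallel>\<^sup>2 \<le> I\<close>, with \<open>I\<close> the mean of \<open>|F|\<close> on the unit circle. For
  \<open>\<parallel>F/G\<parallel>\<^sup>2 \<le> I\<close>, replace \<open>ln |F|\<close> by \<open>ln (|F| + \<epsilon>)\<close>: then \<open>1/G\<^sub>\<epsilon>\<close> is bounded, \<open>F/G\<^sub>\<epsilon>\<close> lies in
  \<open>H\<^sub>2\<close> with boundary values of squared modulus \<open>|F|\<^sup>2 / (|F| + \<epsilon>) \<le> |F|\<close>, and \<open>\<epsilon> \<rightarrow> 0\<close> on each
  smaller circle. Equality then follows from the lower bound.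
\<close>

subsection \<open>Integration over the circle\<close>

text \<open>The relation \<open>|G|^2 = |F|\<close> is the equality case of Cauchy-Schwarz: for
  scalar \<open>G\<close> one has \<open>|F L| = |F| / |G|\<close>, and this is proportional to
  \<open>|G|\<close> exactly when \<open>|G|^2\<close> is proportional to \<open>|F|\<close>.

  Stability only means analyticity for \<open>|w| < 1\<close> with \<open>w = 1/z\<close>, so
  \<open>G\<close> and \<open>L\<close> need not have boundary values. The estimates involving them
  are therefore made on circles of radius \<open>r < 1\<close>, where all coefficient series
  converge absolutely.

  The obstacle to attainment is that boundary values known almost everywhere do not bound an
  analytic function: the reciprocal of a singular inner function has boundary modulus 1 and is not
  in H2. Membership of \<open>F / G\<close> in H2 has to come before any use of its boundary values,
  and the regularisation by \<epsilon> provides it.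

  Real coefficients come from the evenness of \<open>ln |F|\<close> in the angle. Since
  \<open>freq\<close> is a \<open>Lim\<close>, with a default value where no limit exists, its
  measurability and its symmetry both have to account for these exceptional angles.\<close>

text \<open>The total mass is \<open>2 * pi\<close>, not 1; this is the source of the factors
  \<open>2 * pi\<close> below. A restricted space, rather than an indicator in the integrand, is a
  finite measure, so that bounded measurable functions are integrable.\<close>

definition circ :: "real measure" where
  "circ = restrict_space lborel {-pi..pi}"

lemma space_circ [simp]: "space circ = {-pi..pi}"
  by (simp add: circ_def space_restrict_space)

lemma finite_measure_circ: "finite_measure circ"
  by (rule finite_measureI) (simp add: circ_def emeasure_restrict_space space_restrict_space)

lemma measure_circ: "measure circ {-pi..pi} = 2 * pi"
  by (simp add: circ_def measure_restrict_space)

lemma integrable_circ_iff: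
  fixes f :: "real \<Rightarrow> 'a::{banach, second_countable_topology}"
  shows "integrable circ f \<longleftrightarrow> set_integrable lborel {-pi..pi} f"
  by (simp add: circ_def integrable_restrict_space set_integrable_def)

lemma integral_circ:
  fixes f :: "real \<Rightarrow> 'a::{banach, second_countable_topology}"
  shows "integral\<^sup>L circ f = (LBINT t:{-pi..pi}. f t)"
  by (simp add: circ_def integral_restrict_space set_lebesgue_integral_def)

lemma AE_circ_iff: "(AE t in circ. P t) \<longleftrightarrow> (AE t in lborel. t \<in> {-pi..pi} \<longrightarrow> P t)"
  unfolding circ_def by (rule AE_restrict_space_iff) simp

lemma measurable_circI: "f \<in> borel_measurable borel \<Longrightarrow> f \<in> borel_measurable circ"
  by (simp add: circ_def measurable_restrict_space1)

lemma continuous_measurable_circ: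
  fixes f :: "real \<Rightarrow> 'a::topological_space"
  assumes "continuous_on {-pi..pi} f"
  shows "f \<in> borel_measurable circ"
proof -
  have "sets circ = sets (restrict_space borel {-pi..pi})"
    unfolding circ_def by (rule sets_restrict_space_cong) simp
  with borel_measurable_continuous_on_restrict[OF assms] show ?thesis
    by (metis measurable_cong_sets)
qed

lemma integrable_circ_bounded:
  fixes f :: "real \<Rightarrow> 'a::{banach, second_countable_topology}"
  assumes "f \<in> borel_measurable circ" "\<And>t. t \<in> {-pi..pi} \<Longrightarrow> norm (f t) \<le> B"
  shows "integrable circ f"
  using assms by (intro finite_measure.integrable_const_bound[OF finite_measure_circ, of _ B] AE_I2) auto

lemma integrable_circ_continuous:
  fixes f :: "real \<Rightarrow> 'a::{banach, second_countable_topology}"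
  assumes "continuous_on {-pi..pi} f"
  shows "integrable circ f"
proof -
  have "bounded (f ` {-pi..pi})"
    using assms by (intro compact_imp_bounded compact_continuous_image) auto
  then obtain B where "\<And>t. t \<in> {-pi..pi} \<Longrightarrow> norm (f t) \<le> B"
    unfolding bounded_iff by blast
  then show ?thesis
    using assms by (intro integrable_circ_bounded continuous_measurable_circ)
qed

lemma integrable_mult_bounded:
  fixes f g :: "'a \<Rightarrow> complex"
  assumes "integrable M f" "g \<in> borel_measurable M" "\<And>t. t \<in> space M \<Longrightarrow> norm (g t) \<le> B"
  shows "integrable M (\<lambda>t. g t * f t)"
proof (rule Bochner_Integration.integrable_bound[where f="\<lambda>t. B * norm (f t)"])
  show "integrable M (\<lambda>t. B * norm (f t))"
    using assms by auto
  show "(\<lambda>t. g t * f t) \<in> borel_measurable M"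
    using assms by measurable
  show "AE t in M. norm (g t * f t) \<le> norm (B * norm (f t))"
  proof (rule AE_I2)
    fix t assume "t \<in> space M"
    then have "norm (g t) \<le> B" using assms by auto
    then have "norm (g t * f t) \<le> B * norm (f t)"
      by (simp add: norm_mult mult_right_mono)
    then show "norm (g t * f t) \<le> norm (B * norm (f t))"
      by auto
  qed
qed

lemma integrable_mult_bounded_real:
  fixes f g :: "'a \<Rightarrow> real"
  assumes "integrable M f" "g \<in> borel_measurable M" "\<And>t. t \<in> space M \<Longrightarrow> \<bar>g t\<bar> \<le> B"
  shows "integrable M (\<lambda>t. g t * f t)"
proof -
  have "integrable M (\<lambda>t. complex_of_real (g t) * complex_of_real (f t))"
    using assms by (intro integrable_mult_bounded[where B=B]) auto
  then have "integrable M (\<lambda>t. Re (complex_of_real (g t) * complex_of_real (f t)))"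
    by (rule integrable_Re)
  then show ?thesis by simp
qed

section \<open>Termwise integration, orthogonality and Parseval\<close>

text \<open>The terms are dominated by \<open>norm (c k) * norm (g t)\<close>, whose integrals are
  summable, so sum and integral commute. Arbitrary factors \<open>e k\<close> of modulus at most 1
  cover the exponentials of either sign.\<close>

lemma
  fixes c :: "nat \<Rightarrow> complex"
  assumes c: "summable (\<lambda>k. norm (c k))"
    and e: "\<And>k. e k \<in> borel_measurable M" "\<And>k t. norm (e k t) \<le> 1"
    and g: "integrable M g"
  shows integrable_bounded_series: "integrable M (\<lambda>t. (\<Sum>k. c k * e k t) * g t)"
    and sums_integral_bounded_series:
      "(\<lambda>k. c k * (LINT t|M. e k t * g t)) sums (LINT t|M. (\<Sum>k. c k * e k t) * g t)"
proof -
  have le: "norm (c k * e k t) \<le> norm (c k)" for k t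
    using e(2)[of k t] by (simp add: norm_mult mult_left_le)
  have s: "summable (\<lambda>k. norm (c k * e k t))" for t
    by (rule summable_comparison_test'[OF c, of 0]) (use le in auto)
  have eg: "integrable M (\<lambda>t. e k t * g t)" for k
    using e g by (intro integrable_mult_bounded[where B=1]) auto
  have i: "integrable M (\<lambda>t. c k * e k t * g t)" for k
    using eg[of k] by (simp add: mult.assoc)
  have a: "AE t in M. summable (\<lambda>k. norm (c k * e k t * g t))"
    by (rule AE_I2) (use s in \<open>auto simp: norm_mult intro: summable_mult2\<close>)
  have b: "summable (\<lambda>k. LINT t|M. norm (c k * e k t * g t))"
  proof (rule summable_comparison_test')
    show "summable (\<lambda>k. norm (c k) * (LINT t|M. norm (g t)))"
      using c by (rule summable_mult2)
    fix k :: nat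
    have "(LINT t|M. norm (c k * e k t * g t)) \<le> (LINT t|M. norm (c k) * norm (g t))"
    proof (rule integral_mono)
      show "integrable M (\<lambda>t. norm (c k * e k t * g t))" using i by (rule integrable_norm)
      show "integrable M (\<lambda>t. norm (c k) * norm (g t))" using g by auto
      show "norm (c k * e k t * g t) \<le> norm (c k) * norm (g t)" for t
        using le[of k t] by (simp add: norm_mult[of _ "g t"] mult_right_mono)
    qed
    then show "norm (LINT t|M. norm (c k * e k t * g t)) \<le> norm (c k) * (LINT t|M. norm (g t))"
      by simp
  qed
  have eq: "(\<Sum>k. c k * e k t * g t) = (\<Sum>k. c k * e k t) * g t" for t
    using summable_norm_cancel[OF s] by (rule suminf_mult2[symmetric])
  show "integrable M (\<lambda>t. (\<Sum>k. c k * e k t) * g t)"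
    using integrable_suminf[OF i a b] by (simp add: eq)
  show "(\<lambda>k. c k * (LINT t|M. e k t * g t)) sums (LINT t|M. (\<Sum>k. c k * e k t) * g t)"
    using sums_integral[OF i a b] unfolding eq by (simp add: mult.assoc)
qed

lemma integral_circ_cis:
  fixes n :: int
  shows "(LINT t|circ. cis (n * t)) = (if n = 0 then 2 * pi else 0)"
proof (cases "n = 0")
  case True
  then show ?thesis
    by (simp add: measure_circ scaleR_conv_of_real)
next
  case False
  define P where "P t = cis (n * t) / (\<i> * n)" for t :: real
  have "(P has_vector_derivative cis (n * t)) (at t within A)" for t :: real and A
  proof -
    have "((\<lambda>z. exp (\<i> * (n * z)) / (\<i> * n)) has_field_derivative exp (\<i> * (n * t))) (at (of_real t))"
      using False by (auto intro!: derivative_eq_intros simp: mult_ac)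
    from has_vector_derivative_real_field[OF this]
    have "((\<lambda>t. exp (\<i> * (n * t)) / (\<i> * n)) has_vector_derivative exp (\<i> * (n * t))) (at t within A)"
      by simp
    then show ?thesis using False by (simp add: P_def[abs_def] cis_conv_exp)
  qed
  then have "(LBINT t:{-pi..pi}. cis (n * t)) = P pi - P (-pi)"
    unfolding set_lebesgue_integral_def
    by (intro integral_FTC_atLeastAtMost) (auto intro!: continuous_intros)
  moreover have "cis (n * pi) = cis (n * (- pi))"
    by (auto simp: complex_eq_iff sin_times_pi_eq_0)
  ultimately show ?thesis
    using False by (simp add: integral_circ P_def)
qed

lemma integral_circ_cis_cis:
  fixes j k :: int
  shows "(LINT t|circ. cis (j * t) * cis (k * t)) = (if j + k = 0 then 2 * pi else 0)"
  using integral_circ_cis[of "j + k"] by (simp add: cis_mult algebra_simps)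

text \<open>On a circle a transfer function is a series in \<open>cis (- t)\<close>, because its
  variable is \<open>1/z\<close>; coefficient \<open>m\<close> is therefore extracted by the
  opposite exponential \<open>cis (m * t)\<close>.\<close>

lemma integral_circ_cis_series:
  fixes c :: "nat \<Rightarrow> complex"
  assumes c: "summable (\<lambda>k. norm (c k))"
  shows "(LINT t|circ. (\<Sum>k. c k * cis (- real k * t)) * cis (real m * t)) = 2 * pi * c m"
proof -
  have "(\<lambda>k. c k * (LINT t|circ. cis (- real k * t) * cis (real m * t))) sums
     (LINT t|circ. (\<Sum>k. c k * cis (- real k * t)) * cis (real m * t))"
    using c by (intro sums_integral_bounded_series integrable_circ_continuous measurable_circI
        borel_measurable_continuous_onI continuous_intros) auto
  moreover have "c k * (LINT t|circ. cis (- real k * t) * cis (real m * t)) =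
      (if k = m then 2 * pi * c m else 0)" for k
    using integral_circ_cis_cis[of "- int k" "int m"] by auto
  ultimately show ?thesis
    using sums_single[of m "\<lambda>_. 2 * pi * c m"] by (simp add: sums_unique2)
qed

text \<open>Integrating the series of \<open>f\<close> termwise against \<open>cnj f\<close>
  produces the conjugates of the extracted coefficients, so no double series appears. Absolute
  summability gives uniform convergence and hence continuity.\<close>

lemma parseval_circ:
  fixes c :: "nat \<Rightarrow> complex"
  assumes c: "summable (\<lambda>k. norm (c k))"
  shows "(\<lambda>k. 2 * pi * (norm (c k))\<^sup>2) sums (LINT t|circ. (norm (\<Sum>k. c k * cis (- real k * t)))\<^sup>2)"
    and "integrable circ (\<lambda>t. (norm (\<Sum>k. c k * cis (- real k * t)))\<^sup>2)"
    and "continuous_on A (\<lambda>t. \<Sum>k. c k * cis (- real k * t))"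
proof -
  define f where "f t = (\<Sum>k. c k * cis (- real k * t))" for t
  have cont: "continuous_on A f" for A
  proof (rule uniform_limit_theorem)
    show "uniform_limit A (\<lambda>n t. \<Sum>k<n. c k * cis (- real k * t)) f sequentially"
      unfolding f_def
      by (rule Weierstrass_m_test[OF _ c]) (simp add: norm_mult)
  qed (auto intro!: always_eventually continuous_intros)
  then show "continuous_on A (\<lambda>t. \<Sum>k. c k * cis (- real k * t))"
    by (simp add: f_def)
  have ii: "integrable circ (\<lambda>t. cnj (f t))"
    by (intro integrable_circ_continuous continuous_intros cont)
  have "(\<lambda>k. c k * (LINT t|circ. cis (- real k * t) * cnj (f t))) sums
     (LINT t|circ. (\<Sum>k. c k * cis (- real k * t)) * cnj (f t))"
    using c by (intro sums_integral_bounded_series ii measurable_circI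
        borel_measurable_continuous_onI continuous_intros) auto
  moreover have "(LINT t|circ. cis (- real k * t) * cnj (f t)) = 2 * pi * cnj (c k)" for k
  proof -
    have "(LINT t|circ. cis (- real k * t) * cnj (f t)) = (LINT t|circ. cnj (f t * cis (real k * t)))"
      by (simp add: mult.commute flip: cis_cnj)
    also have "\<dots> = cnj (2 * pi * c k)"
      using integral_circ_cis_series[OF c, of k]
      unfolding f_def[symmetric] by (simp only: Bochner_Integration.integral_cnj)
    finally show ?thesis by simp
  qed
  moreover have "c k * (2 * pi * cnj (c k)) = complex_of_real (2 * pi * (norm (c k))\<^sup>2)" for k
    by (simp add: complex_norm_square mult_ac del: of_real_power)
  ultimately have "(\<lambda>k. complex_of_real (2 * pi * (norm (c k))\<^sup>2)) sums
      (LINT t|circ. complex_of_real ((norm (f t))\<^sup>2))"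
    unfolding f_def[symmetric] by (simp only: complex_norm_square)
  then show "(\<lambda>k. 2 * pi * (norm (c k))\<^sup>2) sums (LINT t|circ. (norm (\<Sum>k. c k * cis (- real k * t)))\<^sup>2)"
    unfolding f_def[symmetric] by (simp only: integral_complex_of_real sums_of_real_iff)
  show "integrable circ (\<lambda>t. (norm (\<Sum>k. c k * cis (- real k * t)))\<^sup>2)"
    unfolding f_def[symmetric] by (intro integrable_circ_continuous continuous_intros cont)
qed

subsection \<open>The Poisson kernel\<close>

definition poisson :: "real \<Rightarrow> real \<Rightarrow> real" where
  "poisson r s = (1 - r\<^sup>2) / (1 - 2 * r * cos s + r\<^sup>2)"

text \<open>The denominator is the squared distance from \<open>r * cis s\<close> to 1, split into a
  radial and an angular part; each part alone serves as a lower bound below.\<close>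

lemma poisson_denominator:
  fixes r :: real
  shows
  "1 - 2 * r * cos s + r\<^sup>2 = (1 - r)\<^sup>2 + 2 * r * (1 - cos s)"
  by (simp add: power2_eq_square algebra_simps)

lemma poisson_denominator_ge:
  fixes r :: real
  assumes "0 \<le> r"
  shows "(1 - r)\<^sup>2 \<le> 1 - 2 * r * cos s + r\<^sup>2"
  using assms by (simp add: poisson_denominator)

lemma poisson_denominator_pos:
  fixes r :: real
  assumes "0 \<le> r" "r < 1"
  shows "0 < 1 - 2 * r * cos s + r\<^sup>2"
  using poisson_denominator_ge[OF assms(1), of s] assms(2)
  by (smt (verit) zero_less_power2)

lemma poisson_nonneg:
  assumes "0 \<le> r" "r < 1"
  shows "0 \<le> poisson r s"
  using poisson_denominator_pos[OF assms, of s] assms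
  by (simp add: poisson_def power_le_one)

lemma poisson_minus [simp]: "poisson r (- s) = poisson r s"
  by (simp add: poisson_def)

lemma continuous_on_poisson [continuous_intros]:
  fixes f :: "real \<Rightarrow> real"
  assumes "0 \<le> r" "r < 1" "continuous_on A f"
  shows "continuous_on A (\<lambda>x. poisson r (f x))"
  unfolding poisson_def using assms poisson_denominator_pos[OF assms(1,2)]
  by (intro continuous_intros) (auto simp: less_imp_neq[symmetric])

lemma poisson_bound:
  assumes "0 \<le> r" "r < 1"
  shows "poisson r s \<le> 2 / (1 - r)\<^sup>2"
  unfolding poisson_def
  using poisson_denominator_ge[OF assms(1), of s] assms
  by (intro frac_le) (auto simp: power_le_one intro: order_trans[of _ 0])

text \<open>With \<open>z = r * cis s\<close> the kernel is \<open>(1 - |z|^2) / |1 - z|^2\<close>,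
  the sum of the geometric series in \<open>cnj z\<close> and in \<open>z\<close>. The second starts
  at exponent 1 so that the constant term is counted once.\<close>

lemma poisson_series:
  assumes "0 \<le> r" "r < 1"
  shows "complex_of_real (poisson r s) =
    (\<Sum>k. of_real r ^ k * cis (- real k * s)) + (\<Sum>k. of_real r ^ Suc k * cis (real (Suc k) * s))"
proof -
  define z where "z = of_real r * cis s"
  have nz: "norm z < 1" using assms by (simp add: z_def norm_mult)
  have ne: "1 - z \<noteq> 0" "1 - cnj z \<noteq> 0"
  proof -
    have "z \<noteq> 1" using nz by auto
    then show "1 - z \<noteq> 0" "1 - cnj z \<noteq> 0" by (auto simp: complex_eq_iff)
  qed
  have p: "z ^ k = of_real r ^ k * cis (real k * s)" "cnj z ^ k = of_real r ^ k * cis (- real k * s)" for k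
    by (simp_all add: z_def power_mult_distrib Complex.DeMoivre cis_cnj)
  have "(\<Sum>k. cnj z ^ k) = 1 / (1 - cnj z)"
    using nz by (intro suminf_geometric) simp
  moreover have "(\<Sum>k. z ^ Suc k) = z / (1 - z)"
    using nz by (simp add: suminf_mult summable_geometric suminf_geometric)
  ultimately have "(\<Sum>k. cnj z ^ k) + (\<Sum>k. z ^ Suc k) = (1 - z * cnj z) / ((1 - z) * (1 - cnj z))"
    using ne by (simp add: add_frac_eq algebra_simps)
  also have "z * cnj z = of_real (r\<^sup>2)"
    by (simp add: z_def power2_eq_square mult_ac cis_mult cis_cnj)
  also have "(1 - z) * (1 - cnj z) = of_real (1 - 2 * r * cos s + r\<^sup>2)"
    using sin_cos_squared_add[of s]
    by (simp add: z_def complex_eq_iff power2_eq_square algebra_simps)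
       (simp add: algebra_simps flip: distrib_left)
  finally show ?thesis
    by (simp only: p poisson_def of_real_divide of_real_diff of_real_1)
qed

lemma summable_norm_power_cis:
  assumes "0 \<le> r" "r < 1"
  shows "summable (\<lambda>k. norm (complex_of_real r ^ k * cis (f k)))"
    and "summable (\<lambda>k. norm (complex_of_real r ^ Suc k * cis (f k)))"
  using assms by (auto simp: norm_mult norm_power summable_geometric summable_mult)

text \<open>The Poisson integral becomes a power series in \<open>r * cis (- \<theta>)\<close> plus
  one in its conjugate. If the coefficients in the second sum vanish, only the analytic half
  survives; for real data the halves are conjugate up to the constant term.\<close>

lemma poisson_integral_series:
  fixes f :: "real \<Rightarrow> complex"
  assumes r: "0 \<le> r" "r < 1" and f: "integrable circ f"
  shows "(LINT t|circ. of_real (poisson r (\<theta> - t)) * f t) =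
     (\<Sum>k. of_real r ^ k * cis (- real k * \<theta>) * (LINT t|circ. cis (real k * t) * f t)) +
     (\<Sum>k. of_real r ^ Suc k * cis (real (Suc k) * \<theta>) * (LINT t|circ. cis (- real (Suc k) * t) * f t))"
    (is "_ = suminf ?A + suminf ?B")
proof -
  let ?a = "\<lambda>t. (\<Sum>k. (of_real r ^ k * cis (- real k * \<theta>)) * cis (real k * t))"
  let ?b = "\<lambda>t. (\<Sum>k. (of_real r ^ Suc k * cis (real (Suc k) * \<theta>)) * cis (- real (Suc k) * t))"
  have m: "(\<lambda>t. cis (x * t)) \<in> borel_measurable circ" for x
    by (intro continuous_measurable_circ continuous_intros)
  note ia = integrable_bounded_series[OF summable_norm_power_cis(1)[OF r, of "\<lambda>k. - real k * \<theta>"] m _ f]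
  note ib = integrable_bounded_series[OF summable_norm_power_cis(2)[OF r, of "\<lambda>k. real (Suc k) * \<theta>"] m _ f]
  have "of_real (poisson r (\<theta> - t)) = ?a t + ?b t" for t
  proof -
    have "cis (- real k * \<theta>) * cis (real k * t) = cis (- real k * (\<theta> - t))" for k
      by (simp add: cis_mult algebra_simps)
    moreover have "cis (real (Suc k) * \<theta>) * cis (- real (Suc k) * t) = cis (real (Suc k) * (\<theta> - t))" for k
      unfolding cis_mult by (simp add: algebra_simps)
    ultimately show ?thesis
      unfolding poisson_series[OF r] mult.assoc by presburger
  qed
  then have "(LINT t|circ. of_real (poisson r (\<theta> - t)) * f t) =
      (LINT t|circ. ?a t * f t + ?b t * f t)"
    by (simp only: distrib_right)
  also have "\<dots> = (LINT t|circ. ?a t * f t) + (LINT t|circ. ?b t * f t)"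
    by (intro Bochner_Integration.integral_add ia ib) auto
  also have "(LINT t|circ. ?a t * f t) = suminf ?A"
    by (rule sums_unique, rule sums_integral_bounded_series[OF summable_norm_power_cis(1)[OF r] m _ f]) auto
  also have "(LINT t|circ. ?b t * f t) = suminf ?B"
    by (rule sums_unique, rule sums_integral_bounded_series[OF summable_norm_power_cis(2)[OF r] m _ f]) auto
  finally show ?thesis .
qed

text \<open>The expansion is applied to the constant 1, whose only nonzero Fourier coefficient is
  the zeroth.\<close>

lemma integral_poisson:
  assumes r: "0 \<le> r" "r < 1"
  shows "(LINT t|circ. poisson r (\<theta> - t)) = 2 * pi"
proof -
  have c: "(LINT t|circ. cis (real k * t)) = (if k = 0 then 2 * pi else 0)" 
      "(LINT t|circ. cis (- real (Suc k) * t)) = 0" for k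
    using integral_circ_cis[of "int k"] integral_circ_cis[of "- int (Suc k)"] by (auto simp: algebra_simps)
  have "complex_of_real (LINT t|circ. poisson r (\<theta> - t)) =
     (LINT t|circ. of_real (poisson r (\<theta> - t)) * 1)"
    by simp
  also have "\<dots> = (\<Sum>k. of_real r ^ k * cis (- real k * \<theta>) * (if k = 0 then 2 * pi else 0))"
    by (subst poisson_integral_series[OF r]) (auto simp only: c mult_1_right mult_zero_right suminf_zero add_0_right integrable_circ_continuous continuous_on_const)
  also have "\<dots> = 2 * pi"
    by (subst suminf_finite[of "{0}"]) auto
  finally show ?thesis
    by (metis of_real_eq_iff)
qed

lemma integrable_poisson:
  assumes r: "0 \<le> r" "r < 1" and f: "integrable circ f"
  shows "integrable circ (\<lambda>t. of_real (poisson r (\<theta> - t)) * f t :: complex)"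
  using poisson_bound[OF r] poisson_nonneg[OF r]
  by (intro integrable_mult_bounded[OF f, where B="2 / (1 - r)\<^sup>2"] continuous_measurable_circ continuous_intros r) auto

section \<open>Integration by parts, and the size of the kernel and its derivative\<close>

text \<open>As \<open>\<psi>\<close> is merely integrable, its primitive need not be differentiable
  everywhere. Instead \<open>g \<beta> - g s\<close> is the integral of \<open>g'\<close> over
  \<open>[s, \<beta>]\<close>, and Fubini is applied to \<open>g' x * \<psi> s\<close> on the
  triangle \<open>s \<le> x\<close>.\<close>

lemma integration_by_parts_L1:
  fixes g g' :: "real \<Rightarrow> real" and \<psi> :: "real \<Rightarrow> complex"
  assumes \<beta>: "0 \<le> \<beta>"
    and g: "\<And>x. (g has_real_derivative g' x) (at x)"
    and g': "continuous_on UNIV g'"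
    and \<psi>: "set_integrable lborel {0..\<beta>} \<psi>"
  shows "(LBINT s:{0..\<beta>}. g s *\<^sub>R \<psi> s) =
     g \<beta> *\<^sub>R (LBINT s:{0..\<beta>}. \<psi> s) - (LBINT x:{0..\<beta>}. g' x *\<^sub>R (LBINT s:{0..x}. \<psi> s))"
    and "set_integrable lborel {0..\<beta>} (\<lambda>x. g' x *\<^sub>R (LBINT s:{0..x}. \<psi> s))"
proof -
  define u where "u s = indicator {0..\<beta>} s *\<^sub>R \<psi> s" for s
  define v where "v x = indicator {0..\<beta>} x * g' x" for x :: real
  define f where "f s x = (if s \<le> x then v x *\<^sub>R u s else 0)" for s x
  have [measurable]: "u \<in> borel_measurable borel" and ui: "integrable lborel u"
    using \<psi> by (auto simp: u_def[abs_def] set_integrable_def dest: borel_measurable_integrable)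
  have [measurable]: "g' \<in> borel_measurable borel"
    using g' by (rule borel_measurable_continuous_onI)
  then have [measurable]: "v \<in> borel_measurable borel"
    unfolding v_def[abs_def] by measurable
  obtain C where C: "\<And>x. x \<in> {0..\<beta>} \<Longrightarrow> \<bar>g' x\<bar> \<le> C"
  proof -
    have "bounded (g' ` {0..\<beta>})"
      using g' by (intro compact_imp_bounded compact_continuous_image) (auto intro: continuous_on_subset)
    then show ?thesis using that unfolding bounded_iff real_norm_def by blast
  qed
  have C0: "0 \<le> C" using C[of 0] \<beta> by auto
  have fle: "norm (f s x) \<le> (C * norm (u s)) * indicator {0..\<beta>} x" for s x
    using C[of x] C0 by (auto simp: f_def v_def indicator_def abs_mult mult_right_mono)
  have fm: "case_prod f \<in> borel_measurable (lborel \<Otimes>\<^sub>M lborel)"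
    unfolding f_def[abs_def] by measurable
  have bi: "integrable lborel (\<lambda>x. (C * norm (u s)) * indicator {0..\<beta>} x :: real)" for s
    using \<beta> by (intro integrable_mult_right integrable_real_indicator) auto
  have i2: "integrable lborel (f s)" for s
  proof (rule Bochner_Integration.integrable_bound[OF bi[of s]])
    show "f s \<in> borel_measurable lborel" unfolding f_def[abs_def] by measurable
    show "AE x in lborel. norm (f s x) \<le> norm (C * cmod (u s) * indicat_real {0..\<beta>} x)"
      using fle[of s] by (intro AE_I2) (metis abs_ge_self order_trans real_norm_def)
  qed
  have i1: "integrable lborel (\<lambda>s. LINT x|lborel. norm (f s x))"
  proof (rule Bochner_Integration.integrable_bound[where f="\<lambda>s. (C * norm (u s)) * \<beta>"])
    show "integrable lborel (\<lambda>s. C * norm (u s) * \<beta>)" using ui by auto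
    show "(\<lambda>s. LINT x|lborel. norm (f s x)) \<in> borel_measurable lborel"
      using fm by measurable
    have "norm (LINT x|lborel. norm (f s x)) \<le> norm (C * norm (u s) * \<beta>)" for s
    proof -
      have "(LINT x|lborel. norm (f s x)) \<le> (LINT x|lborel. (C * norm (u s)) * indicator {0..\<beta>} x)"
        by (rule integral_mono[OF integrable_norm[OF i2] bi fle])
      also have "\<dots> = C * norm (u s) * \<beta>"
        using \<beta> by simp
      finally show ?thesis using C0 \<beta> by (simp add: abs_mult)
    qed
    then show "AE s in lborel. norm (LINT x|lborel. norm (f s x)) \<le> norm (C * norm (u s) * \<beta>)"
      by (intro AE_I2) blast
  qed
  have prod: "integrable (lborel \<Otimes>\<^sub>M lborel) (case_prod f)"
    using lborel_pair.Fubini_integrable[OF fm] i1 i2 by simp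
  have in1: "(LINT x|lborel. f s x) = g \<beta> *\<^sub>R u s - indicator {0..\<beta>} s *\<^sub>R (g s *\<^sub>R \<psi> s)" for s
  proof (cases "s \<in> {0..\<beta>}")
    case True
    have "f s x = indicator {s..\<beta>} x *\<^sub>R (g' x *\<^sub>R u s)" for x
      using True by (auto simp: f_def v_def indicator_def)
    then have "(LINT x|lborel. f s x) = g \<beta> *\<^sub>R u s - g s *\<^sub>R u s"
      using True g g'
      by (simp only:) (intro integral_FTC_atLeastAtMost,
          auto intro!: continuous_intros has_vector_derivative_scaleR derivative_eq_intros
           elim: continuous_on_subset intro: has_field_derivative_at_within)
    then show ?thesis using True by (simp add: u_def)
  next
    case False
    then show ?thesis by (simp add: f_def u_def cong: if_cong)
  qed
  have in2: "(LINT s|lborel. f s x) = indicator {0..\<beta>} x *\<^sub>R (g' x *\<^sub>R (LBINT s:{0..x}. \<psi> s))" for x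
  proof -
    have "f s x = v x *\<^sub>R (indicator {0..x} s *\<^sub>R \<psi> s)" for s
      by (auto simp: f_def u_def v_def indicator_def)
    then have "(LINT s|lborel. f s x) = v x *\<^sub>R (LBINT s:{0..x}. \<psi> s)"
      by (simp only: set_lebesgue_integral_def integral_scaleR_right)
    then show ?thesis
      by (simp add: v_def)
  qed
  show "set_integrable lborel {0..\<beta>} (\<lambda>x. g' x *\<^sub>R (LBINT s:{0..x}. \<psi> s))"
    using lborel_pair.integrable_snd[OF prod] by (simp add: in2 set_integrable_def)
  have gi: "integrable lborel (\<lambda>s. indicator {0..\<beta>} s *\<^sub>R (g s *\<^sub>R \<psi> s))"
  proof -
    have "integrable lborel (\<lambda>s. g \<beta> *\<^sub>R u s - (LINT x|lborel. f s x))"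
      using lborel_pair.integrable_fst[OF prod] ui by auto
    then show ?thesis by (simp add: in1)
  qed
  have "(LBINT x:{0..\<beta>}. g' x *\<^sub>R (LBINT s:{0..x}. \<psi> s)) = (LINT x|lborel. LINT s|lborel. f s x)"
    by (simp add: in2 set_lebesgue_integral_def)
  also have "\<dots> = (LINT s|lborel. LINT x|lborel. f s x)"
    by (rule lborel_pair.Fubini_integral[OF prod])
  also have "\<dots> = g \<beta> *\<^sub>R (LBINT s:{0..\<beta>}. \<psi> s) - (LBINT s:{0..\<beta>}. g s *\<^sub>R \<psi> s)"
    using ui gi by (simp only: in1 set_lebesgue_integral_def Bochner_Integration.integral_diff
        integrable_scaleR_right integral_scaleR_right flip: u_def)
  finally show "(LBINT s:{0..\<beta>}. g s *\<^sub>R \<psi> s) =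
     g \<beta> *\<^sub>R (LBINT s:{0..\<beta>}. \<psi> s) - (LBINT x:{0..\<beta>}. g' x *\<^sub>R (LBINT s:{0..x}. \<psi> s))"
    by simp
qed

text \<open>On \<open>[0, 1]\<close> one has \<open>cos y \<ge> 1/2\<close>, because
  \<open>1 \<le> pi / 3\<close>. Integrating once gives \<open>sin y \<ge> y / 2\<close>, and once
  more the factor 1/4.\<close>

lemma one_minus_cos_ge:
  assumes "0 \<le> x" "x \<le> (1::real)"
  shows "x\<^sup>2 / 4 \<le> 1 - cos x"
proof -
  have c: "1 / 2 \<le> cos y" if "0 \<le> y" "y \<le> 1" for y :: real
  proof -
    have "cos (pi / 3) \<le> cos y"
      using that pi_gt3 by (intro cos_monotone_0_pi_le) auto
    then show ?thesis by (simp add: cos_60)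
  qed
  have s: "y / 2 \<le> sin y" if "0 \<le> y" "y \<le> 1" for y :: real
  proof -
    have "sin 0 - 0 / 2 \<le> sin y - y / 2"
      by (rule DERIV_nonneg_imp_nondecreasing[OF that(1)])
         (use c that in \<open>auto intro!: derivative_eq_intros exI\<close>)
    then show ?thesis by simp
  qed
  have "1 - cos 0 - 0\<^sup>2 / 4 \<le> 1 - cos x - x\<^sup>2 / 4"
    by (rule DERIV_nonneg_imp_nondecreasing[OF assms(1)])
       (use s assms in \<open>auto intro!: derivative_eq_intros exI\<close>)
  then show ?thesis by simp
qed

definition poisson' :: "real \<Rightarrow> real \<Rightarrow> real" where
  "poisson' r s = - ((1 - r\<^sup>2) * (2 * r * sin s) / (1 - 2 * r * cos s + r\<^sup>2)\<^sup>2)"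

lemma has_real_derivative_poisson:
  assumes "0 \<le> r" "r < 1"
  shows "(poisson r has_real_derivative poisson' r s) (at s)"
  unfolding poisson_def[abs_def] poisson'_def
  using poisson_denominator_pos[OF assms, of s]
  by (auto intro!: derivative_eq_intros simp: power2_eq_square)

lemma continuous_on_poisson':
  assumes "0 \<le> r" "r < 1"
  shows "continuous_on A (poisson' r)"
  unfolding poisson'_def[abs_def]
  using poisson_denominator_pos[OF assms] by (intro continuous_intros) (auto simp: less_imp_neq[symmetric])

text \<open>The numerator contributes \<open>x * (2 * r * |sin x|) \<le> 2 * r * x^2\<close>, while
  the angular part of the denominator is at least \<open>r * x^2 / 2\<close>. The constant 4 is the
  quotient, independent of \<open>r\<close>.\<close>

lemma abs_poisson'_near:
  assumes r: "0 < r" "r < 1" and x: "0 \<le> x" "x \<le> 1"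
  shows "x * \<bar>poisson' r x\<bar> \<le> 4 * poisson r x"
proof -
  define D where "D = 1 - 2 * r * cos x + r\<^sup>2"
  have D: "0 < D" unfolding D_def using r by (intro poisson_denominator_pos) auto
  have "r * x\<^sup>2 / 2 \<le> D"
    using mult_left_mono[OF one_minus_cos_ge[OF x], of "2 * r"] r zero_le_power2[of "1 - r"]
    unfolding D_def poisson_denominator by (simp add: algebra_simps add_increasing2 del: zero_le_power2)
  moreover have "x * (2 * r * \<bar>sin x\<bar>) \<le> 2 * r * x\<^sup>2"
    using abs_sin_x_le_abs_x[of x] r x
    by (auto simp: power2_eq_square mult_left_mono)
  ultimately have le: "x * (2 * r * \<bar>sin x\<bar>) \<le> 4 * D" by linarith
  have r2: "0 \<le> 1 - r\<^sup>2" using r by (simp add: power_le_one)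
  have "x * \<bar>poisson' r x\<bar> = (1 - r\<^sup>2) / D\<^sup>2 * (x * (2 * r * \<bar>sin x\<bar>))"
    using r r2 by (simp add: poisson'_def D_def abs_mult)
  also have "\<dots> \<le> (1 - r\<^sup>2) / D\<^sup>2 * (4 * D)"
    using le r2 by (intro mult_left_mono) auto
  also have "\<dots> = 4 * poisson r x"
    using D unfolding poisson_def D_def[symmetric] by (simp add: power2_eq_square)
  finally show ?thesis .
qed

text \<open>Once \<open>2 * r \<ge> 1\<close>, the angular part of the denominator alone is at least
  \<open>c\<close>, so kernel and derivative are \<open>O(1 - r\<^sup>2)\<close> uniformly away from
  0.\<close>

lemma poisson_far:
  assumes r: "1 / 2 \<le> r" "r < 1" and c: "0 < c" "c \<le> 1 - cos x"
  shows "poisson r x \<le> (1 - r\<^sup>2) / c" "\<bar>poisson' r x\<bar> \<le> 2 * (1 - r\<^sup>2) / c\<^sup>2"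
proof -
  define D where "D = 1 - 2 * r * cos x + r\<^sup>2"
  have D: "0 < D" unfolding D_def using r by (intro poisson_denominator_pos) auto
  have "c \<le> 2 * r * (1 - cos x)"
    using mult_mono[of 1 "2 * r" c "1 - cos x"] r c by auto
  then have cD: "c \<le> D"
    unfolding D_def poisson_denominator using zero_le_power2[of "1 - r"] by linarith
  have r2: "0 \<le> 1 - r\<^sup>2" using r by (simp add: power_le_one)
  show "poisson r x \<le> (1 - r\<^sup>2) / c"
    unfolding poisson_def D_def[symmetric] using r2 cD c by (intro frac_le) auto
  have "\<bar>poisson' r x\<bar> = (1 - r\<^sup>2) * (2 * r * \<bar>sin x\<bar>) / D\<^sup>2"
    using r r2 by (simp add: poisson'_def D_def abs_mult)
  also have "\<dots> \<le> (1 - r\<^sup>2) * 2 / c\<^sup>2"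
    using r r2 c cD mult_mono[of r 1 "\<bar>sin x\<bar>" 1]
    by (intro frac_le mult_left_mono mult_nonneg_nonneg power_mono) auto
  finally show "\<bar>poisson' r x\<bar> \<le> 2 * (1 - r\<^sup>2) / c\<^sup>2" by (simp add: mult.commute)
qed

text \<open>Integrating by parts moves the derivative to the kernel, where \<open>x |P'(x)| \<le> 4 P(x)\<close> near \<open>0\<close>
  compensates for the primitive of \<open>\<psi>\<close> being \<open>o(x)\<close>.\<close>
lemma poisson_half_tendsto:
  fixes \<psi> :: "real \<Rightarrow> complex"
  assumes \<beta>: "0 < \<beta>" "\<beta> < 2 * pi"
    and \<psi>: "set_integrable lborel {0..\<beta>} \<psi>"
    and avg: "\<And>e. 0 < e \<Longrightarrow> \<exists>d>0. \<forall>h. 0 < h \<and> h < d \<longrightarrow> norm (LBINT s:{0..h}. \<psi> s) \<le> e * h"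
  shows "((\<lambda>r. LBINT s:{0..\<beta>}. poisson r s *\<^sub>R \<psi> s) \<longlongrightarrow> 0) (at_left 1)"
proof (rule tendstoI)
  fix e :: real assume e: "0 < e"
  define \<Psi> where "\<Psi> x = (LBINT s:{0..x}. \<psi> s)" for x
  define K where "K = (LBINT s:{0..\<beta>}. norm (\<psi> s))"
  have sub: "set_integrable lborel {0..x} \<psi>" if "x \<le> \<beta>" for x
    using that by (intro set_integrable_subset[OF \<psi>]) auto
  have K: "norm (\<Psi> x) \<le> K" if "x \<le> \<beta>" for x
  proof -
    have "norm (\<Psi> x) \<le> (LBINT s:{0..x}. norm (\<psi> s))"
      unfolding \<Psi>_def by (rule set_integral_norm_bound[OF sub[OF that]])
    also have "\<dots> \<le> K"
      unfolding K_def set_lebesgue_integral_def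
      using set_integrable_norm[OF sub[OF that]] set_integrable_norm[OF \<psi>] that
      by (intro integral_mono) (auto simp: set_integrable_def split: split_indicator)
    finally show ?thesis .
  qed
  have K0: "0 \<le> K" using K[of 0] \<beta> norm_ge_zero[of "\<Psi> 0"] by linarith
  \<comment> \<open>The near part will cost at most \<open>4 * e1\<close> times the kernel mass
    \<open>2 * pi\<close>, which is \<open>e / 2\<close>.\<close>
  define e1 where "e1 = e / (16 * pi)"
  have e1: "0 < e1" using e by (simp add: e1_def)
  obtain d where d: "0 < d" "\<And>h. 0 < h \<Longrightarrow> h < d \<Longrightarrow> norm (\<Psi> h) \<le> e1 * h"
    using avg[OF e1] unfolding \<Psi>_def by blast
  \<comment> \<open>\<open>d / 2\<close> keeps it strictly within the range of the averages, 1
    admits the near estimate for the derivative, and \<open>\<beta>\<close> keeps it in the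
    interval.\<close>
  define \<eta> where "\<eta> = min (d / 2) (min \<beta> 1)"
  have \<eta>: "0 < \<eta>" "\<eta> < d" "\<eta> \<le> \<beta>" "\<eta> \<le> 1"
    using d(1) \<beta> by (auto simp: \<eta>_def min_def)
  have near: "norm (\<Psi> x) \<le> e1 * x" if "0 \<le> x" "x \<le> \<eta>" for x
  proof (cases "x = 0")
    case True
    have "\<Psi> 0 = 0"
      unfolding \<Psi>_def set_lebesgue_integral_def
      by (rule integral_eq_zero_AE, rule eventually_mono[OF AE_lborel_singleton[of 0]]) auto
    then show ?thesis using True by simp
  next
    case False
    then show ?thesis using that \<eta> d(2)[of x] by auto
  qed
  \<comment> \<open>This is compactness: \<open>1 - cos\<close> vanishes only at multiples of
    \<open>2 * pi\<close>, and these are excluded by \<open>0 < \<eta>\<close> and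
    \<open>\<beta> < 2 * pi\<close>.\<close>
  obtain c where c: "0 < c" "\<And>x. \<eta> \<le> x \<Longrightarrow> x \<le> \<beta> \<Longrightarrow> c \<le> 1 - cos x"
  proof -
    have "\<exists>x\<in>{\<eta>..\<beta>}. \<forall>y\<in>{\<eta>..\<beta>}. 1 - cos x \<le> 1 - cos y"
      using \<eta> by (intro continuous_attains_inf continuous_intros) auto
    then obtain x where x: "x \<in> {\<eta>..\<beta>}" "\<And>y. y \<in> {\<eta>..\<beta>} \<Longrightarrow> 1 - cos x \<le> 1 - cos y"
      by blast
    have "cos x \<noteq> 1"
    proof
      assume "cos x = 1"
      then obtain n :: int where n: "x = of_int n * 2 * pi"
        by (auto simp: cos_one_2pi_int)
      then have "0 < real_of_int n * (2 * pi)" "real_of_int n * (2 * pi) < 1 * (2 * pi)"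
        using x(1) \<eta> \<beta> unfolding n by (auto simp only: atLeastAtMost_iff mult.assoc mult_1)
      then have "0 < n" "n < 1"
        by (simp_all add: zero_less_mult_iff)
      then show False by simp
    qed
    then have "0 < 1 - cos x" using cos_le_one[of x] by linarith
    then show ?thesis using that[of "1 - cos x"] x(2) by simp
  qed
  \<comment> \<open>\<open>B\<close> collects what happens away from 0, namely the boundary term at
    \<open>\<beta>\<close> and the far part of the derivative integral. Both carry a factor
    \<open>1 - r\<^sup>2\<close>, which vanishes in the limit.\<close>
  define B where "B = K / c + \<beta> * (2 * K / c\<^sup>2)"
  have main: "norm (LBINT s:{0..\<beta>}. poisson r s *\<^sub>R \<psi> s) \<le> (1 - r\<^sup>2) * B + e / 2"
    if r: "1 / 2 \<le> r" "r < 1" for r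
  proof -
    have r0: "0 \<le> r" "0 < r" using r by auto
    have r2: "0 \<le> 1 - r\<^sup>2" using r by (simp add: power_le_one)
    note ibp = integration_by_parts_L1[OF less_imp_le[OF \<beta>(1)]
       has_real_derivative_poisson[OF r0(1) r(2)] continuous_on_poisson'[OF r0(1) r(2)] \<psi>, folded \<Psi>_def]
    define w where "w x = 4 * e1 * (indicator {0..\<eta>} x * poisson r x) +
       indicator {0..\<beta>} x * (2 * K * (1 - r\<^sup>2) / c\<^sup>2)" for x
    have pt: "norm (poisson' r x *\<^sub>R \<Psi> x) \<le> w x" if x: "x \<in> {0..\<beta>}" for x
    proof (cases "x \<le> \<eta>")
      case True
      have "norm (poisson' r x *\<^sub>R \<Psi> x) \<le> \<bar>poisson' r x\<bar> * (e1 * x)"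
        using near[of x] True x by (simp add: mult_left_mono)
      also have "\<dots> = e1 * (x * \<bar>poisson' r x\<bar>)" by simp
      also have "\<dots> \<le> e1 * (4 * poisson r x)"
        using True x \<eta> e1 by (intro mult_left_mono abs_poisson'_near r0 r) auto
      also have "\<dots> \<le> w x" using True x K0 r2 by (simp add: w_def)
      finally show ?thesis .
    next
      case False
      have "norm (poisson' r x *\<^sub>R \<Psi> x) \<le> (2 * (1 - r\<^sup>2) / c\<^sup>2) * K"
        using False x c K[of x] K0 r2 unfolding norm_scaleR
        by (intro mult_mono poisson_far(2)[OF r]) auto
      also have "\<dots> = w x" using False x by (simp add: w_def)
      finally show ?thesis .
    qed
    have ip: "set_integrable lborel {-pi..pi} (poisson r)"
      using integrable_circ_continuous[of "poisson r"] continuous_on_poisson[OF r0(1) r(2), of _ "\<lambda>x. x"]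
      by (simp add: integrable_circ_iff)
    have \<eta>pi: "{0..\<eta>} \<subseteq> {-pi..pi}" using \<eta> pi_gt3 by auto
    have ip\<eta>: "set_integrable lborel {0..\<eta>} (poisson r)"
      using \<eta>pi by (intro set_integrable_subset[OF ip]) auto
    have "(LINT x|lborel. indicator {0..\<eta>} x * poisson r x) \<le> (LBINT x:{-pi..pi}. poisson r x)"
      unfolding set_lebesgue_integral_def real_scaleR_def
      using ip ip\<eta> \<eta>pi poisson_nonneg[OF r0(1) r(2)]
      by (intro integral_mono) (auto simp: set_integrable_def indicator_def)
    also have "\<dots> = 2 * pi"
      using integral_poisson[OF r0(1) r(2), of 0] by (simp add: integral_circ)
    finally have le2: "(LINT x|lborel. indicator {0..\<eta>} x * poisson r x) \<le> 2 * pi" .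
    have wi: "integrable lborel w"
      unfolding w_def[abs_def] using ip\<eta> \<beta>
      by (auto simp: set_integrable_def intro!: integrable_add integrable_mult_right integrable_real_indicator)
    have "norm (LBINT x:{0..\<beta>}. poisson' r x *\<^sub>R \<Psi> x) \<le> (LINT x|lborel. w x)"
      unfolding set_lebesgue_integral_def
    proof (rule order_trans[OF integral_norm_bound integral_mono])
      show "integrable lborel (\<lambda>x. norm (indicator {0..\<beta>} x *\<^sub>R (poisson' r x *\<^sub>R \<Psi> x)))"
        using ibp(2) unfolding set_integrable_def by (rule integrable_norm)
      show "integrable lborel w" by (fact wi)
      show "norm (indicator {0..\<beta>} x *\<^sub>R (poisson' r x *\<^sub>R \<Psi> x)) \<le> w x" for x
        using pt[of x] e1 poisson_nonneg[OF r0(1) r(2), of x] by (auto simp: indicator_def w_def)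
    qed
    also have "\<dots> = 4 * e1 * (LINT x|lborel. indicator {0..\<eta>} x * poisson r x) + \<beta> * (2 * K * (1 - r\<^sup>2) / c\<^sup>2)"
      unfolding w_def[abs_def] using ip\<eta> \<beta>
      by (subst Bochner_Integration.integral_add)
         (auto simp: set_integrable_def intro!: integrable_mult_right integrable_real_indicator)
    also have "\<dots> \<le> 4 * e1 * (2 * pi) + \<beta> * (2 * K * (1 - r\<^sup>2) / c\<^sup>2)"
      using le2 e1 by (intro add_right_mono mult_left_mono) auto
    also have "4 * e1 * (2 * pi) = e / 2" by (simp add: e1_def)
    finally have 1: "norm (LBINT x:{0..\<beta>}. poisson' r x *\<^sub>R \<Psi> x) \<le> e / 2 + \<beta> * (2 * K * (1 - r\<^sup>2) / c\<^sup>2)" .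
    have 2: "norm (poisson r \<beta> *\<^sub>R \<Psi> \<beta>) \<le> (1 - r\<^sup>2) / c * K"
      using poisson_nonneg[OF r0(1) r(2)] K[of \<beta>] K0 r2 c \<eta> unfolding norm_scaleR
      by (intro mult_mono) (auto intro!: poisson_far(1)[OF r])
    have "norm (LBINT s:{0..\<beta>}. poisson r s *\<^sub>R \<psi> s) \<le>
        norm (poisson r \<beta> *\<^sub>R \<Psi> \<beta>) + norm (LBINT x:{0..\<beta>}. poisson' r x *\<^sub>R \<Psi> x)"
      unfolding ibp(1) by (rule norm_triangle_ineq4)
    moreover have "(1 - r\<^sup>2) * B = (1 - r\<^sup>2) / c * K + \<beta> * (2 * K * (1 - r\<^sup>2) / c\<^sup>2)"
      by (simp add: B_def distrib_left mult_ac)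
    ultimately show ?thesis using 1 2 by linarith
  qed
  have "((\<lambda>r. (1 - r\<^sup>2) * B + e / 2) \<longlongrightarrow> (1 - 1\<^sup>2) * B + e / 2) (at_left (1::real))"
    by (intro tendsto_intros)
  then have "\<forall>\<^sub>F r in at_left 1. (1 - r\<^sup>2) * B + e / 2 < e"
    by (rule order_tendstoD(2)) (use e in simp)
  moreover have "\<forall>\<^sub>F r in at_left 1. r < (1::real)"
    by (simp add: eventually_at_filter)
  moreover have "\<forall>\<^sub>F r in at_left 1. 1 / 2 < (r::real)"
    by (rule order_tendstoD(1)[OF tendsto_ident_at]) simp
  ultimately show "\<forall>\<^sub>F r in at_left 1. dist (LBINT s:{0..\<beta>}. poisson r s *\<^sub>R \<psi> s) 0 < e"
  proof eventually_elim
    case (elim r)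
    then show ?case using main[of r] by (simp add: dist_norm)
  qed
qed

subsection \<open>Radial limits of Poisson integrals\<close>

text \<open>A weak form of the Lebesgue point property, with the norm outside the integral: it is
  differentiability of the primitive from the right. Integration by parts sees only the primitive,
  so this form suffices.\<close>

lemma lebesgue_differentiation_right:
  fixes f :: "real \<Rightarrow> complex"
  assumes f: "integrable lborel f"
  obtains N where "negligible N"
    "\<And>x e. x \<notin> N \<Longrightarrow> 0 < e \<Longrightarrow>
       \<exists>d>0. \<forall>h. 0 < h \<and> h < d \<longrightarrow> norm (LBINT s:{0..h}. (f (x + s) - f x)) \<le> e * h"
proof -
  have "f integrable_on cbox a b" for a b
    using integrable_on_lborel[OF f] by (rule integrable_on_subcbox) auto
  from integrable_ccontinuous_explicit[OF this] obtain N where N: "negligible N"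
    "\<And>x e. x \<notin> N \<Longrightarrow> 0 < e \<Longrightarrow>
       \<exists>d>0. \<forall>h. 0 < h \<and> h < d \<longrightarrow> norm (integral (cbox x (x + h *\<^sub>R One)) f /\<^sub>R h ^ DIM(real) - f x) < e"
    by blast
  show ?thesis
  proof (rule that[OF N(1)])
    fix x e :: real assume x: "x \<notin> N" and e: "0 < e"
    obtain d where d: "d > 0"
      "\<And>h. 0 < h \<Longrightarrow> h < d \<Longrightarrow> norm (integral {x..x + h} f /\<^sub>R h - f x) < e"
      using N(2)[OF x e] by auto
    have "norm (LBINT s:{0..h}. (f (x + s) - f x)) \<le> e * h" if h: "0 < h" "h < d" for h
    proof -
      have i: "set_integrable lborel A f" if "A \<in> sets borel" for A
        unfolding set_integrable_def using f that by (simp add: integrable_mult_indicator)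
      have "integrable lborel (\<lambda>s. f (x + 1 * s))"
        using f by (rule lborel_integrable_real_affine) simp
      then have i1: "set_integrable lborel {0..h} (\<lambda>s. f (x + s))"
        unfolding set_integrable_def by (simp add: integrable_mult_indicator)
      have i2: "set_integrable lborel {0..h} (\<lambda>s. f x)"
        using h by (simp add: set_integrable_def)
      have "(LBINT t:{x..x+h}. f t) = (LINT s|lborel. indicator {x..x+h} (x + s) *\<^sub>R f (x + s))"
        unfolding set_lebesgue_integral_def
        using lborel_integral_real_affine[of 1 "\<lambda>t. indicator {x..x+h} t *\<^sub>R f t" x] by simp
      also have "\<dots> = (LBINT s:{0..h}. f (x + s))"
        unfolding set_lebesgue_integral_def
        by (intro Bochner_Integration.integral_cong) (auto simp: indicator_def)
      finally have "(LBINT s:{0..h}. f (x + s)) = integral {x..x + h} f"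
        using set_borel_integral_eq_integral(2)[OF i] by simp
      moreover have "(LBINT s:{0..h}. f x) = h *\<^sub>R f x"
        using h by (simp add: set_lebesgue_integral_def)
      ultimately have "(LBINT s:{0..h}. (f (x + s) - f x)) = h *\<^sub>R (integral {x..x + h} f /\<^sub>R h - f x)"
        using h set_integral_diff(2)[OF i1 i2] by (simp add: scaleR_diff_right)
      then have "norm (LBINT s:{0..h}. (f (x + s) - f x)) = h * norm (integral {x..x + h} f /\<^sub>R h - f x)"
        using h by (simp only: norm_scaleR abs_of_pos)
      also have "\<dots> \<le> h * e"
        using d(2)[OF h] h by (intro mult_left_mono) auto
      finally show ?thesis by (simp add: mult.commute)
    qed
    then show "\<exists>d>0. \<forall>h. 0 < h \<and> h < d \<longrightarrow> norm (LBINT s:{0..h}. (f (x + s) - f x)) \<le> e * h"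
      using d(1) by blast
  qed
qed

lemma AE_lborel_not_negligible:
  fixes N :: "real set"
  assumes "negligible N"
  shows "AE x in lborel. x \<notin> N"
proof -
  have "N \<in> null_sets (completion lborel)"
    using assms by (simp add: negligible_iff_null_sets)
  then have "AE x in completion lborel. x \<notin> N"
    by (rule AE_not_in)
  then show ?thesis
    by (simp only: AE_completion_iff)
qed

text \<open>Since the kernel has mass \<open>2 * pi\<close>, subtracting the constant
  \<open>\<phi> \<theta>\<close> leaves two one-sided limits, one to the right of
  \<open>\<theta>\<close> and, after reflection, one to the left. The endpoints are discarded so
  that both arcs have length strictly between 0 and \<open>2 * pi\<close>.\<close>

theorem fatou_poisson:
  fixes \<phi> :: "real \<Rightarrow> complex"
  assumes \<phi>: "integrable circ \<phi>"
  shows "AE \<theta> in circ.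
    ((\<lambda>r. LINT t|circ. of_real (poisson r (\<theta> - t)) * \<phi> t) \<longlongrightarrow> 2 * pi * \<phi> \<theta>) (at_left 1)"
proof -
  define f where "f t = indicator {-pi..pi} t *\<^sub>R \<phi> t" for t
  have fi: "integrable lborel f"
    using \<phi> by (simp add: integrable_circ_iff set_integrable_def f_def[abs_def])
  \<comment> \<open>Left averages at \<open>\<theta>\<close> are right averages of the reflected
    function at \<open>- \<theta>\<close>; the corresponding exceptional set is the negative of
    \<open>N2\<close>.\<close>
  have fi': "integrable lborel (\<lambda>t. f (- t))"
    using lborel_integrable_real_affine[OF fi, of "-1" 0] by simp
  obtain N1 where N1: "negligible N1" "\<And>x e. x \<notin> N1 \<Longrightarrow> 0 < e \<Longrightarrow>
       \<exists>d>0. \<forall>h. 0 < h \<and> h < d \<longrightarrow> norm (LBINT s:{0..h}. (f (x + s) - f x)) \<le> e * h"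
    using lebesgue_differentiation_right[OF fi] by metis
  obtain N2 where N2: "negligible N2" "\<And>x e. x \<notin> N2 \<Longrightarrow> 0 < e \<Longrightarrow>
       \<exists>d>0. \<forall>h. 0 < h \<and> h < d \<longrightarrow> norm (LBINT s:{0..h}. (f (- (x + s)) - f (- x))) \<le> e * h"
    using lebesgue_differentiation_right[OF fi'] by auto
  have "AE \<theta> in lborel. \<theta> \<notin> N1 \<and> \<theta> \<notin> uminus ` N2 \<and> \<theta> \<noteq> pi \<and> \<theta> \<noteq> - pi"
  proof (intro AE_conjI AE_lborel_not_negligible AE_lborel_singleton N1)
    show "negligible (uminus ` N2)"
      using N2(1) by (intro negligible_differentiable_image_negligible) (auto intro!: derivative_intros)
  qed
  then show ?thesis
    unfolding AE_circ_iff
  proof eventually_elim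
    case (elim \<theta>)
    show ?case
    proof
      assume "\<theta> \<in> {-pi..pi}"
      then have \<theta>: "-pi < \<theta>" "\<theta> < pi" using elim by auto
      have f\<theta>: "f \<theta> = \<phi> \<theta>" using \<theta> by (simp add: f_def)
      have n2: "- \<theta> \<notin> N2"
      proof
        assume "- \<theta> \<in> N2"
        then have "- (- \<theta>) \<in> uminus ` N2" by (rule imageI)
        then show False using elim by simp
      qed
      have si: "set_integrable lborel {0..\<beta>} (\<lambda>s. f (\<theta> + c * s) - f \<theta>)" if "c \<noteq> 0" for \<beta> c
      proof (rule set_integral_diff(1))
        show "set_integrable lborel {0..\<beta>} (\<lambda>s. f (\<theta> + c * s))"
          unfolding set_integrable_def
          using lborel_integrable_real_affine[OF fi that, of \<theta>] by (simp add: integrable_mult_indicator)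
        show "set_integrable lborel {0..\<beta>} (\<lambda>s. f \<theta>)"
          by (simp add: set_integrable_def emeasure_lborel_Icc_eq)
      qed
      define q where "q r t = poisson r (\<theta> - t) *\<^sub>R (f t - f \<theta>)" for r t
      have 1: "((\<lambda>r. LBINT s:{0..pi - \<theta>}. poisson r s *\<^sub>R (f (\<theta> + s) - f \<theta>)) \<longlongrightarrow> 0) (at_left 1)"
        using \<theta> elim si[of 1] N1(2)[of \<theta>] by (intro poisson_half_tendsto) auto
      have 2: "((\<lambda>r. LBINT s:{0..pi + \<theta>}. poisson r s *\<^sub>R (f (\<theta> - s) - f \<theta>)) \<longlongrightarrow> 0) (at_left 1)"
        using \<theta> n2 si[of "-1"] N2(2)[of "- \<theta>"] by (intro poisson_half_tendsto) auto
      have 11: "(LBINT s:{0..pi - \<theta>}. poisson r s *\<^sub>R (f (\<theta> + s) - f \<theta>)) = (LBINT t:{\<theta>..pi}. q r t)" for r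
      proof -
        have "(LBINT t:{\<theta>..pi}. q r t) = (LINT s|lborel. indicator {\<theta>..pi} (\<theta> + s) *\<^sub>R q r (\<theta> + s))"
          unfolding set_lebesgue_integral_def
          using lborel_integral_real_affine[of 1 "\<lambda>t. indicator {\<theta>..pi} t *\<^sub>R q r t" \<theta>] by simp
        also have "\<dots> = (LBINT s:{0..pi - \<theta>}. poisson r s *\<^sub>R (f (\<theta> + s) - f \<theta>))"
          unfolding set_lebesgue_integral_def
          by (intro Bochner_Integration.integral_cong) (auto simp: indicator_def q_def)
        finally show ?thesis by simp
      qed
      have 22: "(LBINT s:{0..pi + \<theta>}. poisson r s *\<^sub>R (f (\<theta> - s) - f \<theta>)) = (LBINT t:{-pi..\<theta>}. q r t)" for r
      proof -
        have "(LBINT t:{-pi..\<theta>}. q r t) = (LINT s|lborel. indicator {-pi..\<theta>} (\<theta> - s) *\<^sub>R q r (\<theta> - s))"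
          unfolding set_lebesgue_integral_def
          using lborel_integral_real_affine[of "-1" "\<lambda>t. indicator {-pi..\<theta>} t *\<^sub>R q r t" \<theta>] by simp
        also have "\<dots> = (LBINT s:{0..pi + \<theta>}. poisson r s *\<^sub>R (f (\<theta> - s) - f \<theta>))"
          unfolding set_lebesgue_integral_def
          by (intro Bochner_Integration.integral_cong) (auto simp: indicator_def q_def)
        finally show ?thesis by simp
      qed
      have eq: "(LBINT t:{-pi..\<theta>}. q r t) + (LBINT t:{\<theta>..pi}. q r t) + 2 * pi * \<phi> \<theta> =
        (LINT t|circ. of_real (poisson r (\<theta> - t)) * \<phi> t)" if r: "0 \<le> r" "r < 1" for r
      proof -
        have qc: "of_real (poisson r (\<theta> - t)) * \<phi> t - of_real (poisson r (\<theta> - t)) * \<phi> \<theta> = q r t"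
          if "t \<in> {-pi..pi}" for t
          using that unfolding q_def f\<theta> by (simp add: f_def scaleR_conv_of_real algebra_simps)
        have ic: "integrable circ (\<lambda>t. of_real (poisson r (\<theta> - t)) * \<phi> \<theta>)"
          by (rule integrable_poisson[OF r]) (simp add: integrable_circ_continuous)
        have iq: "integrable circ (q r)"
          using Bochner_Integration.integrable_diff[OF integrable_poisson[OF r \<phi>, of \<theta>] ic]
          by (rule Bochner_Integration.integrable_cong[THEN iffD1, OF refl, rotated]) (use qc in auto)
        then have iq': "set_integrable lborel A (q r)" if "A \<subseteq> {-pi..pi}" "A \<in> sets borel" for A
          using that unfolding integrable_circ_iff by (auto elim: set_integrable_subset)
        have "(LINT t|circ. of_real (poisson r (\<theta> - t)) * \<phi> t) - 2 * pi * \<phi> \<theta> =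
          (LINT t|circ. of_real (poisson r (\<theta> - t)) * \<phi> t) - (LINT t|circ. of_real (poisson r (\<theta> - t)) * \<phi> \<theta>)"
          using integral_poisson[OF r, of \<theta>] by simp
        also have "\<dots> = (LINT t|circ. q r t)"
          unfolding Bochner_Integration.integral_diff[OF integrable_poisson[OF r \<phi>, of \<theta>] ic, symmetric]
          by (intro Bochner_Integration.integral_cong refl) (use qc in auto)
        also have "\<dots> = (LBINT t:{-pi..\<theta>} \<union> {\<theta>..pi}. q r t)"
          using \<theta> by (simp add: integral_circ ivl_disj_un_two_touch)
        also have "\<dots> = (LBINT t:{-pi..\<theta>}. q r t) + (LBINT t:{\<theta>..pi}. q r t)"
        proof (rule set_integral_Un_AE)
          show "AE x in lborel. \<not> (x \<in> {- pi..\<theta>} \<and> x \<in> {\<theta>..pi})"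
            using AE_lborel_singleton[of \<theta>] by eventually_elim auto
        qed (use \<theta> in \<open>auto intro!: iq'\<close>)
        finally show ?thesis by (simp add: algebra_simps)
      qed
      have "((\<lambda>r. (LBINT t:{-pi..\<theta>}. q r t) + (LBINT t:{\<theta>..pi}. q r t) + 2 * pi * \<phi> \<theta>) \<longlongrightarrow>
         0 + 0 + 2 * pi * \<phi> \<theta>) (at_left 1)"
        using 1 2 unfolding 11 22 by (intro tendsto_intros)
      then have "((\<lambda>r. (LBINT t:{-pi..\<theta>}. q r t) + (LBINT t:{\<theta>..pi}. q r t) + 2 * pi * \<phi> \<theta>) \<longlongrightarrow>
         2 * pi * \<phi> \<theta>) (at_left 1)"
        by simp
      then show "((\<lambda>r. LINT t|circ. of_real (poisson r (\<theta> - t)) * \<phi> t) \<longlongrightarrow> 2 * pi * \<phi> \<theta>) (at_left 1)"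
      proof (rule Lim_transform_eventually)
        show "\<forall>\<^sub>F r in at_left 1. (LBINT t:{-pi..\<theta>}. q r t) + (LBINT t:{\<theta>..pi}. q r t) + 2 * pi * \<phi> \<theta> =
          (LINT t|circ. of_real (poisson r (\<theta> - t)) * \<phi> t)"
          by (rule eventually_mono[OF eventually_at_left_real[of 0 1]]) (auto intro!: eq[simplified])
      qed
    qed
  qed
qed

subsection \<open>Boundary values of square-summable power series\<close>

text \<open>A uniform bound on the integrals takes the place of a dominating function and yields
  integrability of the limit as well.\<close>

lemma fatou_integral_bound:
  fixes u :: "nat \<Rightarrow> 'a \<Rightarrow> real"
  assumes u: "\<And>i. integrable M (u i)" "\<And>i t. 0 \<le> u i t" "\<And>i. integral\<^sup>L M (u i) \<le> B"
    and v: "v \<in> borel_measurable M" "AE t in M. (\<lambda>i. u i t) \<longlonglongrightarrow> v t"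
  shows "integrable M v" "integral\<^sup>L M v \<le> B"
proof -
  have v0: "AE t in M. 0 \<le> v t"
    using v(2) by eventually_elim (rule LIMSEQ_le_const, use u(2) in auto)
  have um: "(\<lambda>t. ennreal (u i t)) \<in> borel_measurable M" for i
    using borel_measurable_integrable[OF u(1)[of i]] by measurable
  have B0: "0 \<le> B"
    using u(2) by (intro order_trans[OF Bochner_Integration.integral_nonneg u(3)[of 0]])
  have "(\<integral>\<^sup>+t. ennreal (v t) \<partial>M) = (\<integral>\<^sup>+t. liminf (\<lambda>i. ennreal (u i t)) \<partial>M)"
  proof (rule nn_integral_cong_AE)
    show "AE t in M. ennreal (v t) = liminf (\<lambda>i. ennreal (u i t))"
      using v(2) by eventually_elim
        (metis tendsto_ennrealI lim_imp_Liminf sequentially_bot)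
  qed
  also have "\<dots> \<le> liminf (\<lambda>i. \<integral>\<^sup>+t. ennreal (u i t) \<partial>M)"
    by (rule nn_integral_liminf) (rule um)
  also have "\<dots> \<le> ennreal B"
  proof (rule Liminf_le)
    show "\<forall>\<^sub>F i in sequentially. (\<integral>\<^sup>+t. ennreal (u i t) \<partial>M) \<le> ennreal B"
      using u by (intro always_eventually allI) (simp add: nn_integral_eq_integral ennreal_leI)
  qed simp
  finally have le: "(\<integral>\<^sup>+t. ennreal (v t) \<partial>M) \<le> ennreal B" .
  show i: "integrable M v"
    using le v(1) v0 by (intro integrableI_nonneg) (auto intro: le_less_trans)
  show "integral\<^sup>L M v \<le> B"
    using le B0 by (simp add: nn_integral_eq_integral[OF i v0])
qed

lemma integrable_circ_sqD:
  fixes f :: "real \<Rightarrow> complex"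
  assumes "f \<in> borel_measurable circ" "integrable circ (\<lambda>t. (norm (f t))\<^sup>2)"
  shows "integrable circ f"
proof (rule Bochner_Integration.integrable_bound)
  show "integrable circ (\<lambda>t. 1 + (norm (f t))\<^sup>2)"
    using assms integrable_circ_continuous[OF continuous_on_const, of 1] by auto
  have "x \<le> 1 + x\<^sup>2" for x :: real
    using zero_le_power2[of "x - 1/2"] by (simp add: power2_eq_square algebra_simps)
  then have "norm (f t) \<le> norm (1 + (norm (f t))\<^sup>2)" for t
    by (metis abs_ge_self order_trans real_norm_def)
  then show "AE t in circ. norm (f t) \<le> norm (1 + (norm (f t))\<^sup>2)"
    by (intro AE_I2)
qed (use assms in auto)

text \<open>The pointwise inequality \<open>x \<le> \<eta> + x^2 / \<eta>\<close> replaces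
  Cauchy-Schwarz; the constant \<open>2 * pi + 1\<close> is rounded up to 9 by
  \<open>pi < 4\<close>.\<close>

lemma L1_le_L2_circ:
  fixes f :: "real \<Rightarrow> complex"
  assumes f: "f \<in> borel_measurable circ" "integrable circ (\<lambda>t. (norm (f t))\<^sup>2)"
    and \<eta>: "0 < \<eta>" "(LINT t|circ. (norm (f t))\<^sup>2) \<le> \<eta>\<^sup>2"
  shows "(LINT t|circ. norm (f t)) \<le> 9 * \<eta>"
proof -
  have "(LINT t|circ. norm (f t)) \<le> (LINT t|circ. \<eta> + inverse \<eta> * (norm (f t))\<^sup>2)"
  proof (rule integral_mono)
    show "integrable circ (\<lambda>t. \<eta> + inverse \<eta> * (norm (f t))\<^sup>2)"
      using f integrable_circ_continuous[OF continuous_on_const, of \<eta>] by auto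
    fix t
    have "(norm (f t) - \<eta> / 2)\<^sup>2 = (norm (f t))\<^sup>2 - \<eta> * norm (f t) + \<eta>\<^sup>2 / 4"
      by (simp add: power2_eq_square algebra_simps)
    then have "\<eta> * norm (f t) \<le> \<eta>\<^sup>2 + (norm (f t))\<^sup>2"
      using zero_le_power2[of "norm (f t) - \<eta> / 2"] zero_le_power2[of \<eta>] by linarith
    then show "norm (f t) \<le> \<eta> + inverse \<eta> * (norm (f t))\<^sup>2"
      using \<eta>(1) by (simp add: field_simps power2_eq_square)
  qed (use integrable_circ_sqD[OF f] in auto)
  also have "\<dots> = 2 * pi * \<eta> + inverse \<eta> * (LINT t|circ. (norm (f t))\<^sup>2)"
    using f by (subst Bochner_Integration.integral_add)
      (auto simp: measure_circ intro!: integrable_circ_continuous continuous_intros)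
  also have "\<dots> \<le> 2 * pi * \<eta> + inverse \<eta> * \<eta>\<^sup>2"
    using \<eta> by (intro add_left_mono mult_left_mono) auto
  also have "\<dots> = (2 * pi + 1) * \<eta>"
    using \<eta>(1) by (simp add: power2_eq_square algebra_simps)
  also have "\<dots> \<le> 9 * \<eta>"
    using \<eta>(1) pi_less_4 by (intro mult_right_mono) auto
  finally show ?thesis .
qed

lemma parseval_finite:
  fixes a :: "nat \<Rightarrow> complex"
  assumes "finite A"
  shows "(LINT t|circ. (norm (\<Sum>k\<in>A. a k * cis (- real k * t)))\<^sup>2) = 2 * pi * (\<Sum>k\<in>A. (norm (a k))\<^sup>2)"
proof -
  define c where "c k = (if k \<in> A then a k else 0)" for k
  have "summable (\<lambda>k. norm (c k))"
    using assms by (intro summable_finite[of A]) (auto simp: c_def)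
  from parseval_circ(1)[OF this]
  have "(\<lambda>k. 2 * pi * (norm (c k))\<^sup>2) sums (LINT t|circ. (norm (\<Sum>k. c k * cis (- real k * t)))\<^sup>2)" .
  moreover have "(\<lambda>k. 2 * pi * (norm (c k))\<^sup>2) sums (\<Sum>k\<in>A. 2 * pi * (norm (c k))\<^sup>2)"
    using assms by (intro sums_finite) (auto simp: c_def)
  moreover have "(\<Sum>k. c k * cis (- real k * t)) = (\<Sum>k\<in>A. a k * cis (- real k * t))" for t
    using assms by (subst suminf_finite[of A]) (auto simp: c_def)
  ultimately show ?thesis
    using sums_unique2 by (fastforce simp: c_def sum_distrib_left)
qed

text \<open>The partial sums are Cauchy in L2, hence in L1, so a subsequence converges almost
  everywhere. Fatou applied to its squared distance from the \<open>n\<close>-th partial sum then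
  gives the L2 tail bound for every \<open>n\<close>.\<close>

lemma riesz_fischer:
  fixes a :: "nat \<Rightarrow> complex"
  assumes a: "summable (\<lambda>k. (norm (a k))\<^sup>2)"
  obtains f where "f \<in> borel_measurable circ"
    "\<And>n. integrable circ (\<lambda>t. (norm (f t - (\<Sum>k<n. a k * cis (- real k * t))))\<^sup>2)"
    "\<And>n. (LINT t|circ. (norm (f t - (\<Sum>k<n. a k * cis (- real k * t))))\<^sup>2) \<le>
           2 * pi * (\<Sum>k. (norm (a (k + n)))\<^sup>2)"
proof -
  define s where "s n t = (\<Sum>k<n. a k * cis (- real k * t))" for n t
  have sc: "continuous_on A (s n)" for A n
    unfolding s_def[abs_def] by (intro continuous_intros)
  have diff: "s n t - s m t = (\<Sum>k\<in>{m..<n}. a k * cis (- real k * t))" if "m \<le> n" for m n t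
    unfolding s_def using sum_diff_nat_ivl[of 0 m n "\<lambda>k. a k * cis (- real k * t)"] that
    by (simp add: atLeast0LessThan)
  have sq: "(LINT t|circ. (norm (s n t - s m t))\<^sup>2) = 2 * pi * (\<Sum>k\<in>{m..<n}. (norm (a k))\<^sup>2)"
    if "m \<le> n" for m n
    using that by (simp only: diff parseval_finite finite_atLeastLessThan)
  have tail: "(\<Sum>k\<in>{m..<n}. (norm (a k))\<^sup>2) \<le> (\<Sum>k. (norm (a (k + m)))\<^sup>2)" for m n
  proof -
    have "(\<Sum>k\<in>{m..<n}. (norm (a k))\<^sup>2) = (\<Sum>k<n - m. (norm (a (k + m)))\<^sup>2)"
      using sum.shift_bounds_nat_ivl[of "\<lambda>k. (norm (a k))\<^sup>2" 0 m "n - m"]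
      by (cases "m \<le> n") (simp_all add: atLeast0LessThan)
    also have "\<dots> \<le> (\<Sum>k. (norm (a (k + m)))\<^sup>2)"
      using a by (intro sum_le_suminf) (auto simp: summable_iff_shift[of "\<lambda>k. (norm (a k))\<^sup>2"])
    finally show ?thesis .
  qed
  have si: "integrable circ (s n)" for n
    by (intro integrable_circ_continuous sc)
  have cau: "\<exists>N. \<forall>i\<ge>N. \<forall>j\<ge>N. (LINT t|circ. norm (s i t - s j t)) < e" if e: "0 < e" for e
  proof -
    \<comment> \<open>Passing from L2 to L1 costs a factor 9, which leaves
      \<open>e / 2 < e\<close>.\<close>
    define \<eta> where "\<eta> = e / 18"
    have \<eta>: "0 < \<eta>" using e by (simp add: \<eta>_def)
    have "0 < \<eta>\<^sup>2 / (2 * pi)" using \<eta> by simp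
    then obtain N where N: "\<And>m n. N \<le> m \<Longrightarrow> norm (\<Sum>k\<in>{m..<n}. (norm (a k))\<^sup>2) < \<eta>\<^sup>2 / (2 * pi)"
      using a[unfolded summable_Cauchy] by blast
    have *: "(LINT t|circ. norm (s j t - s i t)) < e" if "N \<le> i" "i \<le> j" for i j
    proof -
      have "(LINT t|circ. norm (s j t - s i t)) \<le> 9 * \<eta>"
      proof (rule L1_le_L2_circ[OF _ _ \<eta>])
        show "(LINT t|circ. (norm (s j t - s i t))\<^sup>2) \<le> \<eta>\<^sup>2"
          using N[OF that(1), of j] that(2) by (simp add: sq field_simps abs_of_nonneg sum_nonneg)
      qed (intro continuous_measurable_circ integrable_circ_continuous continuous_intros sc)+
      then show ?thesis using e by (simp add: \<eta>_def)
    qed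
    have "(LINT t|circ. norm (s i t - s j t)) < e" if "N \<le> i" "N \<le> j" for i j
      using *[of i j] *[of j i] that by (cases "i \<le> j") (auto simp: norm_minus_commute)
    then show ?thesis by blast
  qed
  obtain r where r: "strict_mono r" "AE t in circ. Cauchy (\<lambda>i. s (r i) t)"
    using cauchy_L1_AE_cauchy_subseq[OF si cau] by blast
  define f where "f t = lim (\<lambda>i. s (r i) t)" for t
  have fm: "f \<in> borel_measurable circ"
    unfolding f_def[abs_def] by (intro borel_measurable_lim_metric continuous_measurable_circ sc)
  have flim: "AE t in circ. (\<lambda>i. s (r i) t) \<longlonglongrightarrow> f t"
    using r(2) by eventually_elim (auto simp: f_def convergent_LIMSEQ_iff[symmetric] Cauchy_convergent_iff)
  have fa: "integrable circ (\<lambda>t. (norm (f t - s n t))\<^sup>2) \<and>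
     (LINT t|circ. (norm (f t - s n t))\<^sup>2) \<le> 2 * pi * (\<Sum>k. (norm (a (k + n)))\<^sup>2)" for n
  proof -
    \<comment> \<open>The shift by \<open>n\<close> ensures \<open>n \<le> r (i + n)\<close>, so
      that each difference is a block of the series.\<close>
    let ?u = "\<lambda>i t. (norm (s (r (i + n)) t - s n t))\<^sup>2"
    have le: "n \<le> r (i + n)" for i
      using seq_suble[OF r(1), of "i + n"] by simp
    have 1: "integrable circ (?u i)" for i
      by (intro integrable_circ_continuous continuous_intros sc)
    have 2: "integral\<^sup>L circ (?u i) \<le> 2 * pi * (\<Sum>k. (norm (a (k + n)))\<^sup>2)" for i
      using tail[of n "r (i + n)"] by (simp add: sq[OF le])
    have 3: "(\<lambda>t. (norm (f t - s n t))\<^sup>2) \<in> borel_measurable circ"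
      using fm continuous_measurable_circ[OF sc, of n] by measurable
    have 4: "AE t in circ. (\<lambda>i. ?u i t) \<longlonglongrightarrow> (norm (f t - s n t))\<^sup>2"
      using flim by eventually_elim (intro tendsto_intros, erule LIMSEQ_ignore_initial_segment)
    show ?thesis
      using fatou_integral_bound[OF 1 _ 2 3 4] by auto
  qed
  show ?thesis
    using that[OF fm] fa unfolding s_def by blast
qed

lemma summable_sq_imp_bounded:
  assumes "summable (\<lambda>k. (norm (a k))\<^sup>2)"
  obtains B where "\<And>k. norm (a k) \<le> B"
proof -
  have "(\<lambda>k. (norm (a k))\<^sup>2) \<longlonglongrightarrow> 0" using assms by (rule summable_LIMSEQ_zero)
  then have "Bseq (\<lambda>k. (norm (a k))\<^sup>2)" by (intro convergent_imp_Bseq convergentI)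
  then obtain K where K: "\<And>k. (norm (a k))\<^sup>2 \<le> K" by (auto simp: Bseq_def)
  have "norm (a k) \<le> sqrt K" for k
    using K[of k] by (simp add: real_le_rsqrt)
  then show ?thesis using that by blast
qed

text \<open>The Riesz-Fischer function has the Fourier coefficients \<open>a k\<close> and no
  others, so its Poisson integral is the power series itself and the radial limit theorem applies.
  The inequality is the direction that later bounds coefficients by boundary values.\<close>

theorem H2_boundary:
  fixes a :: "nat \<Rightarrow> complex"
  assumes a: "summable (\<lambda>k. (norm (a k))\<^sup>2)"
  obtains f where "f \<in> borel_measurable circ" "integrable circ (\<lambda>t. (norm (f t))\<^sup>2)"
    "2 * pi * (\<Sum>k. (norm (a k))\<^sup>2) \<le> (LINT t|circ. (norm (f t))\<^sup>2)"
    "AE \<theta> in circ. ((\<lambda>r. \<Sum>k. a k * (of_real r * cis (- \<theta>)) ^ k) \<longlongrightarrow> f \<theta>) (at_left 1)"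
proof -
  define s where "s n t = (\<Sum>k<n. a k * cis (- real k * t))" for n t
  define T where "T n = 2 * pi * (\<Sum>k. (norm (a (k + n)))\<^sup>2)" for n
  obtain f where f: "f \<in> borel_measurable circ"
    "\<And>n. integrable circ (\<lambda>t. (norm (f t - s n t))\<^sup>2)"
    "\<And>n. (LINT t|circ. (norm (f t - s n t))\<^sup>2) \<le> T n"
    using riesz_fischer[OF a] unfolding s_def T_def by blast
  have f2: "integrable circ (\<lambda>t. (norm (f t))\<^sup>2)"
    using f(2)[of 0] by (simp add: s_def)
  have fi: "integrable circ f" by (rule integrable_circ_sqD[OF f(1) f2])
  have sc: "continuous_on A (s n)" for A n
    unfolding s_def[abs_def] by (intro continuous_intros)
  have T0: "T \<longlonglongrightarrow> 0"
  proof -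
    have "(\<lambda>n. 2 * pi * (\<Sum>k. (norm (a (k + n)))\<^sup>2)) \<longlonglongrightarrow> 2 * pi * 0"
      by (intro tendsto_intros suminf_exist_split2 a)
    then show ?thesis by (simp add: T_def[abs_def])
  qed
  \<comment> \<open>The coefficient functional is continuous in L1 and exact on all sufficiently
    long partial sums.\<close>
  have coeff: "(LINT t|circ. cis (of_int m * t) * f t) = (if 0 \<le> m then 2 * pi * a (nat m) else 0)" for m :: int
  proof -
    have sn: "(LINT t|circ. cis (of_int m * t) * s n t) = (if 0 \<le> m then 2 * pi * a (nat m) else 0)" if "nat m < n" for n
    proof -
      have "(LINT t|circ. cis (of_int m * t) * s n t) =
         (LINT t|circ. (\<Sum>k<n. a k * (cis (of_int m * t) * cis (of_int (- int k) * t))))"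
        by (simp add: s_def sum_distrib_left mult_ac)
      also have "\<dots> = (\<Sum>k<n. a k * (LINT t|circ. (cis (of_int m * t) * cis (of_int (- int k) * t))))"
        by (subst Bochner_Integration.integral_sum)
           (auto intro!: integrable_circ_continuous continuous_intros)
      also have "\<dots> = (\<Sum>k<n. if int k = m then 2 * pi * a k else 0)"
        by (intro sum.cong refl, subst integral_circ_cis_cis) auto
      also have "\<dots> = (\<Sum>k<n. if k = nat m then (if 0 \<le> m then 2 * pi * a k else 0) else 0)"
        by (intro sum.cong) auto
      also have "\<dots> = (if 0 \<le> m then 2 * pi * a (nat m) else 0)"
        using that by (simp add: sum.delta)
      finally show ?thesis .
    qed
    have fs: "integrable circ (\<lambda>t. f t - s n t)" for n
      by (intro Bochner_Integration.integrable_diff fi integrable_circ_continuous sc)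
    have "norm ((LINT t|circ. cis (of_int m * t) * f t) - (if 0 \<le> m then 2 * pi * a (nat m) else 0)) \<le> e"
      if e: "0 < e" for e
    proof -
      define \<eta> where "\<eta> = e / 9"
      have \<eta>: "0 < \<eta>" using e by (simp add: \<eta>_def)
      have "\<forall>\<^sub>F n in sequentially. T n < \<eta>\<^sup>2"
        using T0 by (rule order_tendstoD(2)) (use \<eta> in simp)
      moreover have "\<forall>\<^sub>F n in sequentially. nat m < n"
        by (rule eventually_gt_at_top)
      ultimately have "\<forall>\<^sub>F n in sequentially. T n < \<eta>\<^sup>2 \<and> nat m < n"
        by eventually_elim auto
      then obtain n where n: "T n < \<eta>\<^sup>2" "nat m < n"
        by (auto simp: eventually_sequentially)
      have i1: "integrable circ (\<lambda>t. cis (of_int m * t) * f t)"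
        by (rule integrable_mult_bounded[OF fi, where B=1]) (auto intro!: continuous_measurable_circ continuous_intros)
      have i2: "integrable circ (\<lambda>t. cis (of_int m * t) * s n t)"
        by (intro integrable_circ_continuous continuous_intros sc)
      have "norm ((LINT t|circ. cis (of_int m * t) * f t) - (if 0 \<le> m then 2 * pi * a (nat m) else 0)) =
        norm (LINT t|circ. cis (of_int m * t) * (f t - s n t))"
        by (simp only: right_diff_distrib Bochner_Integration.integral_diff[OF i1 i2] sn[OF n(2)])
      also have "\<dots> \<le> (LINT t|circ. norm (cis (of_int m * t) * (f t - s n t)))"
        by (rule integral_norm_bound)
      also have "\<dots> = (LINT t|circ. norm (f t - s n t))"
        by (simp add: norm_mult)
      also have "\<dots> \<le> 9 * \<eta>"
        using f(3)[of n] n(1) by (intro L1_le_L2_circ f(2) \<eta> borel_measurable_integrable[OF fs]) auto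
      finally show ?thesis by (simp add: \<eta>_def)
    qed
    then have "norm ((LINT t|circ. cis (of_int m * t) * f t) - (if 0 \<le> m then 2 * pi * a (nat m) else 0)) \<le> 0"
      by (rule field_le_epsilon[of _ 0, simplified])
    then show ?thesis by simp
  qed
  have c1: "(LINT t|circ. cis (real k * t) * f t) = 2 * pi * a k" for k
    using coeff[of "int k"] by simp
  have c2: "(LINT t|circ. cis (- real (Suc k) * t) * f t) = 0" for k
    using coeff[of "- int (Suc k)"] by simp
  \<comment> \<open>Bessel's inequality: expand the nonnegative integral of
    \<open>|f - s n|^2\<close>; by the coefficient formula the integral of the real part of
    \<open>cnj (s n) * f\<close> equals that of \<open>|s n|^2\<close>.\<close>
  have bessel: "(\<Sum>k<n. 2 * pi * (norm (a k))\<^sup>2) \<le> (LINT t|circ. (norm (f t))\<^sup>2)" for n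
  proof -
    have i3: "integrable circ (\<lambda>t. cnj (s n t) * f t)"
    proof -
      have "bounded (s n ` {-pi..pi})"
        by (intro compact_imp_bounded compact_continuous_image sc) simp
      then obtain B where "\<And>t. t \<in> {-pi..pi} \<Longrightarrow> norm (s n t) \<le> B"
        unfolding bounded_iff by blast
      then show ?thesis
        by (intro integrable_mult_bounded[OF fi, where B=B] continuous_measurable_circ continuous_intros sc) auto
    qed
    have "(LINT t|circ. cnj (s n t) * f t) = (LINT t|circ. (\<Sum>k<n. cnj (a k) * (cis (real k * t) * f t)))"
      by (simp add: s_def cis_cnj sum_distrib_right sum_distrib_left mult_ac)
    also have "\<dots> = (\<Sum>k<n. cnj (a k) * (LINT t|circ. cis (real k * t) * f t))"
      by (subst Bochner_Integration.integral_sum)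
         (auto intro!: integrable_mult_right integrable_mult_bounded[OF fi, where B=1] continuous_measurable_circ continuous_intros)
    also have "\<dots> = of_real (\<Sum>k<n. 2 * pi * (norm (a k))\<^sup>2)"
      unfolding c1 of_real_sum
      by (intro sum.cong refl) (simp add: complex_norm_square mult_ac del: of_real_power)
    finally have cross: "(LINT t|circ. Re (cnj (s n t) * f t)) = (\<Sum>k<n. 2 * pi * (norm (a k))\<^sup>2)"
      by (simp only: integral_Re[OF i3] Re_complex_of_real)
    have ss: "(LINT t|circ. (norm (s n t))\<^sup>2) = (\<Sum>k<n. 2 * pi * (norm (a k))\<^sup>2)"
      unfolding s_def by (simp only: parseval_finite sum_distrib_left finite_lessThan)
    have i4: "integrable circ (\<lambda>t. (norm (s n t))\<^sup>2)"
      by (intro integrable_circ_continuous continuous_intros sc)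
    have "0 \<le> (LINT t|circ. (norm (f t - s n t))\<^sup>2)" by simp
    also have "\<dots> = (LINT t|circ. (norm (f t))\<^sup>2 - 2 * Re (cnj (s n t) * f t) + (norm (s n t))\<^sup>2)"
      unfolding cmod_power2
      by (intro Bochner_Integration.integral_cong refl) (simp add: power2_eq_square algebra_simps)
    also have "\<dots> = (LINT t|circ. (norm (f t))\<^sup>2) - 2 * (LINT t|circ. Re (cnj (s n t) * f t)) + (LINT t|circ. (norm (s n t))\<^sup>2)"
    proof -
      define \<rho> where "\<rho> t = Re (cnj (s n t) * f t)" for t
      have "integrable circ \<rho>"
        unfolding \<rho>_def using i3 by (rule integrable_Re)
      then show ?thesis
        using f2 i4 unfolding \<rho>_def[symmetric] by simp
    qed
    finally show ?thesis unfolding cross ss by simp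
  qed
  have tot: "2 * pi * (\<Sum>k. (norm (a k))\<^sup>2) \<le> (LINT t|circ. (norm (f t))\<^sup>2)"
    unfolding suminf_mult[OF a, symmetric]
    using bessel by (intro suminf_le_const summable_mult a)
  have pois: "(LINT t|circ. of_real (poisson r (\<theta> - t)) * f t) =
       2 * pi * (\<Sum>k. a k * (of_real r * cis (- \<theta>)) ^ k)" if r: "0 \<le> r" "r < 1" for r \<theta>
  proof -
    have "(LINT t|circ. of_real (poisson r (\<theta> - t)) * f t) =
       (\<Sum>k. of_real r ^ k * cis (- real k * \<theta>) * (2 * pi * a k))"
      by (simp only: poisson_integral_series[OF r fi] c1 c2 mult_zero_right suminf_zero add_0_right)
    also have "\<dots> = (\<Sum>k. 2 * pi * (a k * (of_real r * cis (- \<theta>)) ^ k))"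
      by (simp add: power_mult_distrib Complex.DeMoivre mult_ac)
    also have "\<dots> = 2 * pi * (\<Sum>k. a k * (of_real r * cis (- \<theta>)) ^ k)"
    proof (rule suminf_mult)
      obtain B where B: "\<And>k. norm (a k) \<le> B"
        using summable_sq_imp_bounded[OF a] by blast
      have "summable (\<lambda>k. norm (a k * (of_real r * cis (- \<theta>)) ^ k))"
      proof (rule summable_comparison_test')
        show "summable (\<lambda>k. B * r ^ k)" using r by (intro summable_mult summable_geometric) auto
        show "norm (norm (a k * (of_real r * cis (- \<theta>)) ^ k)) \<le> B * r ^ k" for k
          using B[of k] r by (simp add: norm_mult norm_power mult_right_mono)
      qed
      then show "summable (\<lambda>k. a k * (of_real r * cis (- \<theta>)) ^ k)"
        by (rule summable_norm_cancel)
    qed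
    finally show ?thesis .
  qed
  have "AE \<theta> in circ. ((\<lambda>r. \<Sum>k. a k * (of_real r * cis (- \<theta>)) ^ k) \<longlongrightarrow> f \<theta>) (at_left 1)"
    using fatou_poisson[OF fi]
  proof eventually_elim
    case (elim \<theta>)
    have "((\<lambda>r. (LINT t|circ. of_real (poisson r (\<theta> - t)) * f t) / (2 * pi)) \<longlongrightarrow> 2 * pi * f \<theta> / (2 * pi)) (at_left 1)"
      using elim by (intro tendsto_intros) auto
    then have "((\<lambda>r. (LINT t|circ. of_real (poisson r (\<theta> - t)) * f t) / (2 * pi)) \<longlongrightarrow> f \<theta>) (at_left 1)"
      by simp
    then show ?case
    proof (rule Lim_transform_eventually)
      show "\<forall>\<^sub>F r in at_left 1. (LINT t|circ. of_real (poisson r (\<theta> - t)) * f t) / (2 * pi) =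
          (\<Sum>k. a k * (of_real r * cis (- \<theta>)) ^ k)"
        by (rule eventually_mono[OF eventually_at_left_real[of 0 1]]) (auto simp: pois)
    qed
  qed
  with that f(1) f2 tot show ?thesis by blast
qed

subsection \<open>Transfer functions and their boundary values\<close>

lemma h2sq_finite_iff: "h2sq h < \<infinity> \<longleftrightarrow> summable (\<lambda>k. (norm (h k))\<^sup>2)"
proof
  assume "h2sq h < \<infinity>"
  then have "(\<Sum>k. ennreal ((norm (h k))\<^sup>2)) \<noteq> top" by (simp add: h2sq_def)
  then show "summable (\<lambda>k. (norm (h k))\<^sup>2)" by (intro summable_suminf_not_top) auto
next
  assume "summable (\<lambda>k. (norm (h k))\<^sup>2)"
  then have "(\<Sum>k. ennreal ((norm (h k))\<^sup>2)) \<noteq> top" by (intro ennreal_suminf_neq_top) auto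
  then show "h2sq h < \<infinity>" by (simp add: h2sq_def less_top)
qed

lemma h2sq_eq:
  assumes "summable (\<lambda>k. (norm (h k))\<^sup>2)"
  shows "h2sq h = ennreal (\<Sum>k. (norm (h k))\<^sup>2)"
  unfolding h2sq_def using assms by (intro suminf_ennreal2) auto

lemma norm_vec_sq:
  fixes x :: "'a::real_normed_vector ^ 'n"
  shows "(norm x)\<^sup>2 = (\<Sum>i\<in>UNIV. (norm (x $ i))\<^sup>2)"
  by (simp add: norm_vec_def L2_set_def sum_nonneg)

lemma l2_imp_stable:
  assumes a: "summable (\<lambda>k. (norm (h k))\<^sup>2)"
  shows "stable_sys h"
  unfolding stable_sys_def
proof safe
  fix r :: real assume r: "0 \<le> r" "r < 1"
  obtain B where B: "\<And>k. norm (h k) \<le> B"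
    using summable_sq_imp_bounded[OF a] by blast
  show "summable (\<lambda>k. norm (h k) * r ^ k)"
  proof (rule summable_comparison_test')
    show "summable (\<lambda>k. B * r ^ k)" using r by (intro summable_mult summable_geometric) auto
    show "norm (norm (h k) * r ^ k) \<le> B * r ^ k" for k
      using B[of k] r by (simp add: mult_right_mono)
  qed
qed

lemma stable_summable:
  fixes h :: "nat \<Rightarrow> real ^ 'n"
  assumes "stable_sys h" "norm w < 1"
  shows "summable (\<lambda>k. norm (complex_of_real (h k $ i) * w ^ k))"
proof (rule summable_comparison_test')
  show "summable (\<lambda>k. norm (h k) * norm w ^ k)"
    using assms by (simp add: stable_sys_def)
  show "norm (norm (complex_of_real (h k $ i) * w ^ k)) \<le> norm (h k) * norm w ^ k" for k
    using component_le_norm_cart[of "h k" i] by (simp add: norm_mult norm_power mult_right_mono)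
qed

lemma tfun_nth: "tfun h w $ i = (\<Sum>k. complex_of_real (h k $ i) * w ^ k)"
  by (simp add: tfun_def)

lemma of_real_cis_power: "(of_real r * cis (- \<theta>)) ^ k = of_real r ^ k * cis (- real k * \<theta>)"
  by (simp add: power_mult_distrib Complex.DeMoivre)

text \<open>Absorbing \<open>r ^ k\<close> into the coefficients makes them absolutely summable for
  any stable system, whether or not its H2 norm is finite. Parseval is then summed over the
  components.\<close>

lemma
  fixes h :: "nat \<Rightarrow> real ^ 'n"
  assumes h: "stable_sys h" and r: "0 \<le> r" "r < 1"
  shows continuous_tfun_circle: "continuous_on A (\<lambda>\<theta>. tfun h (of_real r * cis (- \<theta>)))"
    and parseval_tfun: "(\<lambda>k. 2 * pi * ((norm (h k))\<^sup>2 * r ^ (2 * k))) sums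
        (LINT \<theta>|circ. (norm (tfun h (of_real r * cis (- \<theta>))))\<^sup>2)"
proof -
  define c where "c i k = complex_of_real (h k $ i) * of_real r ^ k" for i k
  have c: "summable (\<lambda>k. norm (c i k))" for i
    using stable_summable[OF h, of "of_real r" i] r by (simp add: c_def)
  have eq: "tfun h (of_real r * cis (- \<theta>)) $ i = (\<Sum>k. c i k * cis (- real k * \<theta>))" for i \<theta>
    by (simp only: tfun_nth of_real_cis_power c_def mult.assoc)
  have ci: "continuous_on A (\<lambda>\<theta>. tfun h (of_real r * cis (- \<theta>)) $ i)" for i A
    unfolding eq by (rule parseval_circ(3)[OF c])
  then show "continuous_on A (\<lambda>\<theta>. tfun h (of_real r * cis (- \<theta>)))"
    by (intro continuous_on_vec_lambda[of _ "\<lambda>i \<theta>. tfun h (of_real r * cis (- \<theta>)) $ i", simplified])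
  have "(\<lambda>k. \<Sum>i\<in>UNIV. 2 * pi * (norm (c i k))\<^sup>2) sums
     (\<Sum>i\<in>UNIV. LINT \<theta>|circ. (norm (\<Sum>k. c i k * cis (- real k * \<theta>)))\<^sup>2)"
    by (intro sums_sum parseval_circ(1) c)
  also have "(\<Sum>i\<in>UNIV. LINT \<theta>|circ. (norm (\<Sum>k. c i k * cis (- real k * \<theta>)))\<^sup>2) =
      (LINT \<theta>|circ. (norm (tfun h (of_real r * cis (- \<theta>))))\<^sup>2)"
    unfolding norm_vec_sq eq
    by (rule Bochner_Integration.integral_sum[symmetric]) (rule parseval_circ(2)[OF c])
  also have "(\<lambda>k. \<Sum>i\<in>UNIV. 2 * pi * (norm (c i k))\<^sup>2) = (\<lambda>k. 2 * pi * ((norm (h k))\<^sup>2 * r ^ (2 * k)))"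
  proof
    fix k
    have "(norm (c i k))\<^sup>2 = (norm (h k $ i))\<^sup>2 * r ^ (2 * k)" for i
      using r by (simp add: c_def norm_mult norm_power power_mult_distrib power_mult mult.commute[of 2])
    then show "(\<Sum>i\<in>UNIV. 2 * pi * (norm (c i k))\<^sup>2) = 2 * pi * ((norm (h k))\<^sup>2 * r ^ (2 * k))"
      by (simp add: norm_vec_sq sum_distrib_left sum_distrib_right)
  qed
  finally show "(\<lambda>k. 2 * pi * ((norm (h k))\<^sup>2 * r ^ (2 * k))) sums
        (LINT \<theta>|circ. (norm (tfun h (of_real r * cis (- \<theta>))))\<^sup>2)" .
qed

section \<open>Measurability and almost everywhere existence of the frequency response\<close>

lemma continuous_tfun_radius:
  fixes h :: "nat \<Rightarrow> real ^ 'n"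
  assumes h: "stable_sys h"
  shows "continuous_on {0..<1} (\<lambda>r. tfun h (of_real r * cis (- \<theta>)))"
proof -
  have "continuous_on {0..<1} (\<lambda>r. tfun h (of_real r * cis (- \<theta>)) $ i)" for i
  proof -
    have "continuous_on (ball 0 1) (\<lambda>w. \<Sum>k. complex_of_real (h k $ i) * w ^ k)"
      using stable_summable[OF h]
      by (intro holomorphic_on_imp_continuous_on power_series_holomorphic[where a="\<lambda>k. complex_of_real (h k $ i)"])
         (auto intro!: summable_sums intro: summable_norm_cancel)
    then show ?thesis
      unfolding tfun_nth by (rule continuous_on_compose2) (auto intro!: continuous_intros simp: norm_mult)
  qed
  then show ?thesis
    by (intro continuous_on_vec_lambda[of _ "\<lambda>i r. tfun h (of_real r * cis (- \<theta>)) $ i", simplified])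
qed

text \<open>Where no limit exists, \<open>Lim\<close> is the fixed junk value \<open>THE l. False\<close>, so only the set of
  convergence has to be measurable; by continuity in \<open>r\<close> the Cauchy condition may be tested on
  rational radii.\<close>
lemma borel_measurable_radial_Lim:
  fixes g :: "real \<Rightarrow> 'b \<Rightarrow> 'a::euclidean_space"
  assumes m: "\<And>r. 0 \<le> r \<Longrightarrow> r < 1 \<Longrightarrow> g r \<in> borel_measurable M"
    and c: "\<And>t. continuous_on {0..<1} (\<lambda>r. g r t)"
  shows "(\<lambda>t. Lim (at_left 1) (\<lambda>r. g r t)) \<in> borel_measurable M"
proof -
  define C where "C t \<longleftrightarrow> (\<forall>k::nat. \<exists>m::nat. \<forall>p q::rat. 1 - 1 / real (m + 2) < of_rat p \<and> of_rat p < (1::real) \<and>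
     1 - 1 / real (m + 2) < of_rat q \<and> of_rat q < (1::real) \<longrightarrow> dist (g (of_rat p) t) (g (of_rat q) t) \<le> 1 / real (k + 1))" for t
  \<comment> \<open>A sequence tending to 1 from the left: where the radial limit exists it is the
    limit along \<open>x\<close>, and the latter is measurable. The same numbers are the thresholds
    in \<open>C\<close>.\<close>
  define x where "x n = 1 - 1 / real (n + 2)" for n
  have x: "0 \<le> x n" "x n < 1" for n by (auto simp: x_def field_simps)
  have xlim: "filterlim x (at_left 1) sequentially"
  proof -
    have "x \<longlonglongrightarrow> 1"
      unfolding x_def by real_asymp
    moreover have "x n \<noteq> 1" for n using x(2)[of n] by simp
    ultimately show ?thesis
      using x(2) by (auto simp: filterlim_at intro!: always_eventually)
  qed
  have CI: "C t" if l: "((\<lambda>r. g r t) \<longlongrightarrow> l) (at_left 1)" for t l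
    unfolding C_def
  proof
    fix k :: nat
    have "\<forall>\<^sub>F r in at_left 1. dist (g r t) l < 1 / real (2 * (k + 1))"
      using l by (rule tendstoD) simp
    then obtain b where b: "b < 1" "\<And>r. b < r \<Longrightarrow> r < 1 \<Longrightarrow> dist (g r t) l < 1 / real (2 * (k + 1))"
      unfolding eventually_at_left[OF zero_less_one] by blast
    have "\<forall>\<^sub>F m in sequentially. b < x m"
      using eventually_at_left_real[OF b(1)] xlim by (auto simp: filterlim_iff elim: eventually_mono)
    then obtain m where m: "b < x m" by (auto simp: eventually_sequentially)
    show "\<exists>m::nat. \<forall>p q::rat. 1 - 1 / real (m + 2) < of_rat p \<and> of_rat p < (1::real) \<and>
     1 - 1 / real (m + 2) < of_rat q \<and> of_rat q < (1::real) \<longrightarrow> dist (g (of_rat p) t) (g (of_rat q) t) \<le> 1 / real (k + 1)"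
    proof (intro exI[of _ m] allI impI)
      fix p q assume "1 - 1 / real (m + 2) < of_rat p \<and> of_rat p < (1::real) \<and>
        1 - 1 / real (m + 2) < of_rat q \<and> of_rat q < (1::real)"
      then have pq: "dist (g (of_rat p) t) l < 1 / real (2 * (k + 1))" "dist (g (of_rat q) t) l < 1 / real (2 * (k + 1))"
        using m unfolding x_def by (meson b(2) less_trans)+
      have "dist (g (of_rat p) t) (g (of_rat q) t) \<le> dist (g (of_rat p) t) l + dist (g (of_rat q) t) l"
        by (rule dist_triangle2)
      also have "\<dots> \<le> 1 / real (2 * (k + 1)) + 1 / real (2 * (k + 1))"
        using pq by (intro add_mono less_imp_le)
      also have "\<dots> = 1 / real (k + 1)"
        by (simp add: field_simps)
      finally show "dist (g (of_rat p) t) (g (of_rat q) t) \<le> 1 / real (k + 1)" .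
    qed
  qed
  have CD: "((\<lambda>r. g r t) \<longlongrightarrow> lim (\<lambda>n. g (x n) t)) (at_left 1)" if C: "C t" for t
  proof -
    \<comment> \<open>Every radius is approximated by rational ones from above, and continuity
      carries the closed inequality in \<open>C\<close> over to the limit.\<close>
    have key: "\<exists>m. \<forall>r s. x m < r \<and> r < 1 \<and> x m < s \<and> s < 1 \<longrightarrow> dist (g r t) (g s t) \<le> 1 / real (k + 1)" for k
    proof -
      obtain m where m: "\<And>p q::rat. x m < of_rat p \<Longrightarrow> of_rat p < (1::real) \<Longrightarrow>
         x m < of_rat q \<Longrightarrow> of_rat q < (1::real) \<Longrightarrow> dist (g (of_rat p) t) (g (of_rat q) t) \<le> 1 / real (k + 1)"
        using C unfolding C_def x_def by blast
      have "dist (g r t) (g s t) \<le> 1 / real (k + 1)" if rs: "x m < r" "r < 1" "x m < s" "s < 1" for r s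
      proof -
        have ap: "\<exists>P. (\<forall>n. x m < of_rat (P n) \<and> of_rat (P n) < (1::real)) \<and> (\<lambda>n. g (of_rat (P n)) t) \<longlonglongrightarrow> g u t"
          if u: "x m < u" "u < 1" for u
        proof -
          have "\<exists>p. u < of_rat p \<and> of_rat p < min 1 (u + 1 / real (n + 1))" for n
            using u by (intro of_rat_dense) auto
          then obtain P where P: "\<And>n. u < of_rat (P n)" "\<And>n. of_rat (P n) < min 1 (u + 1 / real (n + 1))"
            by metis
          have "(\<lambda>n. real_of_rat (P n)) \<longlonglongrightarrow> u"
          proof (rule tendsto_sandwich[of "\<lambda>_. u" _ _ "\<lambda>n. u + 1 / real (n + 1)"])
            show "(\<lambda>n. u + 1 / real (n + 1)) \<longlonglongrightarrow> u" by real_asymp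
          qed (use P in \<open>auto intro!: always_eventually less_imp_le\<close>)
          then have "(\<lambda>n. g (of_rat (P n)) t) \<longlonglongrightarrow> g u t"
          proof (rule continuous_on_tendsto_compose[OF c[of t]])
            show "u \<in> {0..<1}" using u x[of m] by auto
            show "\<forall>\<^sub>F n in sequentially. real_of_rat (P n) \<in> {0..<1}"
              using P u x[of m] by (intro always_eventually allI) (smt (verit) atLeastLessThan_iff min_less_iff_conj)
          qed
          then show ?thesis using P u by (intro exI[of _ P]) (auto intro: less_trans)
        qed
        obtain P where P: "\<And>n. x m < of_rat (P n)" "\<And>n. of_rat (P n) < (1::real)" "(\<lambda>n. g (of_rat (P n)) t) \<longlonglongrightarrow> g r t"
          using ap[OF rs(1,2)] by blast
        obtain Q where Q: "\<And>n. x m < of_rat (Q n)" "\<And>n. of_rat (Q n) < (1::real)" "(\<lambda>n. g (of_rat (Q n)) t) \<longlonglongrightarrow> g s t"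
          using ap[OF rs(3,4)] by blast
        show ?thesis
          by (rule LIMSEQ_le_const2[OF tendsto_dist[OF P(3) Q(3)]]) (use m P Q in auto)
      qed
      then show ?thesis by blast
    qed
    have xm: "\<exists>N. \<forall>n\<ge>N. x m < x n" for m
      by (rule exI[of _ "Suc m"]) (auto simp: x_def field_simps)
    have "Cauchy (\<lambda>n. g (x n) t)"
    proof (rule metric_CauchyI)
      fix e :: real assume "0 < e"
      then obtain k where k: "1 / real (k + 1) < e"
        by (metis Suc_eq_plus1 nat_approx_posE)
      obtain m where m: "\<And>r s. x m < r \<Longrightarrow> r < 1 \<Longrightarrow> x m < s \<Longrightarrow> s < 1 \<Longrightarrow> dist (g r t) (g s t) \<le> 1 / real (k + 1)"
        using key[of k] by blast
      obtain N where N: "\<And>n. N \<le> n \<Longrightarrow> x m < x n" using xm[of m] by blast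
      show "\<exists>N. \<forall>i\<ge>N. \<forall>j\<ge>N. dist (g (x i) t) (g (x j) t) < e"
        using m N x k by (intro exI[of _ N]) (meson le_less_trans)
    qed
    then have lim: "(\<lambda>n. g (x n) t) \<longlonglongrightarrow> lim (\<lambda>n. g (x n) t)"
      by (simp add: Cauchy_convergent_iff convergent_LIMSEQ_iff)
    show ?thesis
    proof (rule tendstoI)
      fix e :: real assume "0 < e"
      then obtain k where k: "1 / real (k + 1) < e"
        by (metis Suc_eq_plus1 nat_approx_posE)
      obtain m where m: "\<And>r s. x m < r \<Longrightarrow> r < 1 \<Longrightarrow> x m < s \<Longrightarrow> s < 1 \<Longrightarrow> dist (g r t) (g s t) \<le> 1 / real (k + 1)"
        using key[of k] by blast
      obtain N where N: "\<And>n. N \<le> n \<Longrightarrow> x m < x n" using xm[of m] by blast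
      have "dist (g r t) (lim (\<lambda>n. g (x n) t)) < e" if "x m < r" "r < 1" for r
      proof -
        have "dist (g r t) (lim (\<lambda>n. g (x n) t)) \<le> 1 / real (k + 1)"
          by (rule LIMSEQ_le_const2[OF tendsto_dist[OF tendsto_const lim]]) (use m N x that in blast)
        then show ?thesis using k by simp
      qed
      then show "\<forall>\<^sub>F r in at_left 1. dist (g r t) (lim (\<lambda>n. g (x n) t)) < e"
        by (intro eventually_mono[OF eventually_at_left_real[OF x(2)[of m]]]) auto
    qed
  qed
  have Leq: "Lim (at_left 1) (\<lambda>r. g r t) = (if C t then lim (\<lambda>n. g (x n) t) else (THE l. False))" for t
  proof (cases "C t")
    case True
    then show ?thesis using CD[OF True] by (simp add: tendsto_Lim trivial_limit_at_left_real)
  next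
    case False
    then have "(\<lambda>l. ((\<lambda>r. g r t) \<longlongrightarrow> l) (at_left 1)) = (\<lambda>l. False)"
      using CI by blast
    then show ?thesis using False by (simp add: t2_space_class.Lim_def)
  qed
  have "Measurable.pred M C"
  proof -
    \<comment> \<open>For rationals outside the required range the implication is trivially true, so
      \<open>g\<close> is evaluated only at radii where it is known to be measurable.\<close>
    have d: "Measurable.pred M (\<lambda>t. 1 - 1 / real (m + 2) < of_rat p \<and> of_rat p < (1::real) \<and>
     1 - 1 / real (m + 2) < of_rat q \<and> of_rat q < (1::real) \<longrightarrow> dist (g (of_rat p) t) (g (of_rat q) t) \<le> 1 / real (k + 1))"
      for m k p q
    proof (cases "1 - 1 / real (m + 2) < of_rat p \<and> of_rat p < (1::real) \<and>
     1 - 1 / real (m + 2) < of_rat q \<and> of_rat q < (1::real)")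
      case True
      then have "0 \<le> real_of_rat p" "0 \<le> real_of_rat q"
        using x(1)[of m] unfolding x_def by linarith+
      then have [measurable]: "g (of_rat p) \<in> borel_measurable M" "g (of_rat q) \<in> borel_measurable M"
        using True m by auto
      show ?thesis using True by simp
    next
      case False
      then have "(\<lambda>t. 1 - 1 / real (m + 2) < of_rat p \<and> of_rat p < (1::real) \<and>
         1 - 1 / real (m + 2) < of_rat q \<and> of_rat q < (1::real) \<longrightarrow>
         dist (g (of_rat p) t) (g (of_rat q) t) \<le> 1 / real (k + 1)) = (\<lambda>t. True)"
        by blast
      then show ?thesis by (simp only: measurable_const UNIV_I space_count_space)
    qed
    show ?thesis
      unfolding C_def by (intro pred_intros_countable d)
  qed
  moreover have "(\<lambda>t. lim (\<lambda>n. g (x n) t)) \<in> borel_measurable M"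
    by (intro borel_measurable_lim_metric m x)
  ultimately show ?thesis
    unfolding Leq by measurable
qed

text \<open>The radial limit theorem is applied to each component. Measurability of
  \<open>freq F\<close> has its own proof, because \<open>freq F\<close> agrees with the
  componentwise limits only almost everywhere and \<open>circ\<close>, built on Borel sets, is not
  complete.\<close>

lemma
  fixes F :: "nat \<Rightarrow> real ^ 'n"
  assumes F: "summable (\<lambda>k. (norm (F k))\<^sup>2)"
  shows borel_measurable_freq: "freq F \<in> borel_measurable circ"
    and freq_AE: "AE \<theta> in circ. ((\<lambda>r. tfun F (of_real r * cis (- \<theta>))) \<longlongrightarrow> freq F \<theta>) (at_left 1)"
    and integrable_freq_sq: "integrable circ (\<lambda>\<theta>. (norm (freq F \<theta>))\<^sup>2)"
proof -
  have st: "stable_sys F" using F by (rule l2_imp_stable)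
  show m: "freq F \<in> borel_measurable circ"
    unfolding freq_def[abs_def]
    by (intro borel_measurable_radial_Lim continuous_measurable_circ continuous_tfun_circle
        continuous_tfun_radius st)
  have Fi: "summable (\<lambda>k. (norm (complex_of_real (F k $ i)))\<^sup>2)" for i
  proof (rule summable_comparison_test'[OF F])
    show "norm ((norm (complex_of_real (F k $ i)))\<^sup>2) \<le> (norm (F k))\<^sup>2" for k
      using component_le_norm_cart[of "F k" i] power_mono[of "\<bar>F k $ i\<bar>" "norm (F k)" 2] by simp
  qed
  have "\<exists>f. f \<in> borel_measurable circ \<and> integrable circ (\<lambda>t. (norm (f t))\<^sup>2) \<and>
      (AE \<theta> in circ. ((\<lambda>r. tfun F (of_real r * cis (- \<theta>)) $ i) \<longlongrightarrow> f \<theta>) (at_left 1))" for i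
  proof -
    obtain f where "f \<in> borel_measurable circ" "integrable circ (\<lambda>t. (norm (f t))\<^sup>2)"
      "2 * pi * (\<Sum>k. (norm (complex_of_real (F k $ i)))\<^sup>2) \<le> (LINT t|circ. (norm (f t))\<^sup>2)"
      "AE \<theta> in circ. ((\<lambda>r. \<Sum>k. complex_of_real (F k $ i) * (of_real r * cis (- \<theta>)) ^ k) \<longlongrightarrow> f \<theta>) (at_left 1)"
      by (rule H2_boundary[OF Fi[of i]])
    then show ?thesis unfolding tfun_nth by (intro exI[of _ f] conjI)
  qed
  from choice[OF allI[OF this]] obtain f where f': "\<forall>i. f i \<in> borel_measurable circ \<and>
      integrable circ (\<lambda>t. (norm (f i t))\<^sup>2) \<and>
      (AE \<theta> in circ. ((\<lambda>r. tfun F (of_real r * cis (- \<theta>)) $ i) \<longlongrightarrow> f i \<theta>) (at_left 1))" ..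
  note f = f'[THEN spec, THEN conjunct1] f'[THEN spec, THEN conjunct2, THEN conjunct1]
    f'[THEN spec, THEN conjunct2, THEN conjunct2]
  have "AE \<theta> in circ. \<forall>i. ((\<lambda>r. tfun F (of_real r * cis (- \<theta>)) $ i) \<longlongrightarrow> f i \<theta>) (at_left 1)"
    using f(3) by (simp add: AE_finite_all[of UNIV, simplified])
  then have lim: "AE \<theta> in circ. ((\<lambda>r. tfun F (of_real r * cis (- \<theta>))) \<longlongrightarrow> (\<chi> i. f i \<theta>)) (at_left 1)"
    by eventually_elim (auto intro: vec_tendstoI)
  then have eq: "AE \<theta> in circ. freq F \<theta> = (\<chi> i. f i \<theta>)"
    by eventually_elim (simp add: freq_def tendsto_Lim trivial_limit_at_left_real)
  with lim show "AE \<theta> in circ. ((\<lambda>r. tfun F (of_real r * cis (- \<theta>))) \<longlongrightarrow> freq F \<theta>) (at_left 1)"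
    by eventually_elim simp
  have i: "integrable circ (\<lambda>\<theta>. \<Sum>i\<in>UNIV. (norm (f i \<theta>))\<^sup>2)"
    using f(2) by simp
  have e: "AE \<theta> in circ. (\<Sum>i\<in>UNIV. (norm (f i \<theta>))\<^sup>2) = (norm (freq F \<theta>))\<^sup>2"
    using eq by eventually_elim (simp add: norm_vec_sq)
  show "integrable circ (\<lambda>\<theta>. (norm (freq F \<theta>))\<^sup>2)"
    by (rule integrable_cong_AE_imp[OF i _ e]) (use m in measurable)
qed

lemma integrable_norm_freq:
  fixes F :: "nat \<Rightarrow> real ^ 'n"
  assumes F: "summable (\<lambda>k. (norm (F k))\<^sup>2)"
  shows "integrable circ (\<lambda>\<theta>. norm (freq F \<theta>))"
proof -
  have "integrable circ (\<lambda>\<theta>. complex_of_real (norm (freq F \<theta>)))"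
    using borel_measurable_freq[OF F] integrable_freq_sq[OF F]
    by (intro integrable_circ_sqD) auto
  from integrable_Re[OF this] show ?thesis by simp
qed

lemma seq_at_left_1:
  obtains x :: "nat \<Rightarrow> real" where "\<And>n. 0 \<le> x n" "\<And>n. x n < 1" "filterlim x (at_left 1) sequentially"
proof
  show "0 \<le> 1 - 1 / real (n + 2)" "1 - 1 / real (n + 2) < 1" for n
    by (auto simp: field_simps)
  show "filterlim (\<lambda>n. 1 - 1 / real (n + 2)) (at_left 1) sequentially"
    by real_asymp
qed

subsection \<open>The lower bound\<close>

lemma series_FL_tfun:
  fixes F :: "nat \<Rightarrow> real ^ 'p" and L :: "nat \<Rightarrow> real ^ 'q"
  assumes F: "stable_sys F" and L: "stable_sys L" and w: "norm w < 1"
  shows "(\<lambda>k. complex_of_real (series_FL F L k $ i $ j) * w ^ k) sums (tfun F w $ i * tfun L w $ j)"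
proof -
  have "(\<lambda>k. \<Sum>m\<le>k. (complex_of_real (F m $ i) * w ^ m) * (complex_of_real (L (k - m) $ j) * w ^ (k - m))) sums
      (tfun F w $ i * tfun L w $ j)"
    unfolding tfun_nth by (intro Cauchy_product_sums stable_summable F L w)
  moreover have "(\<Sum>m\<le>k. (complex_of_real (F m $ i) * w ^ m) * (complex_of_real (L (k - m) $ j) * w ^ (k - m))) =
      complex_of_real (series_FL F L k $ i $ j) * w ^ k" for k
    unfolding series_FL_def vec_lambda_beta of_real_sum sum_distrib_right
    by (intro sum.cong refl) (auto simp: mult_ac simp flip: power_add)
  ultimately show ?thesis by simp
qed

lemma stable_series_FL_row:
  fixes F :: "nat \<Rightarrow> real ^ 'p" and L :: "nat \<Rightarrow> real ^ 'q"
  assumes F: "stable_sys F" and L: "stable_sys L"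
  shows "stable_sys (\<lambda>k. series_FL F L k $ i)"
  unfolding stable_sys_def
proof safe
  fix r :: real assume r: "0 \<le> r" "r < 1"
  have S: "summable (\<lambda>k. norm (F k) * r ^ k)" "summable (\<lambda>k. norm (L k) * r ^ k)"
    using F L r by (auto simp: stable_sys_def)
  have "summable (\<lambda>k. \<Sum>m\<le>k. (norm (F m) * r ^ m) * (norm (L (k - m)) * r ^ (k - m)))"
    using S r by (intro summable_Cauchy_product) (auto simp: abs_mult)
  then show "summable (\<lambda>k. norm (series_FL F L k $ i) * r ^ k)"
  proof (rule summable_comparison_test'[where N=0])
    fix k
    have "series_FL F L k $ i = (\<Sum>m\<le>k. (F m $ i) *\<^sub>R L (k - m))"
      by (simp add: series_FL_def vec_eq_iff)
    then have "norm (series_FL F L k $ i) \<le> (\<Sum>m\<le>k. norm (F m) * norm (L (k - m)))"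
      using component_le_norm_cart[of "F _" i] by (simp only:) (rule sum_norm_le, simp add: mult_right_mono)
    then have "norm (series_FL F L k $ i) * r ^ k \<le> (\<Sum>m\<le>k. norm (F m) * norm (L (k - m))) * r ^ k"
      using r by (intro mult_right_mono) auto
    also have "\<dots> = (\<Sum>m\<le>k. (norm (F m) * r ^ m) * (norm (L (k - m)) * r ^ (k - m)))"
      unfolding sum_distrib_right by (intro sum.cong refl) (auto simp: mult_ac simp flip: power_add)
    finally show "norm (norm (series_FL F L k $ i) * r ^ k) \<le>
        (\<Sum>m\<le>k. (norm (F m) * r ^ m) * (norm (L (k - m)) * r ^ (k - m)))"
      using r by simp
  qed
qed

lemma tfun_series_FL_row:
  fixes F :: "nat \<Rightarrow> real ^ 'p" and L :: "nat \<Rightarrow> real ^ 'q"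
  assumes "stable_sys F" "stable_sys L" "norm w < 1"
  shows "tfun (\<lambda>k. series_FL F L k $ i) w = (\<chi> j. tfun F w $ i * tfun L w $ j)"
  using series_FL_tfun[OF assms] by (simp add: tfun_def sums_iff)

text \<open>The transfer matrix is a column times a row, so its Frobenius norm is the product of the
  two Euclidean norms. Parseval is applied row by row.\<close>

lemma parseval_series_FL:
  fixes F :: "nat \<Rightarrow> real ^ 'p" and L :: "nat \<Rightarrow> real ^ 'q"
  assumes F: "stable_sys F" and L: "stable_sys L" and r: "0 \<le> r" "r < 1"
  shows "(\<lambda>k. 2 * pi * ((norm (series_FL F L k))\<^sup>2 * r ^ (2 * k))) sums
    (LINT \<theta>|circ. (norm (tfun F (of_real r * cis (- \<theta>))))\<^sup>2 * (norm (tfun L (of_real r * cis (- \<theta>))))\<^sup>2)"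
proof -
  let ?w = "\<lambda>\<theta>. of_real r * cis (- \<theta>)"
  have w: "norm (?w \<theta>) < 1" for \<theta> using r by (simp add: norm_mult)
  have "(\<lambda>k. \<Sum>i\<in>UNIV. 2 * pi * ((norm (series_FL F L k $ i))\<^sup>2 * r ^ (2 * k))) sums
    (\<Sum>i\<in>UNIV. LINT \<theta>|circ. (norm (tfun (\<lambda>k. series_FL F L k $ i) (?w \<theta>)))\<^sup>2)"
    by (intro sums_sum parseval_tfun stable_series_FL_row F L r)
  also have "(\<Sum>i\<in>UNIV. LINT \<theta>|circ. (norm (tfun (\<lambda>k. series_FL F L k $ i) (?w \<theta>)))\<^sup>2) =
     (LINT \<theta>|circ. (\<Sum>i\<in>UNIV. (norm (tfun (\<lambda>k. series_FL F L k $ i) (?w \<theta>)))\<^sup>2))"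
    by (rule Bochner_Integration.integral_sum[symmetric])
       (intro integrable_circ_continuous continuous_intros continuous_tfun_circle stable_series_FL_row F L r)
  also have "\<dots> = (LINT \<theta>|circ. (norm (tfun F (?w \<theta>)))\<^sup>2 * (norm (tfun L (?w \<theta>)))\<^sup>2)"
    by (simp add: tfun_series_FL_row[OF F L w] norm_vec_sq norm_mult power_mult_distrib sum_product)
  finally show ?thesis
    by (simp add: norm_vec_sq sum_distrib_left sum_distrib_right)
qed

lemma left_inverse_tfun:
  fixes L G :: "nat \<Rightarrow> real ^ 'q"
  assumes L: "stable_sys L" and G: "stable_sys G" and inv: "left_inverse L G" and w: "norm w < 1"
  shows "(\<Sum>j\<in>UNIV. tfun L w $ j * tfun G w $ j) = 1"
proof -
  have "(\<lambda>k. \<Sum>j\<in>UNIV. \<Sum>m\<le>k. (complex_of_real (L m $ j) * w ^ m) * (complex_of_real (G (k - m) $ j) * w ^ (k - m))) sums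
      (\<Sum>j\<in>UNIV. tfun L w $ j * tfun G w $ j)"
    unfolding tfun_nth by (intro sums_sum Cauchy_product_sums stable_summable G L w)
  moreover have "(\<Sum>j\<in>UNIV. \<Sum>m\<le>k. (complex_of_real (L m $ j) * w ^ m) * (complex_of_real (G (k - m) $ j) * w ^ (k - m))) =
      complex_of_real (series_LG L G k) * w ^ k" for k
    unfolding series_LG_def inner_vec_def of_real_sum sum_distrib_right
    by (subst sum.swap, intro sum.cong refl) (auto simp: mult_ac simp flip: power_add)
  ultimately have "(\<lambda>k. complex_of_real (if k = 0 then 1 else 0) * w ^ k) sums (\<Sum>j\<in>UNIV. tfun L w $ j * tfun G w $ j)"
    using inv by (simp add: left_inverse_def)
  moreover have "(\<lambda>k. complex_of_real (if k = 0 then 1 else 0) * w ^ k) sums 1"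
  proof -
    have "(\<lambda>k. complex_of_real (if k = 0 then 1 else 0) * w ^ k) = (\<lambda>k. if k = 0 then w ^ k else 0)"
      by auto
    then show ?thesis using sums_single[of 0 "\<lambda>k. w ^ k"] by simp
  qed
  ultimately show ?thesis by (rule sums_unique2)
qed

text \<open>Cauchy-Schwarz over the \<open>q\<close> channels; with a single channel it is an
  equality, so a scalar \<open>G\<close> loses nothing here.\<close>

lemma left_inverse_norm:
  fixes L G :: "nat \<Rightarrow> real ^ 'q"
  assumes "stable_sys L" "stable_sys G" "left_inverse L G" "norm w < 1"
  shows "1 \<le> norm (tfun L w) * norm (tfun G w)"
proof -
  have "1 = norm (\<Sum>j\<in>UNIV. tfun L w $ j * tfun G w $ j)"
    using left_inverse_tfun[OF assms] by simp
  also have "\<dots> \<le> (\<Sum>j\<in>UNIV. \<bar>norm (tfun L w $ j)\<bar> * \<bar>norm (tfun G w $ j)\<bar>)"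
    by (rule order_trans[OF norm_sum]) (simp add: norm_mult)
  also have "\<dots> \<le> norm (tfun L w) * norm (tfun G w)"
    unfolding norm_vec_def by (rule L2_set_mult_ineq)
  finally show ?thesis .
qed

lemma abel_le:
  fixes v :: "nat \<Rightarrow> real"
  assumes v: "\<And>k. 0 \<le> v k" "summable v" and r: "0 \<le> r" "r < 1"
    and s: "(\<lambda>k. 2 * pi * (v k * r ^ (2 * k))) sums S"
  shows "S \<le> 2 * pi * suminf v"
  unfolding suminf_mult[OF v(2), symmetric] sums_unique[OF s]
  using v r s by (intro suminf_le summable_mult mult_left_mono mult_left_le) (auto simp: power_le_one sums_iff)

text \<open>A form of Cauchy-Schwarz that is linear in the integrals, so that the limit at the
  boundary can be taken before \<open>s\<close> is eliminated. The value \<open>s = I / X\<close>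
  suffices; if \<open>X = 0\<close>, then \<open>s = (Y + 1) / I\<close> makes the right side
  smaller than \<open>I\<close>.\<close>

lemma le_sqrt_mult_if_weighted_AM:
  fixes I X Y :: real
  assumes "0 \<le> I" "0 \<le> X" "0 \<le> Y" and s: "\<And>s. 0 < s \<Longrightarrow> 2 * I \<le> s * X + Y / s"
  shows "I\<^sup>2 \<le> X * Y"
proof (cases "I = 0")
  case False
  then have I: "0 < I" using assms by simp
  show ?thesis
  proof (cases "X = 0")
    case True
    have "2 * I \<le> Y / ((Y + 1) / I)" using s[of "(Y + 1) / I"] I assms True by simp
    also have "\<dots> = I * (Y / (Y + 1))" by simp
    also have "\<dots> \<le> I * 1" using I assms by (intro mult_left_mono) auto
    finally show ?thesis using I by simp
  next
    case False
    then have X: "0 < X" using assms by simp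
    have "2 * I \<le> I + Y * X / I" using s[of "I / X"] I X by simp
    then have "I \<le> Y * X / I" by simp
    then show ?thesis using I by (simp add: field_simps power2_eq_square)
  qed
qed (use assms in simp)

theorem h2sq_product_ge:
  fixes F :: "nat \<Rightarrow> real ^ 'p" and G L :: "nat \<Rightarrow> real ^ 'q"
  assumes F: "summable (\<lambda>k. (norm (F k))\<^sup>2)" and G: "stable_sys G" and L: "stable_sys L"
    and inv: "left_inverse L G"
  shows "ennreal ((1 / (2 * pi) * (LINT \<theta>|circ. norm (freq F \<theta>)))\<^sup>2) \<le> h2sq G * h2sq (series_FL F L)"
proof -
  define I where "I = 1 / (2 * pi) * (LINT \<theta>|circ. norm (freq F \<theta>))"
  have I0: "0 \<le> I" by (simp add: I_def)
  have stF: "stable_sys F" using F by (rule l2_imp_stable)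
  note freqm = borel_measurable_freq[OF F]
  \<comment> \<open>In \<open>ennreal\<close> zero times infinity is zero, so an infinite factor
    settles the claim only if the other factor is nonzero. For \<open>G\<close>, the inverse
    relation at \<open>k = 0\<close> forces \<open>G 0\<close> to be nonzero.\<close>
  have nG: "h2sq G \<noteq> 0"
  proof
    assume "h2sq G = 0"
    then have "(norm (G 0))\<^sup>2 = 0"
      unfolding h2sq_def by (simp add: suminf_eq_zero_iff)
    then have "series_LG L G 0 = 0" by (simp add: series_LG_def)
    then show False using inv by (simp add: left_inverse_def)
  qed
  \<comment> \<open>At each point of the disc some component of \<open>L\<close> is nonzero, so if
    \<open>F L\<close> vanishes then \<open>F\<close> does, and the lower bound is 0.\<close>
  have nFL: "I = 0" if "h2sq (series_FL F L) = 0"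
  proof -
    have z: "series_FL F L k = 0" for k
      using that unfolding h2sq_def by (simp add: suminf_eq_zero_iff)
    have "tfun F w = 0" if w: "norm w < 1" for w
    proof -
      have "tfun F w $ i * tfun L w $ j = 0" for i j
        using series_FL_tfun[OF stF L w, of i j] z by (simp add: sums_iff)
      moreover have "\<exists>j. tfun L w $ j \<noteq> 0"
      proof (rule ccontr)
        assume "\<not> ?thesis"
        then have "(\<Sum>j\<in>UNIV. tfun L w $ j * tfun G w $ j) = 0" by simp
        then show False using left_inverse_tfun[OF L G inv w] by simp
      qed
      ultimately show ?thesis by (auto simp: vec_eq_iff)
    qed
    then have "tfun F (of_real r * cis (- \<theta>)) = 0" if "0 < r" "r < 1" for r \<theta>
      using that by (simp add: norm_mult)
    then have "((\<lambda>r. tfun F (of_real r * cis (- \<theta>))) \<longlongrightarrow> 0) (at_left 1)" for \<theta>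
      by (intro tendsto_eventually eventually_mono[OF eventually_at_left_real[of 0 1]]) auto
    then have "freq F \<theta> = 0" for \<theta>
      unfolding freq_def by (intro tendsto_Lim) (auto simp: trivial_limit_at_left_real)
    then show ?thesis by (simp add: I_def)
  qed
  show ?thesis
  proof (cases "h2sq G < \<infinity> \<and> h2sq (series_FL F L) < \<infinity>")
    case False
    show ?thesis
    proof (cases "h2sq (series_FL F L) = 0")
      case True
      then show ?thesis using nFL unfolding I_def[symmetric] by simp
    next
      case nz: False
      then have "h2sq G * h2sq (series_FL F L) = top"
        using False nG by (auto simp: ennreal_mult_eq_top_iff less_top[symmetric])
      then show ?thesis by simp
    qed
  next
    case True
    define X where "X = (\<Sum>k. (norm (series_FL F L k))\<^sup>2)"
    define Y where "Y = (\<Sum>k. (norm (G k))\<^sup>2)"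
    have sG: "summable (\<lambda>k. (norm (G k))\<^sup>2)" and sFL: "summable (\<lambda>k. (norm (series_FL F L k))\<^sup>2)"
      using True unfolding h2sq_finite_iff by blast+
    have X0: "0 \<le> X" and Y0: "0 \<le> Y"
      unfolding X_def Y_def using sG sFL by (auto intro!: suminf_nonneg)
    have bound: "(LINT \<theta>|circ. norm (tfun F (of_real r * cis (- \<theta>)))) \<le> pi * (s * X + Y / s)"
      if s: "0 < s" and r: "0 \<le> r" "r < 1" for s r
    proof -
      let ?w = "\<lambda>\<theta>. of_real r * cis (- \<theta>)"
      have w: "norm (?w \<theta>) < 1" for \<theta> using r by (simp add: norm_mult)
      have cF: "continuous_on A (\<lambda>\<theta>. norm (tfun F (?w \<theta>)))"
        and cL: "continuous_on A (\<lambda>\<theta>. norm (tfun L (?w \<theta>)))"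
        and cG: "continuous_on A (\<lambda>\<theta>. norm (tfun G (?w \<theta>)))" for A
        by (intro continuous_intros continuous_tfun_circle stF L G r)+
      let ?A = "\<lambda>\<theta>. (norm (tfun F (?w \<theta>)))\<^sup>2 * (norm (tfun L (?w \<theta>)))\<^sup>2"
      let ?B = "\<lambda>\<theta>. (norm (tfun G (?w \<theta>)))\<^sup>2"
      have iA: "integrable circ ?A" and iB: "integrable circ ?B"
        by (intro integrable_circ_continuous continuous_intros cF cL cG)+
      have "(LINT \<theta>|circ. norm (tfun F (?w \<theta>))) \<le> (LINT \<theta>|circ. (s / 2) * ?A \<theta> + (1 / (2 * s)) * ?B \<theta>)"
      proof (rule integral_mono)
        show "integrable circ (\<lambda>\<theta>. norm (tfun F (?w \<theta>)))"
          by (intro integrable_circ_continuous cF)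
        show "integrable circ (\<lambda>\<theta>. (s / 2) * ?A \<theta> + (1 / (2 * s)) * ?B \<theta>)"
          using iA iB by (intro Bochner_Integration.integrable_add integrable_mult_right)
        fix \<theta>
        define f l g where "f = norm (tfun F (?w \<theta>))" and "l = norm (tfun L (?w \<theta>))" and "g = norm (tfun G (?w \<theta>))"
        have "f * 1 \<le> f * (l * g)"
          unfolding f_def l_def g_def by (intro mult_left_mono left_inverse_norm L G inv w) auto
        \<comment> \<open>The inequality of arithmetic and geometric means, with weight
          \<open>s\<close>, for the factors \<open>f * l\<close> and \<open>g\<close>.\<close>
        also have "\<dots> \<le> (s / 2) * (f\<^sup>2 * l\<^sup>2) + (1 / (2 * s)) * g\<^sup>2"
        proof -
          have "0 \<le> (s * (f * l) - g)\<^sup>2 / (2 * s)" using s by simp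
          also have "\<dots> = (s / 2) * (f\<^sup>2 * l\<^sup>2) + (1 / (2 * s)) * g\<^sup>2 - f * (l * g)"
            using s by (simp add: power2_eq_square field_simps)
          finally show ?thesis by simp
        qed
        finally show "norm (tfun F (?w \<theta>)) \<le> (s / 2) * ?A \<theta> + (1 / (2 * s)) * ?B \<theta>"
          by (simp add: f_def l_def g_def)
      qed
      also have "\<dots> = (s / 2) * integral\<^sup>L circ ?A + (1 / (2 * s)) * integral\<^sup>L circ ?B"
        using iA iB by (simp only: Bochner_Integration.integral_add integrable_mult_right integral_mult_right_zero)
      also have "\<dots> \<le> (s / 2) * (2 * pi * X) + (1 / (2 * s)) * (2 * pi * Y)"
      proof (intro add_mono mult_left_mono)
        show "integral\<^sup>L circ ?A \<le> 2 * pi * X"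
          unfolding X_def by (rule abel_le[OF _ sFL r parseval_series_FL[OF stF L r]]) simp
        show "integral\<^sup>L circ ?B \<le> 2 * pi * Y"
          unfolding Y_def by (rule abel_le[OF _ sG r parseval_tfun[OF G r]]) simp
      qed (use s in auto)
      also have "\<dots> = pi * (s * X + Y / s)" using s by (simp add: field_simps)
      finally show ?thesis .
    qed
    obtain x where x: "\<And>n. 0 \<le> x n" "\<And>n. x n < 1" "filterlim x (at_left (1::real)) sequentially"
      using seq_at_left_1 by blast
    have "2 * I \<le> s * X + Y / s" if s: "0 < s" for s
    proof -
      have "(LINT \<theta>|circ. norm (freq F \<theta>)) \<le> pi * (s * X + Y / s)"
      proof (rule fatou_integral_bound(2))
        show "integrable circ (\<lambda>\<theta>. norm (tfun F (of_real (x n) * cis (- \<theta>))))" for n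
          by (intro integrable_circ_continuous continuous_intros continuous_tfun_circle stF x)
        show "(LINT \<theta>|circ. norm (tfun F (of_real (x n) * cis (- \<theta>)))) \<le> pi * (s * X + Y / s)" for n
          by (intro bound s x)
        show "AE \<theta> in circ. (\<lambda>n. norm (tfun F (of_real (x n) * cis (- \<theta>)))) \<longlonglongrightarrow> norm (freq F \<theta>)"
          using freq_AE[OF F] by eventually_elim (intro tendsto_norm, erule filterlim_compose[OF _ x(3)])
      qed (use freqm in auto)
      then show ?thesis by (simp add: I_def field_simps)
    qed
    then have "I\<^sup>2 \<le> X * Y"
      by (rule le_sqrt_mult_if_weighted_AM[OF I0 X0 Y0])
    then have "ennreal (I\<^sup>2) \<le> ennreal (Y * X)"
      by (simp add: ennreal_leI mult.commute)
    also have "\<dots> = h2sq G * h2sq (series_FL F L)"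
      using Y0 X0 unfolding h2sq_eq[OF sG] h2sq_eq[OF sFL] X_def[symmetric] Y_def[symmetric]
      by (rule ennreal_mult)
    finally show ?thesis unfolding I_def .
  qed
qed

subsection \<open>Outer functions\<close>

text \<open>Division by the kernel mass makes this an average, as Jensen's inequality
  requires.\<close>

definition pint :: "(real \<Rightarrow> real) \<Rightarrow> real \<Rightarrow> real \<Rightarrow> real" where
  "pint \<phi> r \<theta> = (LINT t|circ. poisson r (\<theta> - t) * \<phi> t) / (2 * pi)"

lemma integrable_poisson_real:
  assumes r: "0 \<le> r" "r < 1" and f: "integrable circ f"
  shows "integrable circ (\<lambda>t. poisson r (\<theta> - t) * f t :: real)"
  using poisson_bound[OF r] poisson_nonneg[OF r]
  by (intro integrable_mult_bounded_real[OF f, where B="2 / (1 - r)\<^sup>2"] continuous_measurable_circ continuous_intros r) auto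

lemma of_real_pint:
  "complex_of_real (pint \<phi> r \<theta>) = (LINT t|circ. of_real (poisson r (\<theta> - t)) * of_real (\<phi> t)) / complex_of_real (2 * pi)"
  by (simp add: pint_def flip: of_real_mult)

lemma pint_tendsto:
  assumes "integrable circ \<phi>"
  shows "AE \<theta> in circ. ((\<lambda>r. pint \<phi> r \<theta>) \<longlongrightarrow> \<phi> \<theta>) (at_left 1)"
proof -
  have "integrable circ (\<lambda>t. complex_of_real (\<phi> t))" using assms by simp
  from fatou_poisson[OF this] show ?thesis
  proof eventually_elim
    case (elim \<theta>)
    have "((\<lambda>r. (LINT t|circ. of_real (poisson r (\<theta> - t)) * of_real (\<phi> t)) / complex_of_real (2 * pi)) \<longlongrightarrow>
       2 * pi * of_real (\<phi> \<theta>) / complex_of_real (2 * pi)) (at_left 1)"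
      using elim by (intro tendsto_divide tendsto_const) auto
    from tendsto_Re[OF this] show ?case
      unfolding of_real_pint[symmetric] Re_complex_of_real by simp
  qed
qed

lemma pint_mono:
  assumes r: "0 \<le> r" "r < 1" and i: "integrable circ \<phi>" "integrable circ \<psi>" and le: "AE t in circ. \<phi> t \<le> \<psi> t"
  shows "pint \<phi> r \<theta> \<le> pint \<psi> r \<theta>"
  unfolding pint_def
proof (intro divide_right_mono integral_mono_AE integrable_poisson_real r i)
  show "AE t in circ. poisson r (\<theta> - t) * \<phi> t \<le> poisson r (\<theta> - t) * \<psi> t"
    using le by eventually_elim (intro mult_left_mono poisson_nonneg r)
qed simp

lemma pint_const:
  assumes "0 \<le> r" "r < 1"
  shows "pint (\<lambda>_. c) r \<theta> = c"
  using integral_poisson[OF assms, of \<theta>] by (simp add: pint_def)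

text \<open>Jensen's inequality by averaging the tangent of \<open>exp\<close> at
  \<open>u = pint \<phi> r \<theta>\<close> against the kernel. \<open>N\<close> is kept apart from
  the exponential of \<open>\<phi>\<close> because for \<open>\<phi> = ln N\<close> the convention
  \<open>ln 0 = 0\<close> breaks the identity at zeros of \<open>N\<close>.\<close>

lemma exp_pint_le:
  assumes r: "0 \<le> r" "r < 1" and i: "integrable circ \<phi>" "integrable circ N"
    and N: "AE t in circ. N t = exp (\<phi> t)"
  shows "exp (pint \<phi> r \<theta>) \<le> pint N r \<theta>"
proof -
  define u where "u = pint \<phi> r \<theta>"
  have ic: "integrable circ (\<lambda>t. exp u * (1 - u))"
    by (intro integrable_circ_continuous continuous_intros)
  have j: "integrable circ (\<lambda>t. exp u * \<phi> t + exp u * (1 - u))"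
    using i ic by (intro Bochner_Integration.integrable_add) auto
  have "AE t in circ. exp u * \<phi> t + exp u * (1 - u) \<le> N t"
    using N
  proof eventually_elim
    case (elim t)
    have "exp u * (1 + (\<phi> t - u)) \<le> exp u * exp (\<phi> t - u)"
      by (intro mult_left_mono exp_ge_add_one_self) auto
    also have "\<dots> = N t" using elim by (simp flip: exp_add)
    finally show ?case by (simp add: algebra_simps)
  qed
  then have "pint (\<lambda>t. exp u * \<phi> t + exp u * (1 - u)) r \<theta> \<le> pint N r \<theta>"
    using j i by (intro pint_mono r)
  also have "pint (\<lambda>t. exp u * \<phi> t + exp u * (1 - u)) r \<theta> = exp u * pint \<phi> r \<theta> + pint (\<lambda>_. exp u * (1 - u)) r \<theta>"
  proof -
    have "(LINT t|circ. poisson r (\<theta> - t) * (exp u * \<phi> t + exp u * (1 - u))) =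
       (LINT t|circ. exp u * (poisson r (\<theta> - t) * \<phi> t) + poisson r (\<theta> - t) * (exp u * (1 - u)))"
      by (simp add: algebra_simps)
    also have "\<dots> = exp u * (LINT t|circ. poisson r (\<theta> - t) * \<phi> t) + (LINT t|circ. poisson r (\<theta> - t) * (exp u * (1 - u)))"
      using integrable_poisson_real[OF r i(1), of \<theta>] integrable_poisson_real[OF r ic, of \<theta>]
      by (subst Bochner_Integration.integral_add) auto
    finally show ?thesis by (simp add: pint_def add_divide_distrib)
  qed
  also have "\<dots> = exp u"
    by (simp add: pint_const[OF r] u_def[symmetric] algebra_simps)
  finally show ?thesis by (simp add: u_def)
qed

section \<open>Even boundary data and the Herglotz transform\<close>

lemma integral_circ_reflect:
  fixes f :: "real \<Rightarrow> 'a::{banach, second_countable_topology}"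
  shows "(LINT t|circ. f (- t)) = (LINT t|circ. f t)"
proof -
  have "(LINT t|circ. f t) = (LINT t|lborel. indicator {-pi..pi} (- t) *\<^sub>R f (- t))"
    unfolding integral_circ set_lebesgue_integral_def
    using lborel_integral_real_affine[of "-1" "\<lambda>t. indicator {-pi..pi} t *\<^sub>R f t" 0] by simp
  also have "\<dots> = (LINT t|circ. f (- t))"
    unfolding integral_circ set_lebesgue_integral_def
    by (intro Bochner_Integration.integral_cong) (auto simp: indicator_def)
  finally show ?thesis by simp
qed

text \<open>For even \<open>\<phi>\<close> the sine part vanishes and these are the full Fourier
  coefficients. The cosine makes them real by construction, which leads to systems with real
  coefficients.\<close>

definition fcoeff :: "(real \<Rightarrow> real) \<Rightarrow> nat \<Rightarrow> real" where
  "fcoeff \<phi> k = (LINT t|circ. cos (real k * t) * \<phi> t) / (2 * pi)"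

text \<open>The reflection of \<open>t\<close> turns the integral into its conjugate, so its
  imaginary part is zero.\<close>

lemma
  assumes i: "integrable circ \<phi>" and even: "\<And>t. \<phi> (- t) = \<phi> t"
  shows fcoeff_cis: "(LINT t|circ. cis (real k * t) * of_real (\<phi> t)) = 2 * pi * fcoeff \<phi> k"
    and fcoeff_cis_minus: "(LINT t|circ. cis (- real k * t) * of_real (\<phi> t)) = 2 * pi * fcoeff \<phi> k"
proof -
  let ?f = "\<lambda>t. cis (real k * t) * of_real (\<phi> t)"
  have "integrable circ (\<lambda>t. complex_of_real (\<phi> t))" using i by simp
  then have ii: "integrable circ ?f"
    by (rule integrable_mult_bounded[where B=1]) (auto intro!: continuous_measurable_circ continuous_intros)
  have refl: "(LINT t|circ. cis (- real k * t) * of_real (\<phi> t)) = (LINT t|circ. ?f t)"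
    using integral_circ_reflect[of ?f] even by simp
  have "Re (LINT t|circ. ?f t) = 2 * pi * fcoeff \<phi> k"
    unfolding integral_Re[OF ii, symmetric] by (simp add: fcoeff_def)
  moreover have "cnj (LINT t|circ. ?f t) = (LINT t|circ. ?f t)"
  proof -
    have "cnj (LINT t|circ. ?f t) = (LINT t|circ. cnj (?f t))"
      by (simp only: Bochner_Integration.integral_cnj)
    also have "\<dots> = (LINT t|circ. ?f t)"
      unfolding refl[symmetric] by (simp add: cis_cnj)
    finally show ?thesis .
  qed
  then have "Im (LINT t|circ. ?f t) = 0" by (simp add: complex_eq_iff)
  ultimately show 1: "(LINT t|circ. ?f t) = 2 * pi * fcoeff \<phi> k"
    by (simp add: complex_eq_iff)
  show "(LINT t|circ. cis (- real k * t) * of_real (\<phi> t)) = 2 * pi * fcoeff \<phi> k"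
    using refl 1 by simp
qed

lemma fcoeff_bound:
  assumes "integrable circ \<phi>"
  shows "\<bar>fcoeff \<phi> k\<bar> \<le> (LINT t|circ. \<bar>\<phi> t\<bar>) / (2 * pi)"
proof -
  have "\<bar>LINT t|circ. cos (real k * t) * \<phi> t\<bar> \<le> (LINT t|circ. \<bar>cos (real k * t) * \<phi> t\<bar>)"
    using integral_norm_bound[of circ "\<lambda>t. cos (real k * t) * \<phi> t"] by simp
  also have "\<dots> \<le> (LINT t|circ. \<bar>\<phi> t\<bar>)"
  proof (rule integral_mono)
    show "integrable circ (\<lambda>t. \<bar>cos (real k * t) * \<phi> t\<bar>)"
      using assms by (intro integrable_abs integrable_mult_bounded_real[where B=1] continuous_measurable_circ continuous_intros) auto
    show "\<bar>cos (real k * t) * \<phi> t\<bar> \<le> \<bar>\<phi> t\<bar>" for t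
      using mult_right_mono[OF abs_cos_le_one[of "real k * t"], of "\<bar>\<phi> t\<bar>"] by (simp add: abs_mult)
  qed (use assms in auto)
  finally show ?thesis by (simp add: fcoeff_def divide_right_mono)
qed

text \<open>For even \<open>\<phi>\<close> this is the power series of the average of
  \<open>(1 + w * cis t) / (1 - w * cis t)\<close> against \<open>\<phi>\<close>, a kernel with the
  Poisson kernel as real part. Doubling the whole series and subtracting its constant term avoids a
  shifted sum.\<close>

definition herglotz :: "(real \<Rightarrow> real) \<Rightarrow> complex \<Rightarrow> complex" where
  "herglotz \<phi> w = 2 * (\<Sum>k. of_real (fcoeff \<phi> k) * w ^ k) - of_real (fcoeff \<phi> 0)"

lemma summable_fcoeff:
  assumes "integrable circ \<phi>" "norm w < 1"
  shows "summable (\<lambda>k. norm (complex_of_real (fcoeff \<phi> k) * w ^ k))"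
proof (rule summable_comparison_test')
  show "summable (\<lambda>k. (LINT t|circ. \<bar>\<phi> t\<bar>) / (2 * pi) * norm w ^ k)"
    using assms by (intro summable_mult summable_geometric) auto
  show "norm (norm (complex_of_real (fcoeff \<phi> k) * w ^ k)) \<le> (LINT t|circ. \<bar>\<phi> t\<bar>) / (2 * pi) * norm w ^ k" for k
    using mult_right_mono[OF fcoeff_bound[OF assms(1), of k], of "norm w ^ k"] by (simp add: norm_mult norm_power)
qed

lemma holomorphic_herglotz:
  assumes "integrable circ \<phi>"
  shows "herglotz \<phi> holomorphic_on ball 0 1"
proof -
  have "(\<lambda>w. \<Sum>k. complex_of_real (fcoeff \<phi> k) * w ^ k) holomorphic_on ball 0 1"
    using summable_fcoeff[OF assms]
    by (intro power_series_holomorphic[where a="\<lambda>k. complex_of_real (fcoeff \<phi> k)"])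
       (auto intro!: summable_sums intro: summable_norm_cancel)
  then show ?thesis
    unfolding herglotz_def[abs_def] by (intro holomorphic_intros)
qed

lemma herglotz_cnj:
  assumes "integrable circ \<phi>" "norm w < 1"
  shows "herglotz \<phi> (cnj w) = cnj (herglotz \<phi> w)"
proof -
  have "(\<lambda>k. complex_of_real (fcoeff \<phi> k) * w ^ k) sums (\<Sum>k. complex_of_real (fcoeff \<phi> k) * w ^ k)"
    by (rule summable_sums[OF summable_norm_cancel[OF summable_fcoeff[OF assms]]])
  then have "(\<lambda>k. cnj (complex_of_real (fcoeff \<phi> k) * w ^ k)) sums cnj (\<Sum>k. complex_of_real (fcoeff \<phi> k) * w ^ k)"
    by (simp only: sums_cnj)
  then have "(\<Sum>k. complex_of_real (fcoeff \<phi> k) * cnj w ^ k) = cnj (\<Sum>k. complex_of_real (fcoeff \<phi> k) * w ^ k)"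
    by (simp add: sums_iff)
  then show ?thesis by (simp add: herglotz_def)
qed

text \<open>By evenness the coefficients of both signs coincide and are real, so the two halves of
  the Poisson expansion are conjugate up to the constant term.\<close>

lemma Re_herglotz:
  assumes i: "integrable circ \<phi>" and even: "\<And>t. \<phi> (- t) = \<phi> t" and r: "0 \<le> r" "r < 1"
  shows "Re (herglotz \<phi> (of_real r * cis (- \<theta>))) = pint \<phi> r \<theta>"
proof -
  let ?w = "of_real r * cis (- \<theta>)"
  define S where "S = (\<Sum>k. complex_of_real (fcoeff \<phi> k) * ?w ^ k)"
  have w: "norm ?w < 1" using r by (simp add: norm_mult)
  have sm: "summable (\<lambda>k. complex_of_real (fcoeff \<phi> k) * ?w ^ k)"
    by (rule summable_norm_cancel[OF summable_fcoeff[OF i w]])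
  have ii: "integrable circ (\<lambda>t. complex_of_real (\<phi> t))" using i by simp
  have s2: "(\<Sum>k. complex_of_real (fcoeff \<phi> (Suc k)) * ?w ^ Suc k) = S - fcoeff \<phi> 0"
    unfolding S_def using suminf_split_head[OF sm] by simp
  have "(LINT t|circ. of_real (poisson r (\<theta> - t)) * complex_of_real (\<phi> t)) =
     (\<Sum>k. 2 * pi * (complex_of_real (fcoeff \<phi> k) * ?w ^ k)) +
     (\<Sum>k. cnj (2 * pi * (complex_of_real (fcoeff \<phi> (Suc k)) * ?w ^ Suc k)))"
    unfolding poisson_integral_series[OF r ii] fcoeff_cis[OF i even] fcoeff_cis_minus[OF i even]
      of_real_cis_power
    by (intro arg_cong2[where f="(+)"] suminf_cong) (simp_all add: cis_cnj mult_ac del: of_nat_Suc power_Suc)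
  also have "(\<Sum>k. 2 * pi * (complex_of_real (fcoeff \<phi> k) * ?w ^ k)) = 2 * pi * S"
    unfolding S_def by (rule suminf_mult[OF sm])
  also have "(\<Sum>k. cnj (2 * pi * (complex_of_real (fcoeff \<phi> (Suc k)) * ?w ^ Suc k))) = cnj (2 * pi * (S - fcoeff \<phi> 0))"
  proof -
    have "summable (\<lambda>k. complex_of_real (fcoeff \<phi> (Suc k)) * ?w ^ Suc k)"
      using sm by (subst summable_Suc_iff)
    from summable_sums[OF this] have "(\<lambda>k. complex_of_real (fcoeff \<phi> (Suc k)) * ?w ^ Suc k) sums (S - fcoeff \<phi> 0)"
      unfolding s2 .
    from sums_mult[OF this, of "2 * pi"]
    have "(\<lambda>k. cnj (2 * pi * (complex_of_real (fcoeff \<phi> (Suc k)) * ?w ^ Suc k))) sums cnj (2 * pi * (S - fcoeff \<phi> 0))"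
      by (simp only: sums_cnj)
    then show ?thesis by (rule sums_unique[symmetric])
  qed
  finally have "complex_of_real (pint \<phi> r \<theta>) = (2 * pi * S + cnj (2 * pi * (S - fcoeff \<phi> 0))) / (2 * pi)"
    unfolding of_real_pint by simp
  also have "\<dots> = S + cnj S - fcoeff \<phi> 0"
    by (simp add: field_simps)
  finally have "pint \<phi> r \<theta> = Re (S + cnj S - fcoeff \<phi> 0)"
    by (metis Re_complex_of_real)
  then show ?thesis by (simp add: herglotz_def S_def)
qed

text \<open>Both facts are read off \<open>2 * Re S - fcoeff \<phi> 0\<close> with an absolutely
  convergent series \<open>S\<close>: it is continuous, and its mean is a zeroth coefficient. No
  exchange of two integrals is involved.\<close>

lemma
  assumes i: "integrable circ \<phi>" and even: "\<And>t. \<phi> (- t) = \<phi> t" and r: "0 \<le> r" "r < 1"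
  shows continuous_pint: "continuous_on A (pint \<phi> r)"
    and integral_pint: "(LINT \<theta>|circ. pint \<phi> r \<theta>) = (LINT \<theta>|circ. \<phi> \<theta>)"
proof -
  define c where "c k = complex_of_real (fcoeff \<phi> k) * of_real r ^ k" for k
  have c: "summable (\<lambda>k. norm (c k))"
    using summable_fcoeff[OF i, of "of_real r"] r by (simp add: c_def)
  define S where "S \<theta> = (\<Sum>k. c k * cis (- real k * \<theta>))" for \<theta>
  have Seq: "S \<theta> = (\<Sum>k. complex_of_real (fcoeff \<phi> k) * (of_real r * cis (- \<theta>)) ^ k)" for \<theta>
    by (simp only: S_def c_def of_real_cis_power mult.assoc)
  have eq: "pint \<phi> r \<theta> = 2 * Re (S \<theta>) - fcoeff \<phi> 0" for \<theta>
    unfolding Re_herglotz[OF i even r, symmetric] herglotz_def Seq by simp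
  have cS: "continuous_on A S" for A
    unfolding S_def[abs_def] by (rule parseval_circ(3)[OF c])
  then show "continuous_on A (pint \<phi> r)"
    unfolding eq by (intro continuous_intros) auto
  have iS: "integrable circ S" by (intro integrable_circ_continuous cS)
  have "(LINT \<theta>|circ. S \<theta>) = 2 * pi * fcoeff \<phi> 0"
    using integral_circ_cis_series[OF c, of 0] by (simp add: S_def c_def)
  then have "(LINT \<theta>|circ. Re (S \<theta>)) = 2 * pi * fcoeff \<phi> 0"
    by (simp add: integral_Re[OF iS])
  then have "(LINT \<theta>|circ. pint \<phi> r \<theta>) = 2 * pi * fcoeff \<phi> 0"
    unfolding eq using integrable_Re[OF iS] integrable_circ_continuous[OF continuous_on_const, of "fcoeff \<phi> 0"]
    by (simp add: measure_circ)
  then show "(LINT \<theta>|circ. pint \<phi> r \<theta>) = (LINT \<theta>|circ. \<phi> \<theta>)"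
    by (simp add: fcoeff_def)
qed

section \<open>Real power series and the outer system\<close>

text \<open>The coefficients are Fourier integrals of \<open>f\<close> over the circle of radius
  1/2; convergence at 3/4 supplies the absolute convergence there.\<close>

lemma power_series_coeff_unique:
  fixes a b :: "nat \<Rightarrow> complex"
  assumes a: "\<And>w. norm w < 1 \<Longrightarrow> (\<lambda>k. a k * w ^ k) sums f w"
    and b: "\<And>w. norm w < 1 \<Longrightarrow> (\<lambda>k. b k * w ^ k) sums f w"
  shows "a = b"
proof
  fix m
  have S: "2 * pi * (v m * (1/2) ^ m) = (LINT t|circ. f (of_real (1/2) * cis (- t)) * cis (real m * t))"
    if v: "\<And>w. norm w < 1 \<Longrightarrow> (\<lambda>k. v k * w ^ k) sums f w" for v :: "nat \<Rightarrow> complex"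
  proof -
    have "summable (\<lambda>k. v k * (3/4) ^ k)" using v[of "3/4"] by (auto simp: sums_iff)
    then have c: "summable (\<lambda>k. norm (v k * (1/2) ^ k))"
      by (rule powser_insidea) simp
    have "(\<Sum>k. (v k * (1/2) ^ k) * cis (- real k * t)) = f (of_real (1/2) * cis (- t))" for t
      using v[of "of_real (1/2) * cis (- t)"] unfolding of_real_cis_power
      by (simp add: norm_mult sums_iff mult.assoc)
    then show ?thesis
      using integral_circ_cis_series[OF c, of m] by simp
  qed
  have "2 * pi * (a m * (1/2) ^ m) = 2 * pi * (b m * (1/2) ^ m)"
    by (rule trans[OF S[OF a] S[OF b, symmetric]])
  then show "a m = b m" by simp
qed

text \<open>Under conjugation symmetry the conjugate coefficients represent the same function, so by
  uniqueness the coefficients are real.\<close>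

lemma real_power_series:
  assumes E: "E holomorphic_on ball 0 1" and cnj: "\<And>w. norm w < 1 \<Longrightarrow> E (cnj w) = cnj (E w)"
  shows "\<exists>e :: nat \<Rightarrow> real. \<forall>w. norm w < 1 \<longrightarrow> (\<lambda>k. complex_of_real (e k) * w ^ k) sums E w"
proof -
  define a where "a k = (deriv ^^ k) E 0 / fact k" for k
  have a: "(\<lambda>k. a k * w ^ k) sums E w" if "norm w < 1" for w
    using holomorphic_power_series[OF E, of w] that by (simp add: a_def)
  have b: "(\<lambda>k. cnj (a k) * w ^ k) sums E w" if w: "norm w < 1" for w
  proof -
    have "(\<lambda>k. cnj (a k * cnj w ^ k)) sums cnj (E (cnj w))"
      using a[of "cnj w"] w by (simp only: sums_cnj complex_mod_cnj)
    then show ?thesis using cnj[OF w] by simp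
  qed
  have "a = (\<lambda>k. cnj (a k))" using a b by (rule power_series_coeff_unique)
  then have "complex_of_real (Re (a k)) = a k" for k
    by (metis complex_cnj_cancel_iff Reals_cnj_iff of_real_Re)
  then show ?thesis using a by (intro exI[of _ "\<lambda>k. Re (a k)"]) simp
qed

lemma stable_scalar_sys:
  assumes "\<And>w. norm w < 1 \<Longrightarrow> (\<lambda>k. complex_of_real (e k) * w ^ k) sums E w"
  shows "stable_sys (\<lambda>k. (\<chi> i. e k) :: real ^ 1)"
  unfolding stable_sys_def
proof safe
  fix r :: real assume r: "0 \<le> r" "r < 1"
  \<comment> \<open>A point strictly between \<open>r\<close> and 1: convergence there gives
    absolute convergence at \<open>r\<close>.\<close>
  let ?x = "complex_of_real ((1 + r) / 2)"
  have n: "norm ?x = (1 + r) / 2" using r by (simp only: norm_of_real) simp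
  have "summable (\<lambda>k. complex_of_real (e k) * ?x ^ k)"
    using assms[of ?x] r n by (auto simp: sums_iff)
  then have "summable (\<lambda>k. norm (complex_of_real (e k) * of_real r ^ k))"
    by (rule powser_insidea) (use r n in simp)
  then show "summable (\<lambda>k. norm ((\<chi> i. e k) :: real ^ 1) * r ^ k)"
    using r by (simp add: norm_mult norm_power norm_vec_def L2_set_def)
qed

lemma norm_complex_1: "norm (x :: complex ^ 1) = norm (x $ 1)"
  by (simp add: norm_vec_def L2_set_def)

text \<open>With \<open>G = exp (H / 2)\<close> and \<open>L = exp (- H / 2)\<close> the factor 1/2
  makes \<open>|G|^2 = exp (Re H)\<close>, and the exponents cancel in the product. Minimum phase is
  expressed by the stability of the inverse \<open>L\<close>; an exponential has no zeros.\<close>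

lemma outer_system:
  assumes i: "integrable circ \<phi>" and even: "\<And>t. \<phi> (- t) = \<phi> t"
  obtains G L :: "nat \<Rightarrow> real ^ 1" where "stable_sys G" "stable_sys L" "left_inverse L G"
    "\<And>r \<theta>. 0 \<le> r \<Longrightarrow> r < 1 \<Longrightarrow> (norm (tfun G (of_real r * cis (- \<theta>))))\<^sup>2 = exp (pint \<phi> r \<theta>)"
    "\<And>r \<theta>. 0 \<le> r \<Longrightarrow> r < 1 \<Longrightarrow> (norm (tfun L (of_real r * cis (- \<theta>))))\<^sup>2 = exp (- pint \<phi> r \<theta>)"
proof -
  have ex: "\<exists>e. \<forall>w. norm w < 1 \<longrightarrow> (\<lambda>k. complex_of_real (e k) * w ^ k) sums exp (of_real a * herglotz \<phi> w)" for a
  proof -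
    have 1: "(\<lambda>w. exp (of_real a * herglotz \<phi> w)) holomorphic_on ball 0 1"
      by (intro holomorphic_intros holomorphic_herglotz i)
    have 2: "exp (of_real a * herglotz \<phi> (cnj w)) = cnj (exp (of_real a * herglotz \<phi> w))" if "norm w < 1" for w
      using herglotz_cnj[OF i that] by (simp add: exp_cnj)
    show ?thesis by (rule real_power_series[OF 1 2])
  qed
  obtain g where g: "\<And>w. norm w < 1 \<Longrightarrow> (\<lambda>k. complex_of_real (g k) * w ^ k) sums exp (of_real (1/2) * herglotz \<phi> w)"
    using ex[of "1/2"] by blast
  obtain l where l: "\<And>w. norm w < 1 \<Longrightarrow> (\<lambda>k. complex_of_real (l k) * w ^ k) sums exp (of_real (-1/2) * herglotz \<phi> w)"
    using ex[of "-1/2"] by blast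
  define G L :: "nat \<Rightarrow> real ^ 1" where "G k = (\<chi> i. g k)" and "L k = (\<chi> i. l k)" for k
  have sG: "stable_sys G" and sL: "stable_sys L"
    unfolding G_def[abs_def] L_def[abs_def] by (rule stable_scalar_sys[OF g], assumption) (rule stable_scalar_sys[OF l], assumption)
  have tG: "tfun G w $ 1 = exp (of_real (1/2) * herglotz \<phi> w)" and tL: "tfun L w $ 1 = exp (of_real (-1/2) * herglotz \<phi> w)"
    if "norm w < 1" for w
    using sums_unique[OF g[OF that]] sums_unique[OF l[OF that]] by (simp_all only: tfun_nth G_def L_def vec_lambda_beta)
  have "left_inverse L G"
  proof -
    have "(\<lambda>k. complex_of_real (series_LG L G k)) = (\<lambda>k. if k = 0 then 1 else 0)"
    proof (rule power_series_coeff_unique[where f="\<lambda>_. 1"])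
      fix w :: complex assume w: "norm w < 1"
      have "(\<lambda>k. \<Sum>m\<le>k. (complex_of_real (L m $ 1) * w ^ m) * (complex_of_real (G (k - m) $ 1) * w ^ (k - m))) sums
          (tfun L w $ 1 * tfun G w $ 1)"
        unfolding tfun_nth by (intro Cauchy_product_sums stable_summable sG sL w)
      moreover have "(\<Sum>m\<le>k. (complex_of_real (L m $ 1) * w ^ m) * (complex_of_real (G (k - m) $ 1) * w ^ (k - m))) =
          complex_of_real (series_LG L G k) * w ^ k" for k
        unfolding series_LG_def inner_vec_def of_real_sum sum_distrib_right
        by (intro sum.cong refl) (auto simp: mult_ac simp flip: power_add)
      moreover have "tfun L w $ 1 * tfun G w $ 1 = 1"
        using w by (simp add: tG tL flip: exp_add)
      ultimately show "(\<lambda>k. complex_of_real (series_LG L G k) * w ^ k) sums 1" by simp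
      have "(\<lambda>k. (if k = 0 then 1 else 0) * w ^ k) = (\<lambda>k. if k = 0 then w ^ k else 0)" by auto
      then show "(\<lambda>k. (if k = 0 then 1 else 0) * w ^ k) sums 1"
        using sums_single[of 0 "\<lambda>k. w ^ k"] by simp
    qed
    then have "complex_of_real (series_LG L G k) = complex_of_real (if k = 0 then 1 else 0)" for k
      by (auto dest: fun_cong[of _ _ k])
    then show ?thesis unfolding left_inverse_def of_real_eq_iff by blast
  qed
  moreover have "(norm (tfun G (of_real r * cis (- \<theta>))))\<^sup>2 = exp (pint \<phi> r \<theta>)"
      "(norm (tfun L (of_real r * cis (- \<theta>))))\<^sup>2 = exp (- pint \<phi> r \<theta>)" if r: "0 \<le> r" "r < 1" for r \<theta>
  proof -
    have w: "norm (of_real r * cis (- \<theta>)) < 1" using r by (simp add: norm_mult)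
    show "(norm (tfun G (of_real r * cis (- \<theta>))))\<^sup>2 = exp (pint \<phi> r \<theta>)"
      "(norm (tfun L (of_real r * cis (- \<theta>))))\<^sup>2 = exp (- pint \<phi> r \<theta>)"
      unfolding norm_complex_1 tG[OF w] tL[OF w] norm_exp_eq_Re Re_herglotz[OF i even r, symmetric]
      by (simp_all add: power2_eq_square flip: exp_add)
  qed
  ultimately show ?thesis using that sG sL by blast
qed

subsection \<open>Attaining the bound\<close>

text \<open>Real coefficients make the transfer function commute with conjugation. The identity
  covers every angle, since \<open>outer_system\<close> asks for evenness everywhere: if no limit
  exists at \<open>\<theta>\<close>, none exists at \<open>- \<theta>\<close>, and both values are
  the same default of \<open>Lim\<close>.\<close>

lemma norm_freq_minus:
  fixes F :: "nat \<Rightarrow> real ^ 'n"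
  assumes F: "stable_sys F"
  shows "norm (freq F (- \<theta>)) = norm (freq F \<theta>)"
proof -
  define J :: "complex ^ 'n \<Rightarrow> complex ^ 'n" where "J x = (\<chi> i. cnj (x $ i))" for x
  have tJ: "tfun F (cnj w) = J (tfun F w)" if w: "norm w < 1" for w
  proof -
    have "(\<lambda>k. cnj (complex_of_real (F k $ i) * w ^ k)) sums cnj (tfun F w $ i)" for i
      unfolding sums_cnj tfun_nth by (rule summable_sums[OF summable_norm_cancel[OF stable_summable[OF F w]]])
    then show ?thesis by (simp add: vec_eq_iff J_def tfun_nth sums_iff)
  qed
  have ev: "\<forall>\<^sub>F r in at_left 1. J (tfun F (of_real r * cis (- \<theta>))) = tfun F (of_real r * cis (- (- \<theta>)))" for \<theta>
  proof (rule eventually_mono[OF eventually_at_left_real[of 0 1]])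
    fix r :: real assume r: "r \<in> {0<..<1}"
    then have "norm (of_real r * cis (- \<theta>)) < 1" by (simp add: norm_mult)
    from tJ[OF this] show "J (tfun F (of_real r * cis (- \<theta>))) = tfun F (of_real r * cis (- (- \<theta>)))"
      by (simp add: cis_cnj)
  qed simp
  have lim: "((\<lambda>r. tfun F (of_real r * cis (- (- \<theta>)))) \<longlongrightarrow> J l) (at_left 1)"
    if l: "((\<lambda>r. tfun F (of_real r * cis (- \<theta>))) \<longlongrightarrow> l) (at_left 1)" for \<theta> l
  proof (rule Lim_transform_eventually[OF _ ev])
    show "((\<lambda>r. J (tfun F (of_real r * cis (- \<theta>)))) \<longlongrightarrow> J l) (at_left 1)"
      unfolding J_def using l by (intro tendsto_vec_lambda tendsto_cnj tendsto_vec_nth)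
  qed
  show ?thesis
  proof (cases "\<exists>l. ((\<lambda>r. tfun F (of_real r * cis (- \<theta>))) \<longlongrightarrow> l) (at_left 1)")
    case True
    then obtain l where l: "((\<lambda>r. tfun F (of_real r * cis (- \<theta>))) \<longlongrightarrow> l) (at_left 1)" by blast
    have "freq F \<theta> = l" "freq F (- \<theta>) = J l"
      unfolding freq_def by (intro tendsto_Lim l lim trivial_limit_at_left_real)+
    moreover have "norm (J l) = norm l"
      by (simp add: norm_vec_def J_def)
    ultimately show ?thesis by simp
  next
    case False
    have False': "\<not> ((\<lambda>r. tfun F (of_real r * cis (- (- \<theta>)))) \<longlongrightarrow> l) (at_left 1)" for l
      using lim[of "- \<theta>" l] False by auto
    have "(\<lambda>l. ((\<lambda>r. tfun F (of_real r * cis (- \<theta>))) \<longlongrightarrow> l) (at_left 1)) =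
      (\<lambda>l. ((\<lambda>r. tfun F (of_real r * cis (- (- \<theta>)))) \<longlongrightarrow> l) (at_left 1))"
      using False False' by blast
    then show ?thesis unfolding freq_def t2_space_class.Lim_def by simp
  qed
qed

text \<open>Letting \<open>r\<close> tend to 1 in finitely many terms bounds each partial sum. This
  is the converse of \<open>abel_le\<close>: summability is a conclusion here.\<close>

lemma abel_bound:
  fixes v :: "nat \<Rightarrow> real"
  assumes v: "\<And>k. 0 \<le> v k"
    and s: "\<And>r. 0 \<le> r \<Longrightarrow> r < 1 \<Longrightarrow> (\<lambda>k. 2 * pi * (v k * r ^ (2 * k))) sums S r"
    and B: "\<And>r. 0 \<le> r \<Longrightarrow> r < 1 \<Longrightarrow> S r \<le> 2 * pi * B"
  shows "summable v" "suminf v \<le> B"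
proof -
  have *: "(\<Sum>k<n. v k) \<le> B" for n
  proof -
    have "((\<lambda>r. \<Sum>k<n. 2 * pi * (v k * r ^ (2 * k))) \<longlongrightarrow> (\<Sum>k<n. 2 * pi * (v k * 1 ^ (2 * k)))) (at_left 1)"
      by (intro tendsto_intros)
    then have "(\<Sum>k<n. 2 * pi * (v k * 1 ^ (2 * k))) \<le> 2 * pi * B"
    proof (rule tendsto_upperbound)
      show "\<forall>\<^sub>F r in at_left 1. (\<Sum>k<n. 2 * pi * (v k * r ^ (2 * k))) \<le> 2 * pi * B"
      proof (rule eventually_mono[OF eventually_at_left_real[of 0 1]])
        fix r :: real assume r: "r \<in> {0<..<1}"
        then have "(\<Sum>k<n. 2 * pi * (v k * r ^ (2 * k))) \<le> S r"
          using sum_le_suminf[OF sums_summable[OF s[of r]], of "{..<n}"] sums_unique[OF s[of r]] v by simp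
        also have "\<dots> \<le> 2 * pi * B" using B r by simp
        finally show "(\<Sum>k<n. 2 * pi * (v k * r ^ (2 * k))) \<le> 2 * pi * B" .
      qed simp
    qed (simp add: trivial_limit_at_left_real)
    then show ?thesis by (simp flip: sum_distrib_left)
  qed
  show sm: "summable v" using v * by (rule summableI_nonneg_bounded)
  show "suminf v \<le> B" using sm * by (rule suminf_le_const)
qed

text \<open>The shift bounds the logarithm below by \<open>ln \<epsilon>\<close>, and
  \<open>ln x \<le> x - 1\<close> bounds it above by an integrable function; the Paley-Wiener
  condition does not enter.\<close>

lemma integrable_ln_freq:
  fixes F :: "nat \<Rightarrow> real ^ 'p"
  assumes F: "summable (\<lambda>k. (norm (F k))\<^sup>2)" and \<epsilon>: "0 < \<epsilon>"
  shows "integrable circ (\<lambda>t. ln (norm (freq F t) + \<epsilon>))"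
proof (rule Bochner_Integration.integrable_bound)
  show "integrable circ (\<lambda>t. norm (freq F t) + (\<epsilon> + \<bar>ln \<epsilon>\<bar>))"
    by (intro Bochner_Integration.integrable_add integrable_norm_freq F integrable_circ_continuous continuous_on_const)
  show "(\<lambda>t. ln (norm (freq F t) + \<epsilon>)) \<in> borel_measurable circ"
    using borel_measurable_freq[OF F] by measurable
  have "\<bar>ln (norm (freq F t) + \<epsilon>)\<bar> \<le> norm (freq F t) + (\<epsilon> + \<bar>ln \<epsilon>\<bar>)" for t
  proof -
    have "ln \<epsilon> \<le> ln (norm (freq F t) + \<epsilon>)" using \<epsilon> by (simp add: add_nonneg_pos)
    moreover have "ln (norm (freq F t) + \<epsilon>) \<le> (norm (freq F t) + \<epsilon>) - 1"
      using \<epsilon> by (intro ln_le_minus_one add_nonneg_pos) auto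
    ultimately show ?thesis using norm_ge_zero[of "freq F t"] \<epsilon> by linarith
  qed
  then show "AE t in circ. norm (ln (norm (freq F t) + \<epsilon>)) \<le> norm (norm (freq F t) + (\<epsilon> + \<bar>ln \<epsilon>\<bar>))"
    using \<epsilon> by (intro AE_I2) simp
qed

text \<open>The regularised system depends on \<open>\<epsilon>\<close>, so the statement mentions
  only its Poisson integral on a fixed circle. This lets \<open>\<epsilon>\<close> tend to 0 without
  comparing different systems, and the right side is free of \<open>\<epsilon>\<close> and
  \<open>r\<close>.\<close>

lemma regularised_bound:
  fixes F :: "nat \<Rightarrow> real ^ 'p"
  assumes F: "summable (\<lambda>k. (norm (F k))\<^sup>2)" and \<epsilon>: "0 < \<epsilon>" and r: "0 \<le> r" "r < 1"
  shows "(LINT \<theta>|circ. (norm (tfun F (of_real r * cis (- \<theta>))))\<^sup>2 *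
      exp (- pint (\<lambda>t. ln (norm (freq F t) + \<epsilon>)) r \<theta>)) \<le> (LINT \<theta>|circ. norm (freq F \<theta>))"
proof -
  define N where "N t = norm (freq F t)" for t
  define \<phi> where "\<phi> t = ln (N t + \<epsilon>)" for t
  have N0: "0 \<le> N t" for t by (simp add: N_def)
  have st: "stable_sys F" by (rule l2_imp_stable[OF F])
  have \<phi>i: "integrable circ \<phi>"
    using integrable_ln_freq[OF F \<epsilon>] by (simp add: \<phi>_def[abs_def] N_def)
  have even: "\<phi> (- t) = \<phi> t" for t
    by (simp add: \<phi>_def N_def norm_freq_minus[OF st])
  have Nm: "N \<in> borel_measurable circ" using borel_measurable_freq[OF F] unfolding N_def[abs_def] by measurable
  have Ni: "integrable circ N" using integrable_norm_freq[OF F] by (simp add: N_def[abs_def])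
  obtain G L :: "nat \<Rightarrow> real ^ 1" where GL: "stable_sys G" "stable_sys L" "left_inverse L G"
    "\<And>r \<theta>. 0 \<le> r \<Longrightarrow> r < 1 \<Longrightarrow> (norm (tfun G (of_real r * cis (- \<theta>))))\<^sup>2 = exp (pint \<phi> r \<theta>)"
    "\<And>r \<theta>. 0 \<le> r \<Longrightarrow> r < 1 \<Longrightarrow> (norm (tfun L (of_real r * cis (- \<theta>))))\<^sup>2 = exp (- pint \<phi> r \<theta>)"
    using outer_system[OF \<phi>i even] by metis
  have p: "(\<lambda>k. 2 * pi * ((norm (series_FL F L k))\<^sup>2 * r ^ (2 * k))) sums
    (LINT \<theta>|circ. (norm (tfun F (of_real r * cis (- \<theta>))))\<^sup>2 * exp (- pint \<phi> r \<theta>))"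
    if r: "0 \<le> r" "r < 1" for r
    using parseval_series_FL[OF st GL(2) r] unfolding GL(5)[OF r] .
  \<comment> \<open>This bound blows up as \<open>\<epsilon>\<close> tends to 0. Its purpose is
    square summability of \<open>F L\<close>, without which boundary values would not control the
    coefficients.\<close>
  have le: "(LINT \<theta>|circ. (norm (tfun F (of_real r * cis (- \<theta>))))\<^sup>2 * exp (- pint \<phi> r \<theta>)) \<le>
      2 * pi * (inverse \<epsilon> * (\<Sum>k. (norm (F k))\<^sup>2))" if r: "0 \<le> r" "r < 1" for r
  proof -
    let ?A = "\<lambda>\<theta>. (norm (tfun F (of_real r * cis (- \<theta>))))\<^sup>2"
    have cF: "continuous_on A ?A" for A
      by (intro continuous_intros continuous_tfun_circle st r)
    have "(LINT \<theta>|circ. ?A \<theta> * exp (- pint \<phi> r \<theta>)) \<le> (LINT \<theta>|circ. inverse \<epsilon> * ?A \<theta>)"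
    proof (rule integral_mono)
      show "integrable circ (\<lambda>\<theta>. ?A \<theta> * exp (- pint \<phi> r \<theta>))"
        by (intro integrable_circ_continuous continuous_intros cF continuous_pint \<phi>i even r)
      show "integrable circ (\<lambda>\<theta>. inverse \<epsilon> * ?A \<theta>)"
        by (intro integrable_circ_continuous continuous_intros cF)
      fix \<theta>
      have "pint (\<lambda>_. ln \<epsilon>) r \<theta> \<le> pint \<phi> r \<theta>"
      proof (intro pint_mono r \<phi>i integrable_circ_continuous continuous_on_const AE_I2)
        show "ln \<epsilon> \<le> \<phi> t" for t using \<epsilon> N0[of t] by (simp add: \<phi>_def add_nonneg_pos)
      qed
      then have "exp (- pint \<phi> r \<theta>) \<le> exp (- ln \<epsilon>)" by (simp add: pint_const[OF r])
      also have "\<dots> = inverse \<epsilon>" using \<epsilon> by (simp add: exp_minus)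
      finally show "?A \<theta> * exp (- pint \<phi> r \<theta>) \<le> inverse \<epsilon> * ?A \<theta>"
        by (simp add: mult.commute mult_right_mono)
    qed
    also have "\<dots> = inverse \<epsilon> * (LINT \<theta>|circ. ?A \<theta>)" by simp
    also have "\<dots> \<le> inverse \<epsilon> * (2 * pi * (\<Sum>k. (norm (F k))\<^sup>2))"
      using \<epsilon> abel_le[OF _ F r parseval_tfun[OF st r]] by (intro mult_left_mono) auto
    finally show ?thesis by (simp add: mult_ac)
  qed
  have sFL: "summable (\<lambda>k. (norm (series_FL F L k))\<^sup>2)"
    using p le by (intro abel_bound(1)[where S="\<lambda>r. LINT \<theta>|circ. (norm (tfun F (of_real r * cis (- \<theta>))))\<^sup>2 * exp (- pint \<phi> r \<theta>)"]) auto
  have nsq: "(norm (series_FL F L k))\<^sup>2 = (\<Sum>i\<in>UNIV. (norm (complex_of_real (series_FL F L k $ i $ 1)))\<^sup>2)" for k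
    by (simp add: norm_vec_sq)
  have sb: "summable (\<lambda>k. (norm (complex_of_real (series_FL F L k $ i $ 1)))\<^sup>2)" for i
  proof (rule summable_comparison_test'[OF sFL])
    show "norm ((norm (complex_of_real (series_FL F L k $ i $ 1)))\<^sup>2) \<le> (norm (series_FL F L k))\<^sup>2" for k
      unfolding nsq by (simp only: real_norm_def abs_power2)
        (rule member_le_sum[of i UNIV "\<lambda>i. (norm (complex_of_real (series_FL F L k $ i $ 1)))\<^sup>2"], auto)
  qed
  \<comment> \<open>The squared modulus of the boundary value of the \<open>i\<close>-th component
    of \<open>F L\<close>, as \<open>|L|^2\<close> tends radially to
    \<open>1 / (N + \<epsilon>)\<close> almost everywhere.\<close>
  define h where "h i \<theta> = (norm (freq F \<theta> $ i))\<^sup>2 / (N \<theta> + \<epsilon>)" for i \<theta>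
  have hm: "h i \<in> borel_measurable circ" for i
  proof -
    have "(\<lambda>\<theta>. freq F \<theta> $ i) \<in> borel_measurable circ"
      using borel_measurable_freq[OF F]
      by (rule measurable_compose) (intro borel_measurable_continuous_onI continuous_intros)
    then show ?thesis unfolding h_def[abs_def] using Nm by measurable
  qed
  have hsum: "(\<Sum>i\<in>UNIV. h i \<theta>) \<le> N \<theta>" for \<theta>
  proof -
    have "(\<Sum>i\<in>UNIV. h i \<theta>) = (N \<theta>)\<^sup>2 / (N \<theta> + \<epsilon>)"
      unfolding h_def N_def norm_vec_sq by (simp add: sum_divide_distrib)
    also have "\<dots> \<le> N \<theta>"
      using N0[of \<theta>] \<epsilon> by (simp add: divide_le_eq power2_eq_square add_nonneg_pos mult_left_mono)
    finally show ?thesis .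
  qed
  have h0: "0 \<le> h i \<theta>" for i \<theta> using N0[of \<theta>] \<epsilon> by (simp add: h_def)
  have hle: "h i \<theta> \<le> N \<theta>" for i \<theta>
    using hsum[of \<theta>] member_le_sum[of i UNIV "\<lambda>i. h i \<theta>"] h0 by auto
  have hi: "integrable circ (h i)" for i
    by (rule Bochner_Integration.integrable_bound[OF Ni hm]) (use hle h0 N0 in \<open>auto intro!: AE_I2\<close>)
  have bi: "2 * pi * (\<Sum>k. (norm (complex_of_real (series_FL F L k $ i $ 1)))\<^sup>2) \<le> (LINT \<theta>|circ. h i \<theta>)" for i
  proof -
    obtain f where f: "f \<in> borel_measurable circ" "integrable circ (\<lambda>t. (norm (f t))\<^sup>2)"
      "2 * pi * (\<Sum>k. (norm (complex_of_real (series_FL F L k $ i $ 1)))\<^sup>2) \<le> (LINT t|circ. (norm (f t))\<^sup>2)"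
      "AE \<theta> in circ. ((\<lambda>r. \<Sum>k. complex_of_real (series_FL F L k $ i $ 1) * (of_real r * cis (- \<theta>)) ^ k) \<longlongrightarrow> f \<theta>) (at_left 1)"
      by (rule H2_boundary[OF sb[of i]])
    have "AE \<theta> in circ. (norm (f \<theta>))\<^sup>2 = h i \<theta>"
      using f(4) freq_AE[OF F] pint_tendsto[OF \<phi>i]
    proof eventually_elim
      case (elim \<theta>)
      have "((\<lambda>r. (norm (\<Sum>k. complex_of_real (series_FL F L k $ i $ 1) * (of_real r * cis (- \<theta>)) ^ k))\<^sup>2) \<longlongrightarrow> (norm (f \<theta>))\<^sup>2) (at_left 1)"
        using elim(1) by (intro tendsto_intros)
      moreover have "((\<lambda>r. (norm (\<Sum>k. complex_of_real (series_FL F L k $ i $ 1) * (of_real r * cis (- \<theta>)) ^ k))\<^sup>2) \<longlongrightarrow> h i \<theta>) (at_left 1)"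
      proof (rule Lim_transform_eventually)
        have "((\<lambda>r. (norm (tfun F (of_real r * cis (- \<theta>)) $ i))\<^sup>2 * exp (- pint \<phi> r \<theta>)) \<longlongrightarrow>
           (norm (freq F \<theta> $ i))\<^sup>2 * exp (- \<phi> \<theta>)) (at_left 1)"
          using elim(2,3) by (intro tendsto_intros)
        moreover have "exp (- \<phi> \<theta>) = inverse (N \<theta> + \<epsilon>)"
          using N0[of \<theta>] \<epsilon> by (simp add: \<phi>_def exp_minus add_nonneg_pos)
        ultimately show "((\<lambda>r. (norm (tfun F (of_real r * cis (- \<theta>)) $ i))\<^sup>2 * exp (- pint \<phi> r \<theta>)) \<longlongrightarrow> h i \<theta>) (at_left 1)"
          by (simp add: h_def divide_inverse)
        show "\<forall>\<^sub>F r in at_left 1. (norm (tfun F (of_real r * cis (- \<theta>)) $ i))\<^sup>2 * exp (- pint \<phi> r \<theta>) =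
           (norm (\<Sum>k. complex_of_real (series_FL F L k $ i $ 1) * (of_real r * cis (- \<theta>)) ^ k))\<^sup>2"
        proof (rule eventually_mono[OF eventually_at_left_real[of 0 1]])
          fix r :: real assume "r \<in> {0<..<1}"
          then have r: "0 \<le> r" "r < 1" by auto
          then have w: "norm (of_real r * cis (- \<theta>)) < 1" by (simp add: norm_mult)
          have "(norm (tfun L (of_real r * cis (- \<theta>)) $ 1))\<^sup>2 = exp (- pint \<phi> r \<theta>)"
            using GL(5)[OF r, of \<theta>] by (simp add: norm_complex_1)
          then show "(norm (tfun F (of_real r * cis (- \<theta>)) $ i))\<^sup>2 * exp (- pint \<phi> r \<theta>) =
             (norm (\<Sum>k. complex_of_real (series_FL F L k $ i $ 1) * (of_real r * cis (- \<theta>)) ^ k))\<^sup>2"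
            unfolding sums_unique[OF series_FL_tfun[OF st GL(2) w, of i 1], symmetric]
            by (simp add: norm_mult power_mult_distrib)
        qed simp
      qed
      ultimately show ?case
        by (rule tendsto_unique[OF trivial_limit_at_left_real])
    qed
    then have "(LINT t|circ. (norm (f t))\<^sup>2) = (LINT \<theta>|circ. h i \<theta>)"
      using f hm by (intro integral_cong_AE) auto
    then show ?thesis using f(3) by simp
  qed
  have "(LINT \<theta>|circ. (norm (tfun F (of_real r * cis (- \<theta>))))\<^sup>2 * exp (- pint \<phi> r \<theta>)) \<le> 2 * pi * (\<Sum>k. (norm (series_FL F L k))\<^sup>2)"
    by (rule abel_le[OF _ sFL r p[OF r]]) simp
  also have "\<dots> = (\<Sum>i\<in>UNIV. 2 * pi * (\<Sum>k. (norm (complex_of_real (series_FL F L k $ i $ 1)))\<^sup>2))"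
    unfolding nsq by (subst suminf_sum[OF sb]) (rule sum_distrib_left)
  also have "\<dots> \<le> (\<Sum>i\<in>UNIV. LINT \<theta>|circ. h i \<theta>)"
    by (rule sum_mono) (rule bi)
  also have "\<dots> = (LINT \<theta>|circ. (\<Sum>i\<in>UNIV. h i \<theta>))"
    by (rule Bochner_Integration.integral_sum[symmetric]) (rule hi)
  also have "\<dots> \<le> (LINT \<theta>|circ. N \<theta>)"
    by (intro integral_mono Bochner_Integration.integrable_sum hi Ni hsum)
  finally show ?thesis by (simp only: \<phi>_def[abs_def] N_def)
qed

theorem outer_system_attains:
  fixes F :: "nat \<Rightarrow> real ^ 'p"
  assumes F: "summable (\<lambda>k. (norm (F k))\<^sup>2)" and pw: "paley_wiener F"
    and I_def: "I = 1 / (2 * pi) * (LINT \<theta>|circ. norm (freq F \<theta>))"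
  obtains G L :: "nat \<Rightarrow> real ^ 1" where "stable_sys G" "stable_sys L" "left_inverse L G"
    "AE \<omega> in circ. (norm (freq G \<omega>))\<^sup>2 = norm (freq F \<omega>)"
    "h2sq G \<le> ennreal I" "h2sq (series_FL F L) \<le> ennreal I"
proof -
  define N where "N t = norm (freq F t)" for t
  define \<phi> where "\<phi> t = ln (N t)" for t
  have N0: "0 \<le> N t" for t by (simp add: N_def)
  have st: "stable_sys F" by (rule l2_imp_stable[OF F])
  have Nm: "N \<in> borel_measurable circ" using borel_measurable_freq[OF F] unfolding N_def[abs_def] by measurable
  have Ni: "integrable circ N" using integrable_norm_freq[OF F] by (simp add: N_def[abs_def])
  have Npos: "AE t in circ. 0 < N t"
    using pw by (simp add: paley_wiener_def AE_circ_iff N_def)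
  have \<phi>i: "integrable circ \<phi>"
    using pw by (simp add: paley_wiener_def integrable_circ_iff \<phi>_def[abs_def] N_def)
  have evenN: "N (- t) = N t" for t by (simp add: N_def norm_freq_minus[OF st])
  have even: "\<phi> (- t) = \<phi> t" for t by (simp add: \<phi>_def evenN)
  have Nexp: "AE t in circ. N t = exp (\<phi> t)"
    using Npos by eventually_elim (simp add: \<phi>_def)
  have I: "2 * pi * I = (LINT \<theta>|circ. N \<theta>)" by (simp add: I_def N_def)
  obtain G L :: "nat \<Rightarrow> real ^ 1" where GL: "stable_sys G" "stable_sys L" "left_inverse L G"
    "\<And>r \<theta>. 0 \<le> r \<Longrightarrow> r < 1 \<Longrightarrow> (norm (tfun G (of_real r * cis (- \<theta>))))\<^sup>2 = exp (pint \<phi> r \<theta>)"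
    "\<And>r \<theta>. 0 \<le> r \<Longrightarrow> r < 1 \<Longrightarrow> (norm (tfun L (of_real r * cis (- \<theta>))))\<^sup>2 = exp (- pint \<phi> r \<theta>)"
    using outer_system[OF \<phi>i even] by metis
  \<comment> \<open>Jensen applies pointwise, and the Poisson integral of \<open>N\<close> has the
    same mean as \<open>N\<close>.\<close>
  have Gle: "(LINT \<theta>|circ. (norm (tfun G (of_real r * cis (- \<theta>))))\<^sup>2) \<le> 2 * pi * I" if r: "0 \<le> r" "r < 1" for r
  proof -
    have "(LINT \<theta>|circ. (norm (tfun G (of_real r * cis (- \<theta>))))\<^sup>2) \<le> (LINT \<theta>|circ. pint N r \<theta>)"
      unfolding GL(4)[OF r]
      by (intro integral_mono exp_pint_le integrable_circ_continuous continuous_intros continuous_pint r \<phi>i even Ni evenN Nexp)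
    then show ?thesis by (simp only: I integral_pint[OF Ni evenN r])
  qed
  have G2: "summable (\<lambda>k. (norm (G k))\<^sup>2)" "(\<Sum>k. (norm (G k))\<^sup>2) \<le> I"
    using abel_bound[OF _ parseval_tfun[OF GL(1)] Gle] by auto
  have "AE \<omega> in circ. (norm (freq G \<omega>))\<^sup>2 = norm (freq F \<omega>)"
    using freq_AE[OF G2(1)] pint_tendsto[OF \<phi>i] Nexp
  proof eventually_elim
    case (elim \<theta>)
    have "((\<lambda>r. (norm (tfun G (of_real r * cis (- \<theta>))))\<^sup>2) \<longlongrightarrow> (norm (freq G \<theta>))\<^sup>2) (at_left 1)"
      using elim(1) by (intro tendsto_intros)
    moreover have "((\<lambda>r. (norm (tfun G (of_real r * cis (- \<theta>))))\<^sup>2) \<longlongrightarrow> N \<theta>) (at_left 1)"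
    proof (rule Lim_transform_eventually)
      show "((\<lambda>r. exp (pint \<phi> r \<theta>)) \<longlongrightarrow> N \<theta>) (at_left 1)"
        unfolding elim(3) using elim(2) by (intro tendsto_intros)
      show "\<forall>\<^sub>F r in at_left 1. exp (pint \<phi> r \<theta>) = (norm (tfun G (of_real r * cis (- \<theta>))))\<^sup>2"
        by (rule eventually_mono[OF eventually_at_left_real[of 0 1]]) (auto simp: GL(4))
    qed
    ultimately show ?case
      unfolding N_def by (rule tendsto_unique[OF trivial_limit_at_left_real])
  qed
  moreover have "h2sq G \<le> ennreal I"
    unfolding h2sq_eq[OF G2(1)] using G2(2) by (rule ennreal_leI)
  moreover have "h2sq (series_FL F L) \<le> ennreal I"
  proof -
    have Fle: "(LINT \<theta>|circ. (norm (tfun F (of_real r * cis (- \<theta>))))\<^sup>2 * (norm (tfun L (of_real r * cis (- \<theta>))))\<^sup>2) \<le> 2 * pi * I"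
      if r: "0 \<le> r" "r < 1" for r
    proof -
      let ?A = "\<lambda>\<theta>. (norm (tfun F (of_real r * cis (- \<theta>))))\<^sup>2"
      \<comment> \<open>The regularisation with \<open>\<epsilon> = 1 / (n + 1)\<close>. Since this
        is at most 1, \<open>\<phi> t \<le> \<psi> n t \<le> N t\<close> wherever
        \<open>N t > 0\<close>, which supplies a majorant independent of \<open>n\<close>.\<close>
      define \<psi> where "\<psi> n t = ln (N t + 1 / real (Suc n))" for n t
      have \<psi>i: "integrable circ (\<psi> n)" for n
        using integrable_ln_freq[OF F, of "1 / real (Suc n)"] by (simp add: \<psi>_def[abs_def] N_def)
      have \<psi>e: "\<psi> n (- t) = \<psi> n t" for n t by (simp add: \<psi>_def evenN)
      have cF: "continuous_on A ?A" for A
        by (intro continuous_intros continuous_tfun_circle st r)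
      have conv: "(\<lambda>n. pint (\<psi> n) r \<theta>) \<longlonglongrightarrow> pint \<phi> r \<theta>" for \<theta>
        unfolding pint_def
      proof (intro tendsto_divide tendsto_const)
        show "(\<lambda>n. LINT t|circ. poisson r (\<theta> - t) * \<psi> n t) \<longlonglongrightarrow> (LINT t|circ. poisson r (\<theta> - t) * \<phi> t)"
        proof (rule integral_dominated_convergence[where w="\<lambda>t. poisson r (\<theta> - t) * (\<bar>\<phi> t\<bar> + N t)"])
          show "(\<lambda>t. poisson r (\<theta> - t) * \<phi> t) \<in> borel_measurable circ"
            by (intro borel_measurable_integrable integrable_poisson_real r \<phi>i)
          show "(\<lambda>t. poisson r (\<theta> - t) * \<psi> n t) \<in> borel_measurable circ" for n
            by (intro borel_measurable_integrable integrable_poisson_real r \<psi>i)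
          show "integrable circ (\<lambda>t. poisson r (\<theta> - t) * (\<bar>\<phi> t\<bar> + N t))"
            by (intro integrable_poisson_real r Bochner_Integration.integrable_add integrable_abs \<phi>i Ni)
          show "AE t in circ. (\<lambda>n. poisson r (\<theta> - t) * \<psi> n t) \<longlonglongrightarrow> poisson r (\<theta> - t) * \<phi> t"
            using Npos
          proof eventually_elim
            case (elim t)
            have "(\<lambda>n. N t + 1 / real (Suc n)) \<longlonglongrightarrow> N t + 0"
              by (intro tendsto_intros LIMSEQ_Suc[OF lim_1_over_n])
            then show ?case
              unfolding \<psi>_def \<phi>_def using elim by (intro tendsto_intros tendsto_ln) auto
          qed
          show "AE t in circ. norm (poisson r (\<theta> - t) * \<psi> n t) \<le> poisson r (\<theta> - t) * (\<bar>\<phi> t\<bar> + N t)" for n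
            using Npos
          proof eventually_elim
            case (elim t)
            have p0: "0 < 1 / real (Suc n)" "1 / real (Suc n) \<le> 1" by auto
            have p1: "0 < N t + 1 / real (Suc n)" "N t \<le> N t + 1 / real (Suc n)"
              using elim p0 by linarith+
            have "\<phi> t \<le> \<psi> n t"
              unfolding \<psi>_def \<phi>_def using ln_le_cancel_iff[OF elim p1(1)] p1(2) by blast
            moreover have "\<psi> n t \<le> (N t + 1 / real (Suc n)) - 1"
              unfolding \<psi>_def by (rule ln_le_minus_one[OF p1(1)])
            ultimately have "\<bar>\<psi> n t\<bar> \<le> \<bar>\<phi> t\<bar> + N t" using elim p0 by linarith
            then show ?case
              using poisson_nonneg[OF r, of "\<theta> - t"] by (simp add: abs_mult mult_left_mono)
          qed
        qed
      qed simp
      \<comment> \<open>Fatou in \<open>n\<close> at fixed \<open>r\<close>; convergence of the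
        Poisson integrals holds at every angle, and the bound does not depend on
        \<open>n\<close>.\<close>
      have "(LINT \<theta>|circ. ?A \<theta> * exp (- pint \<phi> r \<theta>)) \<le> (LINT \<theta>|circ. N \<theta>)"
      proof (rule fatou_integral_bound(2))
        show "integrable circ (\<lambda>\<theta>. ?A \<theta> * exp (- pint (\<psi> n) r \<theta>))" for n
          by (intro integrable_circ_continuous continuous_intros cF continuous_pint \<psi>i \<psi>e r)
        show "(LINT \<theta>|circ. ?A \<theta> * exp (- pint (\<psi> n) r \<theta>)) \<le> (LINT \<theta>|circ. N \<theta>)" for n
          using regularised_bound[OF F _ r, of "1 / real (Suc n)"] by (simp add: \<psi>_def[abs_def] N_def)
        show "(\<lambda>\<theta>. ?A \<theta> * exp (- pint \<phi> r \<theta>)) \<in> borel_measurable circ"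
          by (intro continuous_measurable_circ continuous_intros cF continuous_pint \<phi>i even r)
        show "AE \<theta> in circ. (\<lambda>n. ?A \<theta> * exp (- pint (\<psi> n) r \<theta>)) \<longlonglongrightarrow> ?A \<theta> * exp (- pint \<phi> r \<theta>)"
          by (intro AE_I2 tendsto_intros conv)
      qed simp
      then show ?thesis by (simp only: GL(5)[OF r] I)
    qed
    note b = abel_bound[OF _ parseval_series_FL[OF st GL(2)] Fle, simplified]
    show ?thesis
      unfolding h2sq_eq[OF b(1)] using b(2) by (rule ennreal_leI)
  qed
  ultimately show ?thesis using that GL(1-3) by blast
qed

section \<open>From the product of norms to the mean-squared error\<close>

lemma err_eq: "err k1 \<delta> \<epsilon> F G L = ennreal (k1\<^sup>2 * (kappa \<delta> \<epsilon>)\<^sup>2) * (h2sq G * h2sq (series_FL F L))"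
  by (simp add: err_def mult.assoc)

lemma err_bound_eq:
  "err_bound k1 \<delta> \<epsilon> F = ennreal (k1\<^sup>2 * (kappa \<delta> \<epsilon>)\<^sup>2) *
     ennreal ((1 / (2 * pi) * (LINT \<theta>|circ. norm (freq F \<theta>)))\<^sup>2)"
  by (simp add: err_bound_def integral_circ ennreal_mult)

lemma err_bound_le_err:
  assumes "summable (\<lambda>k. (norm (F k))\<^sup>2)" "stable_sys G" "stable_sys L" "left_inverse L G"
  shows "err_bound k1 \<delta> \<epsilon> F \<le> err k1 \<delta> \<epsilon> F G L"
  unfolding err_bound_eq err_eq by (intro mult_left_mono h2sq_product_ge assms) simp

theorem theorem6:
  fixes F :: "nat \<Rightarrow> real ^ 'p" and k1 \<epsilon> \<delta> :: real
  assumes F_h2: "h2sq F < \<infinity>"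
    and k1: "k1 > 0" and eps: "\<epsilon> > 0" and del: "\<delta> > 0"
  shows "(\<forall>(G :: nat \<Rightarrow> real ^ 'q) (L :: nat \<Rightarrow> real ^ 'q).
            stable_sys G \<and> stable_sys L \<and> left_inverse L G \<longrightarrow>
            err k1 \<delta> \<epsilon> F G L \<ge> err_bound k1 \<delta> \<epsilon> F)
       \<and> (paley_wiener F \<longrightarrow>
            (\<exists>(G :: nat \<Rightarrow> real ^ 1) (L :: nat \<Rightarrow> real ^ 1).
               stable_sys G \<and> stable_sys L \<and> left_inverse L G \<and>
               (AE \<omega> in lborel. \<omega> \<in> {-pi..<pi} \<longrightarrow> (norm (freq G \<omega>))\<^sup>2 = norm (freq F \<omega>)) \<and>
               err k1 \<delta> \<epsilon> F G L = err_bound k1 \<delta> \<epsilon> F))"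
proof -
  have F: "summable (\<lambda>k. (norm (F k))\<^sup>2)" using F_h2 unfolding h2sq_finite_iff .
  define I where "I = 1 / (2 * pi) * (LINT \<theta>|circ. norm (freq F \<theta>))"
  have I0: "0 \<le> I" by (simp add: I_def)
  have "\<exists>(G :: nat \<Rightarrow> real ^ 1) (L :: nat \<Rightarrow> real ^ 1).
               stable_sys G \<and> stable_sys L \<and> left_inverse L G \<and>
               (AE \<omega> in lborel. \<omega> \<in> {-pi..<pi} \<longrightarrow> (norm (freq G \<omega>))\<^sup>2 = norm (freq F \<omega>)) \<and>
               err k1 \<delta> \<epsilon> F G L = err_bound k1 \<delta> \<epsilon> F" if pw: "paley_wiener F"
  proof -
    obtain G L :: "nat \<Rightarrow> real ^ 1" where GL: "stable_sys G" "stable_sys L" "left_inverse L G"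
      "AE \<omega> in circ. (norm (freq G \<omega>))\<^sup>2 = norm (freq F \<omega>)"
      "h2sq G \<le> ennreal I" "h2sq (series_FL F L) \<le> ennreal I"
      by (rule outer_system_attains[OF F pw I_def])
    have "h2sq G * h2sq (series_FL F L) \<le> ennreal (I\<^sup>2)"
      using mult_mono[OF GL(5,6)] I0 by (simp add: power2_eq_square ennreal_mult)
    then have "err k1 \<delta> \<epsilon> F G L \<le> err_bound k1 \<delta> \<epsilon> F"
      unfolding err_bound_eq err_eq I_def by (intro mult_left_mono) auto
    with err_bound_le_err[OF F GL(1-3)] have "err k1 \<delta> \<epsilon> F G L = err_bound k1 \<delta> \<epsilon> F" by (rule antisym[rotated])
    moreover have "AE \<omega> in lborel. \<omega> \<in> {-pi..<pi} \<longrightarrow> (norm (freq G \<omega>))\<^sup>2 = norm (freq F \<omega>)"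
      using GL(4) unfolding AE_circ_iff by eventually_elim auto
    ultimately show ?thesis using GL(1-3) by blast
  qed
  then show ?thesis using err_bound_le_err[OF F] by blast
qed

end
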